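(* Let $\mathbb{W},\mathbb{U}$ be Banach spaces, $T>0$, $\alpha>0$, $\beta\ge 0$, $0<\nu<1$, and let $\mathrm{A}:D(\mathrm{A})\subseteq\mathbb{W}\to\mathbb{W}$ be a closed, densely defined linear operator which is sectorial of angle $\frac{\nu\pi}{2}$ and such that $(\lambda_0\mathrm{I}-\mathrm{A})^{-1}$ is compact for some $\lambda_0\in\rho(\mathrm{A})$. Let $(\mathscr{G}(t))_{t\ge0}$ be the $(\alpha,\beta,\nu)$-resolvent family generated by $\mathrm{A}$, let $\mathrm{B}:\mathbb{U}\to\mathbb{W}$ be a bounded linear operator, and let $\zeta\in\mathbb{W}$. Let $f:[0,T]\times\mathbb{W}\to\mathbb{W}$ satisfy: (i) for a.e. $t\in[0,T]$ the map $f(t,\cdot):\mathbb{W}\to\mathbb{W}$ is continuous, and for each $w\in\mathbb{W}$ the map $t\mapsto f(t,w)$ is strongly measurable on $[0,T]$; (ii) there exists $\gamma\in\mathrm{L}^1([0,T];\mathbb{R}^+)$ such that $\|f(t,w)\|_{\mathbb{W}}\le\gamma(t)$ for a.e. $t\in[0,T]$ and all $w\in\mathbb{W}$. Then for each $u\in\mathrm{L}^2([0,T];\mathbb{U})$ the system $$w'(t)=\mathrm{A}w(t)+\int_0^t\kappa(t-s)\mathrm{A}w(s)\,\mathrm{d}s+\mathrm{B}u(t)+f(t,w(t)),\quad t\in(0,T],\qquad w(0)=\zeta,$$ where $\kappa(t)=\alpha e^{-\beta t}\frac{t^{\nu-1}}{\Gamma(\nu)}$, has at least one mild solution, i.e.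 there exists $w\in C([0,T];\mathbb{W})$ such that $$w(t)=\mathscr{G}(t)\zeta+\int_0^t\mathscr{G}(t-s)\left[\mathrm{B}u(s)+f(s,w(s))\right]\mathrm{d}s,\quad t\in[0,T].$$
   Context: Sectorial operator: $\mathrm{A}$ is sectorial of angle $\theta\in(0,\frac{\pi}{2}]$ if $\Sigma_\theta:=\{\lambda\in\mathbb{C}\setminus\{0\}:|\arg(\lambda)|<\theta+\frac{\pi}{2}\}\subset\rho(\mathrm{A})$ and for each $\omega\in(0,\theta)$ there exists $K_\omega\ge1$ such that $\|(\lambda\mathrm{I}-\mathrm{A})^{-1}\|\le K_\omega/|\lambda|$ for all $0\ne\lambda\in\overline{\Sigma}_{\theta-\omega}$. (If the scalar field is real, resolvent set and resolvents are understood in the complexification.) $(\alpha,\beta,\nu)$-resolvent family: with $\kappa(t)=\alpha e^{-\beta t}\frac{t^{\nu-1}}{\Gamma(\nu)}$, $t>0$, it is the family $(\mathscr{G}(t))_{t\ge0}=(\mathscr{G}_{\alpha,\beta}^{\nu}(t))_{t\ge 0}$ of bounded linear operators on $\mathbb{W}$ such that (a) $\mathscr{G}(\cdot)$ is strongly continuous on $[0,\infty)$ and $\mathscr{G}(0)=\mathrm{I}$; (b) $\mathscr{G}(t)z\in D(\mathrm{A})$ and $\mathscr{G}(t)\mathrm{A}z=\mathrm{A}\mathscr{G}(t)z$ for all $z\in D(\mathrm{A})$, $t\ge0$; (c) $\mathscr{G}(t)z=z+\int_0^t(1+1*\kappa)(t-s)\mathrm{A}\mathscr{G}(s)z\,\mathrm{d}s$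 for all $z\in D(\mathrm{A})$, $t\ge0$, where $(1*\kappa)(t)=\int_0^t\kappa(s)\,\mathrm{d}s$. If $\mathrm{A}$ is sectorial of angle $\frac{\nu\pi}{2}$, such a family exists and is unique. *)

theory Defs
  imports "HOL-Analysis.Analysis"
begin

section \<open>Strong measurability and the Bochner integral\<close>

text \<open>
  The library's Bochner integral requires a second countable range space. The following are the
  same notions for an arbitrary normed range space: in \<open>strong_has_bochner_integral\<close>, Borel
  measurability is replaced by strong measurability. They are meant for complete measures.
\<close>

definition strongly_measurable :: "'a measure \<Rightarrow> ('a \<Rightarrow> 'b::real_normed_vector) \<Rightarrow> bool" where
  "strongly_measurable M f \<longleftrightarrow>
     (\<exists>s. (\<forall>i. simple_function M (s i)) \<and> (AE x in M. (\<lambda>i. s i x) \<longlonglongrightarrow> f x))"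

definition strong_has_bochner_integral ::
    "'a measure \<Rightarrow> ('a \<Rightarrow> 'b::real_normed_vector) \<Rightarrow> 'b \<Rightarrow> bool" where
  "strong_has_bochner_integral M f I \<longleftrightarrow>
     strongly_measurable M f \<and>
     (\<exists>s. (\<forall>i. Bochner_Integration.simple_bochner_integrable M (s i)) \<and>
          ((\<lambda>i. \<integral>\<^sup>+x. norm (f x - s i x) \<partial>M) \<longlonglongrightarrow> 0) \<and>
          ((\<lambda>i. Bochner_Integration.simple_bochner_integral M (s i)) \<longlonglongrightarrow> I))"

section \<open>Banach spaces and operators over the real or complex scalars\<close>

text \<open>
  The scalar field is a set \<open>K\<close> of complex numbers, either \<open>\<real>\<close> or \<open>UNIV\<close>, and \<open>sc\<close> is the scalar
  multiplication, of which only the values \<open>sc a x\<close> with \<open>a \<in> K\<close> matter. It extends the real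
  scalar multiplication of the type; for \<open>K = \<real>\<close> it carries no further information.
\<close>

definition banach_over :: "complex set \<Rightarrow> (complex \<Rightarrow> 'a \<Rightarrow> 'a::banach) \<Rightarrow> bool" where
  "banach_over K sc \<longleftrightarrow>
     (K = \<real> \<or> K = UNIV) \<and>
     (\<forall>a\<in>K. \<forall>x y. sc a (x + y) = sc a x + sc a y) \<and>
     (\<forall>a\<in>K. \<forall>b\<in>K. \<forall>x. sc (a + b) x = sc a x + sc b x) \<and>
     (\<forall>a\<in>K. \<forall>b\<in>K. \<forall>x. sc (a * b) x = sc a (sc b x)) \<and>
     (\<forall>r x. sc (of_real r) x = r *\<^sub>R x) \<and>
     (\<forall>a\<in>K. \<forall>x. norm (sc a x) = cmod a * norm x)"

definition bounded_operator :: "complex set \<Rightarrow> (complex \<Rightarrow> 'a \<Rightarrow> 'a) \<Rightarrow> (complex \<Rightarrow> 'b \<Rightarrow> 'b)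
    \<Rightarrow> ('a::real_normed_vector \<Rightarrow> 'b::real_normed_vector) \<Rightarrow> bool" where
  "bounded_operator K sc sc' B \<longleftrightarrow>
     bounded_linear B \<and> (\<forall>a\<in>K. \<forall>x. B (sc a x) = sc' a (B x))"

text \<open>
  An unbounded operator is given by its domain \<open>D\<close> and a total function \<open>A\<close>, whose values
  outside \<open>D\<close> are irrelevant.
\<close>

definition linear_operator :: "complex set \<Rightarrow> (complex \<Rightarrow> 'a \<Rightarrow> 'a) \<Rightarrow> 'a set
    \<Rightarrow> ('a::real_vector \<Rightarrow> 'a) \<Rightarrow> bool" where
  "linear_operator K sc D A \<longleftrightarrow>
     0 \<in> D \<and>
     (\<forall>x\<in>D. \<forall>y\<in>D. x + y \<in> D \<and> A (x + y) = A x + A y) \<and>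
     (\<forall>a\<in>K. \<forall>x\<in>D. sc a x \<in> D \<and> A (sc a x) = sc a (A x))"

definition closed_operator :: "'a set \<Rightarrow> ('a::topological_space \<Rightarrow> 'a) \<Rightarrow> bool" where
  "closed_operator D A \<longleftrightarrow> closed ((\<lambda>x. (x, A x)) ` D)"

definition densely_defined :: "'a::topological_space set \<Rightarrow> bool" where
  "densely_defined D \<longleftrightarrow> closure D = UNIV"

definition compact_operator :: "('a::metric_space \<Rightarrow> 'b::topological_space) \<Rightarrow> bool" where
  "compact_operator R \<longleftrightarrow> (\<forall>S. bounded S \<longrightarrow> compact (closure (R ` S)))"

section \<open>Resolvents and sectorial operators\<close>

definition resolvent :: "(complex \<Rightarrow> 'v \<Rightarrow> 'v) \<Rightarrow> 'v set \<Rightarrow> ('v \<Rightarrow> 'v) \<Rightarrow> complex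
    \<Rightarrow> 'v::real_normed_vector \<Rightarrow> 'v" where
  "resolvent sc D A l = inv_into D (\<lambda>x. sc l x - A x)"

definition resolvent_set :: "(complex \<Rightarrow> 'v \<Rightarrow> 'v) \<Rightarrow> 'v set
    \<Rightarrow> ('v::real_normed_vector \<Rightarrow> 'v) \<Rightarrow> complex set" where
  "resolvent_set sc D A =
     {l. bij_betw (\<lambda>x. sc l x - A x) D UNIV \<and> bounded_linear (resolvent sc D A l)}"

definition sector :: "real \<Rightarrow> complex set" where
  "sector \<theta> = {l. l \<noteq> 0 \<and> \<bar>Arg l\<bar> < \<theta> + pi / 2}"

text \<open>
  The norm \<open>N\<close> is an argument because the complexification below does not carry the norm of the
  product type.
\<close>

definition sectorial_complex :: "(complex \<Rightarrow> 'v \<Rightarrow> 'v) \<Rightarrow> ('v \<Rightarrow> real) \<Rightarrow> 'v set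
    \<Rightarrow> ('v::real_normed_vector \<Rightarrow> 'v) \<Rightarrow> real \<Rightarrow> bool" where
  "sectorial_complex sc N D A \<theta> \<longleftrightarrow>
     0 < \<theta> \<and> \<theta> \<le> pi / 2 \<and> sector \<theta> \<subseteq> resolvent_set sc D A \<and>
     (\<forall>\<omega>. 0 < \<omega> \<and> \<omega> < \<theta> \<longrightarrow>
        (\<exists>C\<ge>1. \<forall>l \<in> closure (sector (\<theta> - \<omega>)) - {0}.
           \<forall>x. N (resolvent sc D A l x) \<le> C / cmod l * N x))"

text \<open>
  The complexification of a real space consists of the pairs \<open>(x, y)\<close>, standing for \<open>x + i y\<close>,
  with the Taylor norm \<open>sup\<^sub>t \<parallel>Re (e\<^sup>i\<^sup>t (x + i y))\<parallel>\<close>. The norm of the product type is equivalent to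
  it (but not complex homogeneous), so the two define the same bounded sets, bounded operators
  and compact operators.
\<close>

definition cplx_scale :: "complex \<Rightarrow> 'a \<times> 'a \<Rightarrow> 'a \<times> 'a::real_vector" where
  "cplx_scale l = (\<lambda>(x, y). (Re l *\<^sub>R x - Im l *\<^sub>R y, Im l *\<^sub>R x + Re l *\<^sub>R y))"

definition cplx_norm :: "'a::real_normed_vector \<times> 'a \<Rightarrow> real" where
  "cplx_norm = (\<lambda>(x, y). SUP t. norm (cos t *\<^sub>R x - sin t *\<^sub>R y))"

definition sectorial :: "complex set \<Rightarrow> (complex \<Rightarrow> 'a \<Rightarrow> 'a) \<Rightarrow> 'a set
    \<Rightarrow> ('a::real_normed_vector \<Rightarrow> 'a) \<Rightarrow> real \<Rightarrow> bool" where
  "sectorial K sc D A \<theta> \<longleftrightarrow>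
     (if K = UNIV then sectorial_complex sc norm D A \<theta>
      else sectorial_complex cplx_scale cplx_norm (D \<times> D) (map_prod A A) \<theta>)"

definition has_compact_resolvent :: "complex set \<Rightarrow> (complex \<Rightarrow> 'a \<Rightarrow> 'a) \<Rightarrow> 'a set
    \<Rightarrow> ('a::real_normed_vector \<Rightarrow> 'a) \<Rightarrow> bool" where
  "has_compact_resolvent K sc D A \<longleftrightarrow>
     (if K = UNIV then \<exists>l\<in>resolvent_set sc D A. compact_operator (resolvent sc D A l)
      else \<exists>l\<in>resolvent_set cplx_scale (D \<times> D) (map_prod A A).
             compact_operator (resolvent cplx_scale (D \<times> D) (map_prod A A) l))"

section \<open>Resolvent families and mild solutions\<close>

definition kappa :: "real \<Rightarrow> real \<Rightarrow> real \<Rightarrow> real \<Rightarrow> real" where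
  "kappa \<alpha> \<beta> \<nu> t = \<alpha> * exp (- \<beta> * t) * (t powr (\<nu> - 1) / Gamma \<nu>)"

definition one_conv_kappa :: "real \<Rightarrow> real \<Rightarrow> real \<Rightarrow> real \<Rightarrow> real" where
  "one_conv_kappa \<alpha> \<beta> \<nu> t = (LINT s|lebesgue_on {0..t}. kappa \<alpha> \<beta> \<nu> s)"

definition resolvent_family :: "complex set \<Rightarrow> (complex \<Rightarrow> 'a \<Rightarrow> 'a) \<Rightarrow> real \<Rightarrow> real \<Rightarrow> real
    \<Rightarrow> 'a set \<Rightarrow> ('a::real_normed_vector \<Rightarrow> 'a) \<Rightarrow> (real \<Rightarrow> 'a \<Rightarrow> 'a) \<Rightarrow> bool" where
  "resolvent_family K sc \<alpha> \<beta> \<nu> D A G \<longleftrightarrow>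
     (\<forall>t\<ge>0. bounded_operator K sc sc (G t)) \<and>
     (\<forall>z. continuous_on {0..} (\<lambda>t. G t z)) \<and> (\<forall>z. G 0 z = z) \<and>
     (\<forall>z\<in>D. \<forall>t\<ge>0. G t z \<in> D \<and> G t (A z) = A (G t z)) \<and>
     (\<forall>z\<in>D. \<forall>t\<ge>0. \<exists>I.
        strong_has_bochner_integral (lebesgue_on {0..t})
          (\<lambda>s. (1 + one_conv_kappa \<alpha> \<beta> \<nu> (t - s)) *\<^sub>R A (G s z)) I \<and>
        G t z = z + I)"

definition mild_solution :: "real \<Rightarrow> (real \<Rightarrow> 'w \<Rightarrow> 'w) \<Rightarrow> ('u \<Rightarrow> 'w)
    \<Rightarrow> (real \<Rightarrow> 'w \<Rightarrow> 'w) \<Rightarrow> (real \<Rightarrow> 'u) \<Rightarrow> 'w \<Rightarrow> (real \<Rightarrow> 'w::real_normed_vector) \<Rightarrow> bool" where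
  "mild_solution T G B f u \<zeta> w \<longleftrightarrow>
     continuous_on {0..T} w \<and>
     (\<forall>t\<in>{0..T}. \<exists>I.
        strong_has_bochner_integral (lebesgue_on {0..t})
          (\<lambda>s. G (t - s) (B (u s) + f s (w s))) I \<and>
        w t = G t \<zeta> + I)"

end

(*
Write R(m) for the resolvent of A and Q_n = n R(n), a compact operator. The point is the estimate
  t |(I - Q_n) G(t) z| <= C n^(-1/2) |z|   for 0 <= t <= T,
which says that G(t), t > 0, is approximated by compact operators. For z in D(A), the Laplace transform
of the orbit G(.)z cut off at tau = T + 1 equals M(m) z = psi(m) R(m psi(m)) z with
psi = 1 / (1 + Laplace kappa), up to an error of size exp(-tau Re m). Invert it with the Gaussian regularisation
exp(m t + m^2/(2 n^2)) on a vertical line far to the right, where the error is negligible, shift the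
main term back to a fixed line and integrate by parts once: M'(m) (I - Q_n) z is bounded by
C n^(-1/2) |m|^(-3/2) |z|, which is integrable on that line.

Consequently the convolutions of G with functions dominated by a fixed integrable density form a
relatively compact subset of C([0,T]; W). The equations with a delayed argument in f are solved step by
step, and a subsequence of their solutions converges to a mild solution. Over the real
field the estimate is obtained in the complexification and projected back.
*)

theory Submission
  imports Defs "HOL-Probability.Probability" "HOL-Real_Asymp.Real_Asymp" "HOL-Library.Diagonal_Subsequence"
begin

section \<open>Calculus in a complex vector space\<close>

text \<open>The family is assumed strongly continuous only, so no exponential bound, hence no
  Laplace integral over the half line, is at hand. Cutting at \<tau> = T + 1 costs exp (- \<tau> Re
  m), whereas the inversion kernel grows like exp (t Re m) with t <= T; the spare unit makes the
  error vanish once the line moves to the right with n. The multiplier M decays like 1/|m|, which is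
  not integrable on a vertical line. Its derivative decays like |m|^-2, at the price of the factor t
  in the estimate. Half a power of |m| out of this gain is then traded for n^(-1/2): R (m \<psi>) (I
  - Q_n) has one bound of order 1/|m| and one of order 1/n, and their geometric mean is used. The
  contour stays in a half plane where Re m is large; the part of the sector beyond it absorbs the
  rotation of m by \<psi>(m), which is small there. One abstract complex scalar action serves both
  scalar fields. Its norm inequality carries a factor 2, because the product norm on the
  complexification is not complex homogeneous.\<close>

locale complex_action =
  fixes sc :: "complex \<Rightarrow> 'v \<Rightarrow> 'v::banach"
  assumes sc_add_right: "sc a (x + y) = sc a x + sc a y"
    and sc_add_left: "sc (a + b) x = sc a x + sc b x"
    and sc_mult: "sc (a * b) x = sc a (sc b x)"
    and sc_of_real: "sc (of_real r) x = r *\<^sub>R x"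
    and sc_norm: "norm (sc a x) \<le> 2 * cmod a * norm x"
begin

lemma sc_one [simp]: "sc 1 x = x"
  using sc_of_real[of 1 x] by simp

lemma sc_scaleR_right: "sc a (r *\<^sub>R x) = r *\<^sub>R sc a x"
  by (metis sc_of_real sc_mult mult.commute)

lemma sc_scaleR_left: "sc (r *\<^sub>R a) x = r *\<^sub>R sc a x"
  by (simp add: scaleR_conv_of_real sc_mult sc_of_real)

sublocale bounded_bilinear sc
proof
  show "\<exists>K. \<forall>a b. norm (sc a b) \<le> norm a * norm b * K"
    using sc_norm by (intro exI[of _ 2]) (simp add: mult_ac)
qed (auto simp: sc_add_right sc_add_left sc_scaleR_right sc_scaleR_left)

lemma sc_sc_inverse [simp]: "a \<noteq> 0 \<Longrightarrow> sc a (sc (inverse a) x) = x"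
  by (simp flip: sc_mult)

lemma sc_inverse_sc [simp]: "a \<noteq> 0 \<Longrightarrow> sc (inverse a) (sc a x) = x"
  by (simp flip: sc_mult)

lemma integral_sc:
  assumes "f integrable_on S"
  shows "integral S (\<lambda>x. sc a (f x)) = sc a (integral S f)"
  using integral_linear[OF assms bounded_linear_right, of a] by (simp add: o_def)

text \<open>Complex differentiability with respect to \<open>sc\<close>, expressed as a real Frechet
  derivative: the complex structure is a parameter and not a type class instance, and in this form
  the calculus of \<open>has_derivative\<close> applies.\<close>

definition has_sc_derivative :: "(complex \<Rightarrow> 'v) \<Rightarrow> 'v \<Rightarrow> complex \<Rightarrow> bool" where
  "has_sc_derivative F d z \<longleftrightarrow> (F has_derivative (\<lambda>h. sc h d)) (at z)"

text \<open>Division by w - z is the action of its inverse; the linearisation error is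
  \<open>sc (y - z)\<close> applied to the error of the difference quotient.\<close>

lemma has_sc_derivativeI:
  assumes "((\<lambda>w. sc (inverse (w - z)) (F w - F z)) \<longlongrightarrow> d) (at z)"
  shows "has_sc_derivative F d z"
  unfolding has_sc_derivative_def has_derivative_at_within
proof
  show "((\<lambda>y. (F y - F z - sc (y - z) d) /\<^sub>R norm (y - z)) \<longlongrightarrow> 0) (at z)"
  proof (rule Lim_null_comparison)
    show "\<forall>\<^sub>F y in at z. norm ((F y - F z - sc (y - z) d) /\<^sub>R norm (y - z))
        \<le> 2 * norm (sc (inverse (y - z)) (F y - F z) - d)"
      unfolding eventually_at_filter
    proof (intro always_eventually allI impI)
      fix y assume "y \<noteq> z"
      then have "F y - F z - sc (y - z) d = sc (y - z) (sc (inverse (y - z)) (F y - F z) - d)"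
        by (simp add: diff_right)
      then show "norm ((F y - F z - sc (y - z) d) /\<^sub>R norm (y - z))
        \<le> 2 * norm (sc (inverse (y - z)) (F y - F z) - d)"
        using sc_norm[of "y - z" "sc (inverse (y - z)) (F y - F z) - d"] \<open>y \<noteq> z\<close>
        by (simp add: divide_simps mult_ac)
    qed
    show "((\<lambda>y. 2 * norm (sc (inverse (y - z)) (F y - F z) - d)) \<longlongrightarrow> 0) (at z)"
      using assms by (auto intro!: tendsto_eq_intros)
  qed
qed (rule bounded_linear_left)

lemma has_sc_derivative_sc:
  assumes "(p has_field_derivative p') (at z)" "has_sc_derivative F F' z"
  shows "has_sc_derivative (\<lambda>w. sc (p w) (F w)) (sc p' (F z) + sc (p z) F') z"
proof -
  have "sc (p z) (sc h F') + sc (h * p') (F z) = sc h (sc p' (F z) + sc (p z) F')" for h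
    by (simp add: sc_add_right flip: sc_mult) (simp add: mult.commute add.commute)
  with FDERIV[OF assms(1)[unfolded has_field_derivative_def] assms(2)[unfolded has_sc_derivative_def]]
  show ?thesis unfolding has_sc_derivative_def by (simp add: mult.commute)
qed

lemma has_sc_derivative_isCont: "has_sc_derivative F d z \<Longrightarrow> isCont F z"
  unfolding has_sc_derivative_def by (rule has_derivative_continuous)

lemma has_sc_derivative_vertical:
  assumes "has_sc_derivative F d (Complex s y)"
  shows "((\<lambda>y. F (Complex s y)) has_vector_derivative sc \<i> d) (at y within S)"
proof -
  have "((\<lambda>y. Complex s y) has_derivative (\<lambda>h. h *\<^sub>R \<i>)) (at y within S)"
    unfolding Complex_eq by (auto intro!: derivative_eq_intros simp: scaleR_conv_of_real)
  from diff_chain_within[OF this has_derivative_at_withinI[OF assms[unfolded has_sc_derivative_def]]]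
  show ?thesis unfolding has_vector_derivative_def o_def
    by (simp add: sc_scaleR_left)
qed

lemma has_sc_derivative_horizontal:
  assumes "has_sc_derivative F d (Complex s y)"
  shows "((\<lambda>s. F (Complex s y)) has_vector_derivative d) (at s within S)"
proof -
  have "((\<lambda>s. Complex s y) has_derivative (\<lambda>h. of_real h)) (at s within S)"
    unfolding Complex_eq by (auto intro!: derivative_eq_intros)
  from diff_chain_within[OF this has_derivative_at_withinI[OF assms[unfolded has_sc_derivative_def]]]
  show ?thesis unfolding has_vector_derivative_def o_def
    by (simp add: sc_of_real)
qed

text \<open>Along a vertical line the chain rule contributes a factor i, which -i removes.\<close>

lemma integral_vertical:
  assumes "\<And>y. y \<in> {-Y..Y} \<Longrightarrow> has_sc_derivative F (F' (Complex s y)) (Complex s y)" "0 \<le> Y"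
  shows "((\<lambda>y. F' (Complex s y)) has_integral sc (-\<i>) (F (Complex s Y) - F (Complex s (-Y)))) {-Y..Y}"
proof -
  have "((\<lambda>y. sc \<i> (F' (Complex s y))) has_integral (F (Complex s Y) - F (Complex s (-Y)))) {-Y..Y}"
    using assms by (intro fundamental_theorem_of_calculus has_sc_derivative_vertical) auto
  from has_integral_linear[OF this bounded_linear_right[of "-\<i>"]]
  show ?thesis by (simp add: o_def flip: sc_mult)
qed

text \<open>The derivative in \<open>s\<close> of the integral over the vertical segment is a boundary term, because
  the horizontal and vertical derivatives differ by the factor \<open>\<i>\<close>.\<close>

lemma vertical_integral_shift:
  assumes der: "\<And>s y. s \<in> {a..b} \<Longrightarrow> y \<in> {-Y..Y} \<Longrightarrow> has_sc_derivative F (F' (Complex s y)) (Complex s y)"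
    and cont: "continuous_on ({a..b} \<times> {-Y..Y}) (\<lambda>(s, y). F' (Complex s y))"
    and bound: "\<And>s. s \<in> {a..b} \<Longrightarrow> norm (F (Complex s Y)) \<le> B \<and> norm (F (Complex s (-Y))) \<le> B"
    and "0 \<le> Y" "a \<le> b"
  shows "norm (integral {-Y..Y} (\<lambda>y. F (Complex b y)) - integral {-Y..Y} (\<lambda>y. F (Complex a y)))
    \<le> 4 * B * (b - a)"
proof -
  have B: "0 \<le> B" using bound[of a] \<open>a \<le> b\<close> norm_ge_zero[of "F (Complex a Y)"] by (simp del: norm_ge_zero)
  have d: "((\<lambda>s. integral (cbox (-Y) Y) (\<lambda>y. F (Complex s y)))
      has_vector_derivative integral (cbox (-Y) Y) (\<lambda>y. F' (Complex s y))) (at s within {a..b})"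
    if "s \<in> {a..b}" for s
  proof (rule leibniz_rule_vector_derivative[where U="{a..b}" and f="\<lambda>s y. F (Complex s y)" and fx="\<lambda>s y. F' (Complex s y)"])
    show "((\<lambda>s. F (Complex s y)) has_vector_derivative F' (Complex s y)) (at s within {a..b})"
      if "s \<in> {a..b}" "y \<in> cbox (-Y) Y" for s y
      using that by (intro has_sc_derivative_horizontal der) auto
    show "continuous_on ({a..b} \<times> cbox (- Y) Y) (\<lambda>(s, y). F' (Complex s y))"
      using cont by simp
    fix s assume s: "s \<in> {a..b}"
    have "continuous_on (cbox (-Y) Y) (\<lambda>y. F (Complex s y))"
      unfolding continuous_on_eq_continuous_within cbox_interval
    proof
      fix y assume "y \<in> {-Y..Y}"
      show "continuous (at y within {-Y..Y}) (\<lambda>y. F (Complex s y))"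
        by (rule has_vector_derivative_continuous[OF has_sc_derivative_vertical]) (rule der[OF s \<open>y \<in> {-Y..Y}\<close>])
    qed
    then show "(\<lambda>y. F (Complex s y)) integrable_on cbox (-Y) Y"
      by (rule integrable_continuous)
  qed (use that in auto)
  \<comment> \<open>The 4 is a factor 2 for the two ends of the segment times the 2 of
    \<open>sc_norm\<close>.\<close>
  have n: "norm (integral {-Y..Y} (\<lambda>y. F' (Complex s y))) \<le> 4 * B" if s: "s \<in> {a..b}" for s
  proof -
    have "integral {-Y..Y} (\<lambda>y. F' (Complex s y)) = sc (-\<i>) (F (Complex s Y) - F (Complex s (-Y)))"
      using integral_vertical[OF der[OF s] \<open>0 \<le> Y\<close>] by (rule integral_unique)
    also have "norm \<dots> \<le> 2 * norm (F (Complex s Y) - F (Complex s (-Y)))"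
      using sc_norm[of "-\<i>"] by simp
    also have "\<dots> \<le> 4 * B"
      using bound[OF s] norm_triangle_ineq4[of "F (Complex s Y)" "F (Complex s (-Y))"]
      by linarith
    finally show ?thesis .
  qed
  have "norm (integral {-Y..Y} (\<lambda>y. F (Complex b y)) - integral {-Y..Y} (\<lambda>y. F (Complex a y)))
      \<le> (4 * B) * norm (b - a)"
  proof (rule differentiable_bound[where S="{a..b}" and f' = "\<lambda>s h. h *\<^sub>R integral {-Y..Y} (\<lambda>y. F' (Complex s y))"])
    show "onorm (\<lambda>h. h *\<^sub>R integral {-Y..Y} (\<lambda>y. F' (Complex s y))) \<le> 4 * B" if "s \<in> {a..b}" for s
      by (rule onorm_le) (use n[OF that] in \<open>auto simp: mult.commute intro!: mult_left_mono\<close>)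
    show "((\<lambda>s. integral {-Y..Y} (\<lambda>y. F (Complex s y))) has_derivative
        (\<lambda>h. h *\<^sub>R integral {-Y..Y} (\<lambda>y. F' (Complex s y)))) (at s within {a..b})" if "s \<in> {a..b}" for s
      using d[OF that] by (simp add: has_vector_derivative_def)
  qed (use \<open>a \<le> b\<close> in auto)
  then show ?thesis using \<open>a \<le> b\<close> by simp
qed

end

section \<open>The Laplace transform of the kernel\<close>

locale weak_kernel =
  fixes \<alpha> \<beta> \<nu> \<tau> :: real
  assumes \<alpha>: "0 < \<alpha>" and \<beta>: "0 \<le> \<beta>" and \<nu>: "0 < \<nu>" "\<nu> < 1" and \<tau>: "0 < \<tau>"
begin

abbreviation kap :: "real \<Rightarrow> real" where "kap \<equiv> kappa \<alpha> \<beta> \<nu>"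

text \<open>The transform is cut at \<tau> like the orbit. It is therefore entire, and it involves
  \<kappa> only on [0, \<tau>], which is all that the convolution on [0, \<tau>] sees.\<close>

definition khat :: "complex \<Rightarrow> complex" where
  "khat z = integral {0..\<tau>} (\<lambda>s. of_real (kap s) * exp (- z * of_real s))"

definition khat' :: "complex \<Rightarrow> complex" where
  "khat' z = integral {0..\<tau>} (\<lambda>s. - of_real (s * kap s) * exp (- z * of_real s))"

lemma kap_nonneg: "0 \<le> kap s"
  unfolding kappa_def using \<alpha> \<nu> by (simp add: Gamma_real_nonneg)

lemma kap_absolutely_integrable: "kap absolutely_integrable_on {0..x}"
proof (cases "0 \<le> x")
  case True
  have "(\<lambda>s. s powr (\<nu> - 1)) absolutely_integrable_on {0..x}"
    using True \<nu> by (intro nonnegative_absolutely_integrable_1 integrable_on_powr_from_0) auto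
  moreover have "continuous_on {0..x} (\<lambda>s. \<alpha> * exp (- \<beta> * s) / Gamma \<nu>)"
    using \<nu> by (auto intro!: continuous_intros simp: Gamma_real_pos less_imp_neq[symmetric])
  ultimately have "(\<lambda>s. (\<alpha> * exp (- \<beta> * s) / Gamma \<nu>) * s powr (\<nu> - 1)) absolutely_integrable_on {0..x}"
    by (intro absolutely_integrable_bounded_measurable_product_real
        continuous_imp_measurable_on_sets_lebesgue compact_imp_bounded compact_continuous_image) auto
  then show ?thesis by (simp add: kappa_def[abs_def])
qed simp

lemma kap_integrable_on: "kap integrable_on {0..x}"
  using kap_absolutely_integrable absolutely_integrable_on_def by blast

lemma kap_mult_absolutely_integrable:
  fixes g :: "real \<Rightarrow> complex"
  assumes "continuous_on {0..x} g"
  shows "(\<lambda>s. of_real (kap s) * g s) absolutely_integrable_on {0..x}"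
proof -
  have "(\<lambda>s. of_real (kap s) :: complex) absolutely_integrable_on {0..x}"
    using absolutely_integrable_linear[OF kap_absolutely_integrable bounded_linear_of_real]
    by (simp add: o_def)
  then have "(\<lambda>s. g s * of_real (kap s)) absolutely_integrable_on {0..x}"
    using assms by (intro absolutely_integrable_bounded_measurable_product[OF bilinear_times]
        continuous_imp_measurable_on_sets_lebesgue compact_imp_bounded compact_continuous_image) auto
  then show ?thesis by (simp add: mult.commute)
qed

lemma kap_mult_integrable_on:
  fixes g :: "real \<Rightarrow> complex"
  assumes "continuous_on {0..x} g"
  shows "(\<lambda>s. of_real (kap s) * g s) integrable_on {0..x}"
  using kap_mult_absolutely_integrable[OF assms] absolutely_integrable_on_def by blast

text \<open>The factor s turns the singular power s^(\<nu> - 1) into s^\<nu>, which is continuous at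
  0. At s = 0 both sides vanish, since \<open>0 powr \<nu> = 0\<close>.\<close>

lemma mult_kap: "0 \<le> s \<Longrightarrow> s * kap s = \<alpha> / Gamma \<nu> * exp (- \<beta> * s) * s powr \<nu>"
  by (cases "s = 0") (auto simp: kappa_def powr_diff)

lemma continuous_mult_kap: "continuous_on {0..x} (\<lambda>s. s * kap s)"
proof -
  have "continuous_on {0..x} (\<lambda>s. \<alpha> / Gamma \<nu> * exp (- \<beta> * s) * s powr \<nu>)"
    using \<nu> by (intro continuous_intros continuous_on_powr') auto
  then show ?thesis by (rule continuous_on_eq) (auto simp: mult_kap)
qed

lemma khat_norm_le:
  assumes "\<sigma> \<le> Re z"
  shows "cmod (khat z) \<le> integral {0..\<tau>} (\<lambda>s. kap s * exp (- \<sigma> * s))"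
  unfolding khat_def
proof (rule integral_norm_bound_integral)
  show "(\<lambda>s. of_real (kap s) * exp (- z * of_real s)) integrable_on {0..\<tau>}"
    by (intro kap_mult_integrable_on continuous_intros)
  have "(\<lambda>s. Re (of_real (kap s) * of_real (exp (- \<sigma> * s)))) integrable_on {0..\<tau>}"
    using integrable_linear[OF kap_mult_integrable_on[of \<tau> "\<lambda>s. of_real (exp (- \<sigma> * s))"] bounded_linear_Re]
    by (simp add: o_def continuous_intros)
  then show "(\<lambda>s. kap s * exp (- \<sigma> * s)) integrable_on {0..\<tau>}" by simp
  show "cmod (of_real (kap s) * exp (- z * of_real s)) \<le> kap s * exp (- \<sigma> * s)" if "s \<in> {0..\<tau>}" for s
    using that assms kap_nonneg by (auto simp: norm_mult intro!: mult_left_mono mult_right_mono)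
qed

text \<open>The bound \<open>khat_norm_le\<close> involves Re z only, so dominated convergence along
  integer abscissae gives smallness that is uniform in Im z. It makes the argument of 1 / (1 + khat
  z) small.\<close>

lemma khat_small:
  assumes "0 < \<eta>"
  obtains \<sigma> where "1 \<le> \<sigma>" "\<And>z. \<sigma> \<le> Re z \<Longrightarrow> cmod (khat z) \<le> \<eta>"
proof -
  have "(\<lambda>n. integral {0..\<tau>} (\<lambda>s. kap s * exp (- real n * s))) \<longlonglongrightarrow> integral {0..\<tau>} (\<lambda>s. 0)"
  proof (rule dominated_convergence(2))
    show "(\<lambda>s. kap s * exp (- real n * s)) integrable_on {0..\<tau>}" for n
    proof -
      have "(\<lambda>s. Re (of_real (kap s) * of_real (exp (- real n * s)))) integrable_on {0..\<tau>}"
        using integrable_linear[OF kap_mult_integrable_on[of \<tau> "\<lambda>s. of_real (exp (- real n * s))"] bounded_linear_Re]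
        by (simp add: o_def continuous_intros)
      then show ?thesis by simp
    qed
    show "norm (kap s * exp (- real n * s)) \<le> kap s" if "s \<in> {0..\<tau>}" for n s
      using that kap_nonneg[of s] by (auto simp: abs_mult intro!: mult_left_le)
    show "(\<lambda>n. kap s * exp (- real n * s)) \<longlonglongrightarrow> 0" if "s \<in> {0..\<tau>}" for s
    \<comment> \<open>At s = 0 the exponential does not decay, but there \<open>kap 0 = 0\<close>
      because \<open>0 powr (\<nu> - 1) = 0\<close>.\<close>
    proof (cases "s = 0")
      case True
      then show ?thesis by (simp add: kappa_def)
    next
      case False
      then have "0 < s" using that by auto
      then have "(\<lambda>n. exp (- real n * s)) \<longlonglongrightarrow> 0" by real_asymp
      then show ?thesis by (rule tendsto_mult_right_zero)
    qed
  qed (rule kap_integrable_on)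
  then have "\<forall>\<^sub>F n in sequentially. integral {0..\<tau>} (\<lambda>s. kap s * exp (- real n * s)) < \<eta>"
    using assms by (intro order_tendstoD(2)[where y=0]) simp_all
  then have "\<forall>\<^sub>F n in sequentially. integral {0..\<tau>} (\<lambda>s. kap s * exp (- real n * s)) < \<eta> \<and> 1 \<le> n"
    using eventually_ge_at_top[of "1::nat"] by eventually_elim simp
  then obtain n where n: "integral {0..\<tau>} (\<lambda>s. kap s * exp (- real n * s)) < \<eta>" "1 \<le> n"
    using eventually_happens'[OF sequentially_bot] by blast
  show ?thesis
  proof (rule that[of "real n"])
    fix z assume "real n \<le> Re z"
    from khat_norm_le[OF this] n(1) show "cmod (khat z) \<le> \<eta>" by linarith
  qed (use n in simp)
qed

lemma continuous_khat'_integrand: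
  "continuous_on (UNIV \<times> {0..\<tau>}) (\<lambda>(z :: complex, s). - of_real (s * kap s) * exp (- z * of_real s))"
proof -
  have "continuous_on (UNIV \<times> {0..\<tau>}) (\<lambda>x :: complex \<times> real. snd x * kap (snd x))"
    by (rule continuous_on_compose2[OF continuous_mult_kap[of \<tau>]]) (auto intro!: continuous_intros)
  moreover have "continuous_on (UNIV \<times> {0..\<tau>}) (\<lambda>x :: complex \<times> real. exp (- fst x * of_real (snd x)))"
    by (intro continuous_intros)
  ultimately have "continuous_on (UNIV \<times> {0..\<tau>}) (\<lambda>x :: complex \<times> real.
      - of_real (snd x * kap (snd x)) * exp (- fst x * of_real (snd x)))"
    by (intro continuous_on_mult[OF continuous_on_minus[OF continuous_on_of_real]])
  then show ?thesis by (simp add: split_beta)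
qed

text \<open>The Leibniz rule asks for joint continuity of the differentiated integrand. Its factor s
  kap s is continuous up to 0, although kap itself is singular there.\<close>

lemma has_field_derivative_khat: "(khat has_field_derivative khat' z) (at z)"
proof -
  have "((\<lambda>z. integral (cbox 0 \<tau>) (\<lambda>s. of_real (kap s) * exp (- (z * of_real s)))) has_field_derivative
      integral (cbox 0 \<tau>) (\<lambda>s. - (of_real s * of_real (kap s) * exp (- (z * of_real s))))) (at z within UNIV)"
  proof (rule leibniz_rule_field_derivative)
    show "((\<lambda>z. of_real (kap s) * exp (- (z * of_real s))) has_field_derivative
      - (of_real s * of_real (kap s) * exp (- (z * of_real s)))) (at z)" for z s
    by (auto intro!: derivative_eq_intros)
    show "(\<lambda>s. of_real (kap s) * exp (- (z * of_real s))) integrable_on cbox 0 \<tau>" for z :: complex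
      unfolding cbox_interval by (rule kap_mult_integrable_on) (intro continuous_intros)
    show "continuous_on (UNIV \<times> cbox 0 \<tau>) (\<lambda>(z :: complex, s). - (of_real s * of_real (kap s) * exp (- (z * of_real s))))"
      using continuous_khat'_integrand by simp
  qed auto
  then show ?thesis by (simp add: khat_def[abs_def] khat'_def)
qed

lemma continuous_khat': "continuous_on UNIV khat'"
  using integral_continuous_on_param[of UNIV 0 \<tau> "\<lambda>z s. - of_real (s * kap s) * exp (- z * of_real s)"]
    continuous_khat'_integrand unfolding khat'_def[abs_def] cbox_interval by blast

lemma has_real_derivative_mult_kap:
  assumes "0 < s"
  shows "((\<lambda>s. s * kap s) has_real_derivative (\<nu> * kap s - \<beta> * (s * kap s))) (at s)"
proof -
  have "((\<lambda>s. \<alpha> / Gamma \<nu> * exp (- \<beta> * s) * s powr \<nu>) has_real_derivative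
      (\<nu> * kap s - \<beta> * (s * kap s))) (at s)"
  proof -
    have "Gamma \<nu> \<noteq> 0" using \<nu> by (simp add: Gamma_real_pos less_imp_neq[symmetric])
    then show ?thesis
      using assms by (auto intro!: derivative_eq_intros simp: kappa_def powr_diff field_simps)
  qed
  then show ?thesis
    by (rule has_field_derivative_transform_within_open[of _ _ _ "{0<..}"]) (use assms in \<open>auto simp: mult_kap\<close>)
qed

text \<open>Integration by parts: (s kap s)' = (\<nu> - \<beta> s) kap s is again integrable, so z
  khat' z stays bounded. This is what later bounds z \<psi>' z and with it \<mu>'.\<close>

lemma khat'_bound:
  obtains C where "0 \<le> C" "\<And>z. 0 < Re z \<Longrightarrow> cmod (khat' z) \<le> C / cmod z"
proof
  define J where "J = integral {0..\<tau>} kap"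
  have J: "0 \<le> J" unfolding J_def by (intro integral_nonneg kap_integrable_on kap_nonneg)
  \<comment> \<open>The boundary value at \<tau>, plus the integral of the bound (\<nu> + \<beta>
    \<tau>) kap for the derivative of s kap s.\<close>
  define C where "C = \<tau> * kap \<tau> + (\<nu> + \<beta> * \<tau>) * J"
  show "0 \<le> C" using \<tau> \<nu> \<beta> J kap_nonneg unfolding C_def by simp
  show "cmod (khat' z) \<le> C / cmod z" if z: "0 < Re z" for z
  proof -
    define g :: "real \<Rightarrow> complex" where "g s = of_real (\<nu> - \<beta> * s) * exp (- z * of_real s)" for s
    have g: "continuous_on {0..\<tau>} g" unfolding g_def by (intro continuous_intros)
    have "((\<lambda>s. of_real (kap s) * g s - z * (of_real (s * kap s) * exp (- z * of_real s))) has_integral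
       (of_real (\<tau> * kap \<tau>) * exp (- z * of_real \<tau>) - of_real (0 * kap 0) * exp (- z * of_real 0))) {0..\<tau>}"
    proof (rule fundamental_theorem_of_calculus_interior)
      show "continuous_on {0..\<tau>} (\<lambda>s. of_real (s * kap s) * exp (- z * of_real s))"
        by (intro continuous_intros continuous_on_of_real continuous_mult_kap)
      fix s assume s: "s \<in> {0<..<\<tau>}"
      have "((\<lambda>s. of_real (s * kap s) :: complex) has_vector_derivative of_real (\<nu> * kap s - \<beta> * (s * kap s))) (at s)"
        using has_real_derivative_mult_kap[of s] s
        by (intro has_vector_derivative_of_real) (simp add: has_real_derivative_iff_has_vector_derivative)
      moreover have "((\<lambda>s. exp (- z * of_real s)) has_vector_derivative - z * exp (- z * of_real s)) (at s)"
      proof -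
        have "((\<lambda>w. exp (- z * w)) has_field_derivative - z * exp (- z * of_real s)) (at (of_real s))"
          by (auto intro!: derivative_eq_intros)
        then show ?thesis by (rule has_vector_derivative_real_field)
      qed
      ultimately have "((\<lambda>s. of_real (s * kap s) * exp (- z * of_real s)) has_vector_derivative
        of_real (s * kap s) * (- z * exp (- z * of_real s)) + of_real (\<nu> * kap s - \<beta> * (s * kap s)) * exp (- z * of_real s)) (at s)"
        by (rule has_vector_derivative_mult)
      then show "((\<lambda>s. of_real (s * kap s) * exp (- z * of_real s)) has_vector_derivative
          of_real (kap s) * g s - z * (of_real (s * kap s) * exp (- z * of_real s))) (at s)"
        by (rule has_vector_derivative_eq_rhs) (simp add: g_def algebra_simps)
    qed (use \<tau> in auto)
    from has_integral_diff[OF integrable_integral[OF kap_mult_integrable_on[OF g]] this]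
    have "((\<lambda>s. z * (of_real (s * kap s) * exp (- z * of_real s))) has_integral
        (integral {0..\<tau>} (\<lambda>s. of_real (kap s) * g s) - of_real (\<tau> * kap \<tau>) * exp (- z * of_real \<tau>))) {0..\<tau>}"
      by simp
    then have "- (z * khat' z) = integral {0..\<tau>} (\<lambda>s. of_real (kap s) * g s) - of_real (\<tau> * kap \<tau>) * exp (- z * of_real \<tau>)"
      unfolding khat'_def by (auto dest!: integral_unique)
    moreover have "cmod (of_real (\<tau> * kap \<tau>) * exp (- z * of_real \<tau>)) \<le> \<tau> * kap \<tau>"
      using z \<tau> kap_nonneg[of \<tau>] by (simp add: norm_mult abs_mult mult_left_le)
    moreover have "cmod (integral {0..\<tau>} (\<lambda>s. of_real (kap s) * g s)) \<le> integral {0..\<tau>} (\<lambda>s. (\<nu> + \<beta> * \<tau>) * kap s)"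
    proof (rule integral_norm_bound_integral)
      fix s assume s: "s \<in> {0..\<tau>}"
      have "cmod (g s) \<le> \<bar>\<nu> - \<beta> * s\<bar> * 1"
        unfolding g_def norm_mult norm_of_real using s z by (intro mult_left_mono) auto
      also have "\<dots> \<le> \<nu> + \<beta> * \<tau>"
      proof -
        have "0 \<le> \<beta> * s" "\<beta> * s \<le> \<beta> * \<tau>" using s \<beta> by (auto intro: mult_left_mono)
        then show ?thesis using \<nu> by (simp add: abs_le_iff)
      qed
      finally show "cmod (of_real (kap s) * g s) \<le> (\<nu> + \<beta> * \<tau>) * kap s"
        using mult_left_mono[OF _ kap_nonneg[of s], of "cmod (g s)"] kap_nonneg[of s]
        by (simp add: norm_mult mult.commute[of _ "kap s"])
    qed (intro kap_mult_integrable_on[OF g] integrable_on_mult_right kap_integrable_on)+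
    ultimately have "cmod (- (z * khat' z)) \<le> C"
      using norm_triangle_ineq4[of "integral {0..\<tau>} (\<lambda>s. of_real (kap s) * g s)" "of_real (\<tau> * kap \<tau>) * exp (- z * of_real \<tau>)"]
      unfolding C_def J_def by simp
    then have "cmod (z * khat' z) \<le> C" by simp
    moreover have "z \<noteq> 0" using z by auto
    ultimately show ?thesis by (simp add: norm_mult pos_le_divide_eq mult.commute)
  qed
qed

abbreviation mm :: "real \<Rightarrow> real" where "mm t \<equiv> one_conv_kappa \<alpha> \<beta> \<nu> t"

lemma one_conv_kappa_eq: "one_conv_kappa \<alpha> \<beta> \<nu> t = integral {0..t} kap"
  unfolding one_conv_kappa_def
proof (rule lebesgue_integral_eq_integral)
  show "integrable (lebesgue_on {0..t}) kap"
    using kap_absolutely_integrable[of t] by (simp add: integrable_restrict_space set_integrable_def)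
qed simp

lemma continuous_mm: "continuous_on {0..x} mm"
  unfolding one_conv_kappa_eq by (intro indefinite_integral_continuous_1 kap_integrable_on)

lemma mm_bounds: "0 \<le> x \<Longrightarrow> x \<le> \<tau> \<Longrightarrow> 0 \<le> mm x \<and> mm x \<le> mm \<tau>"
  using integral_nonneg[OF kap_integrable_on[of x] kap_nonneg]
    integral_subset_le[OF _ kap_integrable_on[of x] kap_integrable_on[of \<tau>] ballI[OF kap_nonneg]]
  unfolding one_conv_kappa_eq by simp

lemma has_real_derivative_mm: "0 < s \<Longrightarrow> (mm has_real_derivative kap s) (at s)"
proof -
  assume s: "0 < s"
  have "((\<lambda>u. integral {0..u} kap) has_vector_derivative kap s) (at s within {0..s+1} - {})"
  proof (rule integral_has_vector_derivative_continuous_at)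
    have "isCont kap s"
      using s \<nu> unfolding kappa_def[abs_def]
      by (auto simp: Gamma_real_pos less_imp_neq[symmetric] intro!: continuous_intros)
    then show "continuous (at s within {0..s+1} - {}) kap"
      by (rule continuous_at_imp_continuous_at_within)
  qed (use s in \<open>auto intro: kap_integrable_on\<close>)
  then have "((\<lambda>u. integral {0..u} kap) has_vector_derivative kap s) (at s)"
    using s at_within_interior[of s "{0..s+1}"] by simp
  then show ?thesis
    by (simp add: has_real_derivative_iff_has_vector_derivative one_conv_kappa_eq)
qed

text \<open>Without any cut the transform of the running integral of \<kappa> would be khat z / z.
  Cutting at x leaves a boundary term at x and the part of khat beyond x, both of order exp (- x Re
  z). The cut x must be variable, because inside the transformed convolution the inner integral ends
  at \<tau> - s.\<close>

lemma mm_laplace: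
  obtains C where "0 \<le> C" "\<And>z x. 1 \<le> Re z \<Longrightarrow> 0 \<le> x \<Longrightarrow> x \<le> \<tau> \<Longrightarrow>
    cmod (integral {0..x} (\<lambda>r. of_real (mm r) * exp (- z * of_real r)) - khat z / z) \<le> C * exp (- Re z * x)"
proof
  define J where "J = integral {0..\<tau>} kap"
  have J: "0 \<le> J" unfolding J_def by (intro integral_nonneg kap_integrable_on kap_nonneg)
  define C where "C = mm \<tau> + J"
  show "0 \<le> C" using J mm_bounds[of \<tau>] \<tau> unfolding C_def by simp
  fix z :: complex and x :: real
  assume z: "1 \<le> Re z" and x: "0 \<le> x" "x \<le> \<tau>"
  have nz: "1 \<le> cmod z" using z complex_Re_le_cmod[of z] by linarith
  then have z0: "z \<noteq> 0" by auto
  define e where "e s = exp (- z * of_real s)" for s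
  have e: "continuous_on S e" for S unfolding e_def by (intro continuous_intros)
  define I where "I a b = integral {a..b} (\<lambda>s. of_real (kap s) * e s)" for a b
  have int: "(\<lambda>s. of_real (kap s) * e s) integrable_on {0..y}" for y
    by (rule kap_mult_integrable_on[OF e])
  have "((\<lambda>s. of_real (mm s) * (- z * e s) + of_real (kap s) * e s) has_integral
       of_real (mm x) * e x - of_real (mm 0) * e 0) {0..x}"
  proof (rule fundamental_theorem_of_calculus_interior)
    show "continuous_on {0..x} (\<lambda>s. of_real (mm s) * e s)"
      by (intro continuous_on_mult continuous_on_of_real continuous_mm e)
    fix s assume s: "s \<in> {0<..<x}"
    have "((\<lambda>s. of_real (mm s) :: complex) has_vector_derivative of_real (kap s)) (at s)"
      using has_real_derivative_mm[of s] s
      by (intro has_vector_derivative_of_real) (simp add: has_real_derivative_iff_has_vector_derivative)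
    moreover have "(e has_vector_derivative - z * e s) (at s)"
    proof -
      have "((\<lambda>w. exp (- z * w)) has_field_derivative - z * exp (- z * of_real s)) (at (of_real s))"
        by (auto intro!: derivative_eq_intros)
      then show ?thesis unfolding e_def by (rule has_vector_derivative_real_field)
    qed
    ultimately show "((\<lambda>s. of_real (mm s) * e s) has_vector_derivative
        of_real (mm s) * (- z * e s) + of_real (kap s) * e s) (at s)"
      by (rule has_vector_derivative_mult)
  qed (use x in auto)
  from has_integral_diff[OF integrable_integral[OF int] this]
  have "((\<lambda>s. z * (of_real (mm s) * e s)) has_integral (I 0 x - of_real (mm x) * e x)) {0..x}"
    by (simp add: I_def mult_ac one_conv_kappa_eq)
  from has_integral_divide[OF this, of z] z0
  have "((\<lambda>s. of_real (mm s) * e s) has_integral ((I 0 x - of_real (mm x) * e x) / z)) {0..x}"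
    by simp
  then have "integral {0..x} (\<lambda>s. of_real (mm s) * e s) = (I 0 x - of_real (mm x) * e x) / z"
    by (rule integral_unique)
  moreover have "khat z = I 0 x + I x \<tau>"
    using Henstock_Kurzweil_Integration.integral_combine[OF x int]
    by (simp add: khat_def I_def e_def)
  ultimately have eq: "integral {0..x} (\<lambda>s. of_real (mm s) * e s) - khat z / z = - ((of_real (mm x) * e x + I x \<tau>) / z)"
    by (simp add: diff_divide_distrib add_divide_distrib)
  have "cmod (I x \<tau>) \<le> integral {x..\<tau>} (\<lambda>s. exp (- Re z * x) * kap s)"
    unfolding I_def
  proof (rule integral_norm_bound_integral)
    show "(\<lambda>s. of_real (kap s) * e s) integrable_on {x..\<tau>}"
      by (rule integrable_subinterval_real[OF int[of \<tau>]]) (use x in auto)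
    show "(\<lambda>s. exp (- Re z * x) * kap s) integrable_on {x..\<tau>}"
      by (intro integrable_on_mult_right integrable_subinterval_real[OF kap_integrable_on[of \<tau>]]) (use x in auto)
    fix s assume "s \<in> {x..\<tau>}"
    then have "exp (- (Re z * s)) \<le> exp (- Re z * x)" using z by (simp add: mult_left_mono)
    from mult_right_mono[OF this kap_nonneg[of s]]
    show "cmod (of_real (kap s) * e s) \<le> exp (- Re z * x) * kap s"
      using kap_nonneg[of s] by (simp add: norm_mult e_def mult.commute[of "kap s"])
  qed
  also have "\<dots> = exp (- Re z * x) * integral {x..\<tau>} kap"
    by (rule integral_mult_right)
  also have "\<dots> \<le> exp (- Re z * x) * J"
    unfolding J_def using x
    by (intro mult_left_mono integral_subset_le integrable_subinterval_real[OF kap_integrable_on[of \<tau>]] kap_integrable_on ballI kap_nonneg) auto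
  finally have "cmod (I x \<tau>) \<le> exp (- Re z * x) * J" .
  moreover have "cmod (of_real (mm x) * e x) \<le> exp (- Re z * x) * mm \<tau>"
    using mm_bounds[OF x] by (simp add: norm_mult e_def mult.commute[of _ "exp _"] mult_left_mono)
  ultimately have "cmod (of_real (mm x) * e x + I x \<tau>) \<le> C * exp (- Re z * x)"
    using norm_triangle_ineq[of "of_real (mm x) * e x" "I x \<tau>"]
    unfolding C_def distrib_right by (simp add: mult.commute)
  moreover have "cmod (of_real (mm x) * e x + I x \<tau>) / cmod z \<le> cmod (of_real (mm x) * e x + I x \<tau>)"
    using nz mult_left_mono[of 1 "cmod z" "cmod (of_real (mm x) * e x + I x \<tau>)"] z0 by (simp add: divide_le_eq)
  ultimately have "cmod (integral {0..x} (\<lambda>s. of_real (mm s) * e s) - khat z / z) \<le> C * exp (- Re z * x)"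
    unfolding eq norm_minus_cancel norm_divide by linarith
  then show "cmod (integral {0..x} (\<lambda>r. of_real (mm r) * exp (- z * of_real r)) - khat z / z) \<le> C * exp (- Re z * x)"
    unfolding e_def .
qed

text \<open>Outside the intended domain \<open>t \<ge> 0\<close> the function \<open>1 * \<kappa>\<close> is thus the extension by \<open>0\<close>, which makes the
  convolution an integral over the whole of \<open>[0, \<tau>]\<close> with a continuous integrand.\<close>

lemma mm_nonpos: "r \<le> 0 \<Longrightarrow> mm r = 0"
  by (cases "r = 0") (simp_all add: one_conv_kappa_eq)

text \<open>The extension by 0 is r -> mm (max 0 r), and \<open>continuous_mm\<close> covers the
  range of \<open>max 0 r\<close> on every bounded set.\<close>

lemma continuous_mm_UNIV: "continuous_on S mm"
proof -
  have "continuous_on S (\<lambda>r. mm (max 0 r))" if bS: "bounded S" for S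
  proof -
    obtain b where b: "\<And>r. r \<in> S \<Longrightarrow> \<bar>r\<bar> \<le> b" using bS unfolding bounded_real by blast
    show ?thesis
      by (rule continuous_on_compose2[OF continuous_mm[of "max 0 b"]]) (auto intro!: continuous_intros simp: le_max_iff_disj dest!: b)
  qed
  then have "continuous_on (ball x 1) mm" for x
    by (rule continuous_on_eq) (auto simp: max_def mm_nonpos)
  then have "isCont mm x" for x
    by (meson centre_in_ball continuous_on_eq_continuous_at open_ball zero_less_one)
  then show ?thesis by (simp add: continuous_at_imp_continuous_on)
qed

end

section \<open>Gaussian kernels\<close>

text \<open>The factor of |exp (z^2 / (2 n^2))| that depends on Im z; n is its standard deviation,
  and there is no normalisation.\<close>

definition gauss :: "real \<Rightarrow> real \<Rightarrow> real" where
  "gauss n y = exp (- (y\<^sup>2 / (2 * n\<^sup>2)))"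

lemma gauss_nonneg [simp]: "0 \<le> gauss n y"
  by (simp add: gauss_def)

lemma gauss_even [simp]: "gauss n (- y) = gauss n y"
  by (simp add: gauss_def)

lemma continuous_on_gauss: "continuous_on S (gauss n)"
  unfolding gauss_def[abs_def] divide_inverse by (intro continuous_intros)

lemma gauss_eq_normal_density:
  assumes "0 < n"
  shows "gauss n = (\<lambda>y. n * sqrt (2 * pi) * normal_density 0 n y)"
  using assms by (simp add: fun_eq_iff gauss_def normal_density_def real_sqrt_mult)

lemma integrable_gauss: "0 < n \<Longrightarrow> integrable lborel (gauss n)"
  by (simp add: gauss_eq_normal_density)

lemma integral_gauss_moment:
  assumes "0 < n"
  shows "has_bochner_integral lborel (\<lambda>y. gauss n y * y\<^sup>2) (n * sqrt (2 * pi) * n\<^sup>2)"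
  using has_bochner_integral_mult_right[OF normal_moment_even[OF assms, of 0 1], of "n * sqrt (2 * pi)"] assms
  by (simp add: gauss_eq_normal_density field_simps power2_eq_square)

text \<open>Substituting y = n u reduces the integral to the characteristic function of the standard
  normal distribution.\<close>

lemma has_bochner_integral_gauss_fourier:
  assumes n: "0 < n"
  shows "has_bochner_integral lborel (\<lambda>y. of_real (gauss n y) * exp (\<i> * of_real (x * y)))
    (of_real (n * sqrt (2 * pi) * exp (- ((n * x)\<^sup>2 / 2))))"
proof -
  have i: "integrable lborel (\<lambda>y. of_real (gauss n y) * exp (\<i> * of_real (x * y)))"
    by (rule Bochner_Integration.integrable_bound[OF integrable_gauss[OF n]])
       (auto simp: norm_mult gauss_def)
  have "(\<integral>y. of_real (gauss n y) * exp (\<i> * of_real (x * y)) \<partial>lborel)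
      = \<bar>n\<bar> *\<^sub>R (\<integral>u. of_real (gauss n (0 + n * u)) * exp (\<i> * of_real (x * (0 + n * u))) \<partial>lborel)"
    using n by (intro lborel_integral_real_affine) auto
  also have "(\<integral>u. of_real (gauss n (0 + n * u)) * exp (\<i> * of_real (x * (0 + n * u))) \<partial>lborel)
      = of_real (sqrt (2 * pi)) * (\<integral>u. std_normal_density u *\<^sub>R iexp ((n * x) * u) \<partial>lborel)"
    using n by (subst Bochner_Integration.integral_mult_right_zero[symmetric], intro Bochner_Integration.integral_cong)
      (auto simp: gauss_def std_normal_density_def scaleR_conv_of_real power_mult_distrib mult_ac)
  also have "\<dots> = of_real (sqrt (2 * pi)) * char std_normal_distribution (n * x)"
    unfolding char_def by (subst integral_density) auto
  also have "\<bar>n\<bar> *\<^sub>R \<dots> = of_real (n * sqrt (2 * pi) * exp (- ((n * x)\<^sup>2 / 2)))"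
    using n by (simp add: char_std_normal_distribution scaleR_conv_of_real)
  finally show ?thesis using i by (simp add: has_bochner_integral_iff)
qed

lemma integral_Icc_eq_LINT:
  fixes f :: "real \<Rightarrow> 'a::euclidean_space"
  assumes "continuous_on {a..b} f"
  shows "integral {a..b} f = (\<integral>y. indicator {a..b} y *\<^sub>R f y \<partial>lborel)"
  using set_borel_integral_eq_integral(2)[OF borel_integrable_atLeastAtMost'[OF assms]]
  by (simp add: set_lebesgue_integral_def)

text \<open>Outside [-Y, Y] the modulus of the integrand is at most y^2 / Y^2 times itself, so the
  second moment controls the tail. The bound is free of the frequency x, hence can be used for all
  times s at once.\<close>

lemma gauss_fourier_error:
  assumes n: "0 < n" and Y: "0 < Y"
  shows "cmod (integral {-Y..Y} (\<lambda>y. of_real (gauss n y) * exp (\<i> * of_real (x * y)))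
      - of_real (n * sqrt (2 * pi) * exp (- ((n * x)\<^sup>2 / 2)))) \<le> sqrt (2 * pi) * n ^ 3 / Y\<^sup>2"
proof -
  define f where "f y = of_real (gauss n y) * exp (\<i> * of_real (x * y))" for y
  note f = has_bochner_integral_gauss_fourier[OF n, of x, folded f_def]
  have cf: "continuous_on S f" for S
    unfolding f_def by (intro continuous_intros continuous_on_of_real continuous_on_gauss)
  have intf: "integrable lborel f" and If: "integral\<^sup>L lborel f = of_real (n * sqrt (2 * pi) * exp (- ((n * x)\<^sup>2 / 2)))"
    using f by (auto simp: has_bochner_integral_iff)
  have iY: "integrable lborel (\<lambda>y. indicator {-Y..Y} y *\<^sub>R f y)"
    using borel_integrable_atLeastAtMost'[OF cf] by (simp add: set_integrable_def)
  have "integral {-Y..Y} f - integral\<^sup>L lborel f = (\<integral>y. indicator {-Y..Y} y *\<^sub>R f y - f y \<partial>lborel)"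
    using intf iY by (simp add: integral_Icc_eq_LINT[OF cf])
  also have "cmod \<dots> \<le> (\<integral>y. gauss n y * y\<^sup>2 / Y\<^sup>2 \<partial>lborel)"
  proof (rule Bochner_Integration.integral_norm_bound_integral)
    show "integrable lborel (\<lambda>y. indicator {-Y..Y} y *\<^sub>R f y - f y)" using intf iY by simp
    show "integrable lborel (\<lambda>y. gauss n y * y\<^sup>2 / Y\<^sup>2)"
      using integral_gauss_moment[OF n] by (auto simp: has_bochner_integral_iff)
    show "norm (indicator {-Y..Y} y *\<^sub>R f y - f y) \<le> gauss n y * y\<^sup>2 / Y\<^sup>2" for y
    proof (cases "y \<in> {-Y..Y}")
      case False
      then have "Y \<le> \<bar>y\<bar>" by auto
      then have "1 \<le> y\<^sup>2 / Y\<^sup>2" using Y by (metis abs_le_square_iff abs_of_pos divide_le_eq_1_pos le_divide_eq_1_pos zero_less_power2 less_irrefl)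
      from mult_left_mono[OF this gauss_nonneg[of n y]] show ?thesis using False by (simp add: f_def norm_mult)
    qed simp
  qed
  also have "\<dots> = sqrt (2 * pi) * n ^ 3 / Y\<^sup>2"
    using integral_gauss_moment[OF n]
    by (simp add: has_bochner_integral_iff power3_eq_cube power2_eq_square)
  finally show ?thesis unfolding If unfolding f_def .
qed

lemma integral_gauss_le:
  assumes n: "0 < n"
  shows "integral {-Y..Y} (gauss n) \<le> n * sqrt (2 * pi)"
proof -
  have "integral {-Y..Y} (gauss n) = (\<integral>y. indicator {-Y..Y} y *\<^sub>R gauss n y \<partial>lborel)"
    by (rule integral_Icc_eq_LINT[OF continuous_on_gauss])
  also have "\<dots> \<le> (\<integral>y. gauss n y \<partial>lborel)"
    using borel_integrable_atLeastAtMost'[OF continuous_on_gauss] integrable_gauss[OF n]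
    by (intro integral_mono) (auto simp: set_integrable_def indicator_def)
  also have "\<dots> = n * sqrt (2 * pi)"
    using n by (simp add: gauss_eq_normal_density)
  finally show ?thesis .
qed

lemma has_bochner_integral_normal_density_moment2:
  assumes "0 < \<sigma>"
  shows "has_bochner_integral lborel (\<lambda>s. normal_density t \<sigma> s * (s - t)\<^sup>2) (\<sigma>\<^sup>2)"
  using normal_moment_even[OF assms, of t 1] assms by simp

text \<open>The densities form an approximate identity; the mass away from t is controlled by the
  variance, as in Chebyshev's inequality.\<close>

lemma normal_density_mollify:
  fixes F :: "real \<Rightarrow> 'a::banach"
  assumes F: "continuous_on {0..\<tau>} F" and t: "0 < t" "t < \<tau>"
  shows "(\<lambda>n. integral {0..\<tau>} (\<lambda>s. normal_density t (1 / real (Suc n)) s *\<^sub>R F s)) \<longlonglongrightarrow> F t"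
proof (rule LIMSEQ_I)
  fix \<epsilon> :: real assume "0 < \<epsilon>"
  obtain B where B: "\<And>s. s \<in> {0..\<tau>} \<Longrightarrow> norm (F s) \<le> B"
    using compact_imp_bounded[OF compact_continuous_image[OF F compact_Icc]] by (fastforce simp: bounded_iff)
  have B0: "0 \<le> B" using B[of t] t norm_ge_zero[of "F t"] by (simp del: norm_ge_zero)
  obtain d where d: "0 < d" "\<And>s. s \<in> {0..\<tau>} \<Longrightarrow> dist s t < d \<Longrightarrow> dist (F s) (F t) < \<epsilon> / 2"
    using F t \<open>0 < \<epsilon>\<close> unfolding continuous_on_iff by (metis atLeastAtMost_iff half_gt_zero less_eq_real_def)
  \<comment> \<open>The window of radius d' around t stays inside [0, \<tau>], so all mass lost
    outside [0, \<tau>] is far from t.\<close>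
  define d' where "d' = min d (min t (\<tau> - t))"
  have d': "0 < d'" "d' \<le> d" "d' \<le> t" "d' \<le> \<tau> - t" using d t by (auto simp: d'_def)
  \<comment> \<open>A share 2 B for the points of [0, \<tau>] far from t, and B for the mass lost
    outside [0, \<tau>].\<close>
  define C where "C = 3 * B / d'\<^sup>2"
  have C: "0 \<le> C" using B0 by (simp add: C_def)
  have "norm (integral {0..\<tau>} (\<lambda>s. normal_density t \<sigma> s *\<^sub>R F s) - F t) \<le> \<epsilon> / 2 + C * \<sigma>\<^sup>2"
    if \<sigma>: "0 < \<sigma>" for \<sigma>
  proof -
    let ?g = "normal_density t \<sigma>"
    note m = has_bochner_integral_normal_density_moment2[OF \<sigma>, of t]
    have cg: "continuous_on S ?g" for S
      unfolding normal_density_def[abs_def] divide_inverse by (intro continuous_intros)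
    have ig: "?g integrable_on {0..\<tau>}" by (intro integrable_continuous_interval cg)
    have igF: "(\<lambda>s. ?g s *\<^sub>R (F s - F t)) integrable_on {0..\<tau>}"
      by (intro integrable_continuous_interval continuous_intros cg F)
    define I where "I = integral {0..\<tau>} ?g"
    have i1: "integrable lborel (\<lambda>s. indicator {0..\<tau>} s *\<^sub>R (?g s * h s))" if "continuous_on {0..\<tau>} h" for h
      using borel_integrable_atLeastAtMost'[OF continuous_on_mult[OF cg that]] by (simp add: set_integrable_def)
    have far: "1 \<le> (s - t)\<^sup>2 / d'\<^sup>2" if "d' \<le> \<bar>s - t\<bar>" for s
      using that d' power_mono[of d' "\<bar>s - t\<bar>" 2] by simp
    have "\<bar>1 - I\<bar> \<le> \<sigma>\<^sup>2 / d'\<^sup>2"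
    proof -
      have "I - 1 = (\<integral>s. indicator {0..\<tau>} s *\<^sub>R (?g s) - ?g s \<partial>lborel)"
        using integral_Icc_eq_LINT[OF cg, of 0 \<tau>] i1[of "\<lambda>_. 1"] \<sigma> unfolding I_def by (simp add: integrable_normal_density integral_normal_density)
      also have "\<bar>\<dots>\<bar> \<le> (\<integral>s. ?g s * (s - t)\<^sup>2 / d'\<^sup>2 \<partial>lborel)"
        unfolding real_norm_def[symmetric]
      proof (rule Bochner_Integration.integral_norm_bound_integral)
        show "integrable lborel (\<lambda>s. indicator {0..\<tau>} s *\<^sub>R ?g s - ?g s)" using i1[of "\<lambda>_. 1"] \<sigma> by simp
        show "integrable lborel (\<lambda>s. ?g s * (s - t)\<^sup>2 / d'\<^sup>2)" using m by (auto simp: has_bochner_integral_iff)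
        show "norm (indicator {0..\<tau>} s *\<^sub>R ?g s - ?g s) \<le> ?g s * (s - t)\<^sup>2 / d'\<^sup>2" for s
        proof (cases "s \<in> {0..\<tau>}")
          case False
          then have "d' \<le> \<bar>s - t\<bar>" using d' by auto
          from mult_left_mono[OF far[OF this] normal_density_nonneg[of t \<sigma> s]] show ?thesis using False by simp
        qed simp
      qed
      also have "\<dots> = \<sigma>\<^sup>2 / d'\<^sup>2" using m by (simp add: has_bochner_integral_iff)
      finally show ?thesis by (simp add: abs_minus_commute)
    qed
    have "norm (integral {0..\<tau>} (\<lambda>s. ?g s *\<^sub>R (F s - F t))) \<le> integral {0..\<tau>} (\<lambda>s. ?g s * (\<epsilon> / 2 + 2 * B * (s - t)\<^sup>2 / d'\<^sup>2))"
    proof (rule integral_norm_bound_integral[OF igF])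
      show "(\<lambda>s. ?g s * (\<epsilon> / 2 + 2 * B * (s - t)\<^sup>2 / d'\<^sup>2)) integrable_on {0..\<tau>}"
        by (intro integrable_continuous_interval continuous_intros cg) (use d' in auto)
      fix s assume s: "s \<in> {0..\<tau>}"
      have "norm (F s - F t) \<le> \<epsilon> / 2 + 2 * B * (s - t)\<^sup>2 / d'\<^sup>2"
      proof (cases "\<bar>s - t\<bar> < d'")
        case True
        then have "norm (F s - F t) < \<epsilon> / 2" using d(2)[OF s] d' by (simp add: dist_norm)
        then show ?thesis using B0 by (simp add: add_increasing2)
      next
        case False
        have "norm (F s - F t) \<le> 2 * B" using B[OF s] B[of t] t norm_triangle_ineq4[of "F s" "F t"] by simp
        also have "\<dots> \<le> 2 * B * ((s - t)\<^sup>2 / d'\<^sup>2)" using mult_left_mono[OF far, of s "2 * B"] False B0 by simp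
        finally show ?thesis using \<open>0 < \<epsilon>\<close> by simp
      qed
      then show "norm (?g s *\<^sub>R (F s - F t)) \<le> ?g s * (\<epsilon> / 2 + 2 * B * (s - t)\<^sup>2 / d'\<^sup>2)"
        by (simp add: mult_left_mono)
    qed
    also have "\<dots> \<le> (\<integral>s. ?g s * (\<epsilon> / 2) + ?g s * (s - t)\<^sup>2 * (2 * B / d'\<^sup>2) \<partial>lborel)"
    proof (subst integral_Icc_eq_LINT)
      show "continuous_on {0..\<tau>} (\<lambda>s. ?g s * (\<epsilon> / 2 + 2 * B * (s - t)\<^sup>2 / d'\<^sup>2))"
        by (intro continuous_intros cg) (use d' in auto)
      show "(\<integral>s. indicator {0..\<tau>} s *\<^sub>R (?g s * (\<epsilon> / 2 + 2 * B * (s - t)\<^sup>2 / d'\<^sup>2)) \<partial>lborel)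
        \<le> (\<integral>s. ?g s * (\<epsilon> / 2) + ?g s * (s - t)\<^sup>2 * (2 * B / d'\<^sup>2) \<partial>lborel)"
      proof (rule integral_mono)
        show "integrable lborel (\<lambda>s. indicator {0..\<tau>} s *\<^sub>R (?g s * (\<epsilon> / 2 + 2 * B * (s - t)\<^sup>2 / d'\<^sup>2)))"
          by (intro i1 continuous_intros) (use d' in auto)
        show "integrable lborel (\<lambda>s. ?g s * (\<epsilon> / 2) + ?g s * (s - t)\<^sup>2 * (2 * B / d'\<^sup>2))"
          using m \<sigma> by (auto simp: has_bochner_integral_iff)
        show "indicator {0..\<tau>} s *\<^sub>R (?g s * (\<epsilon> / 2 + 2 * B * (s - t)\<^sup>2 / d'\<^sup>2))
          \<le> ?g s * (\<epsilon> / 2) + ?g s * (s - t)\<^sup>2 * (2 * B / d'\<^sup>2)" for s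
          using \<open>0 < \<epsilon>\<close> B0 by (auto simp: indicator_def algebra_simps)
      qed
    qed
    also have "\<dots> = \<epsilon> / 2 + \<sigma>\<^sup>2 * (2 * B / d'\<^sup>2)"
      using m \<sigma> by (simp add: has_bochner_integral_iff)
    finally have 1: "norm (integral {0..\<tau>} (\<lambda>s. ?g s *\<^sub>R (F s - F t))) \<le> \<epsilon> / 2 + \<sigma>\<^sup>2 * (2 * B / d'\<^sup>2)" .
    have "integral {0..\<tau>} (\<lambda>s. ?g s *\<^sub>R F s) = integral {0..\<tau>} (\<lambda>s. ?g s *\<^sub>R (F s - F t) + ?g s *\<^sub>R F t)"
      by (simp add: algebra_simps)
    also have "\<dots> = integral {0..\<tau>} (\<lambda>s. ?g s *\<^sub>R (F s - F t)) + I *\<^sub>R F t"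
      using ig igF integral_linear[OF ig bounded_linear_scaleR_left[of "F t"]]
      by (subst Henstock_Kurzweil_Integration.integral_add)
         (auto simp: I_def o_def intro!: integrable_continuous_interval continuous_intros cg)
    finally have "integral {0..\<tau>} (\<lambda>s. ?g s *\<^sub>R F s) - F t
        = integral {0..\<tau>} (\<lambda>s. ?g s *\<^sub>R (F s - F t)) - (1 - I) *\<^sub>R F t"
      by (simp add: algebra_simps)
    also have "norm \<dots> \<le> (\<epsilon> / 2 + \<sigma>\<^sup>2 * (2 * B / d'\<^sup>2)) + (\<sigma>\<^sup>2 / d'\<^sup>2) * B"
      using 1 \<open>\<bar>1 - I\<bar> \<le> _\<close> B[of t] t B0
      using mult_mono[OF \<open>\<bar>1 - I\<bar> \<le> _\<close>, of "norm (F t)" B]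
      by (intro order_trans[OF norm_triangle_ineq4] add_mono) auto
    also have "\<dots> = \<epsilon> / 2 + C * \<sigma>\<^sup>2" by (simp add: C_def field_simps)
    finally show ?thesis .
  qed
  moreover have "(\<lambda>n. \<epsilon> / 2 + C * (1 / real (Suc n))\<^sup>2) \<longlonglongrightarrow> \<epsilon> / 2 + C * 0"
    by (intro tendsto_intros) real_asymp
  then have "\<forall>\<^sub>F n in sequentially. \<epsilon> / 2 + C * (1 / real (Suc n))\<^sup>2 < \<epsilon>"
    using \<open>0 < \<epsilon>\<close> by (intro order_tendstoD(2)[where y="\<epsilon> / 2 + C * 0"]) auto
  then obtain N where "\<And>n. n \<ge> N \<Longrightarrow> \<epsilon> / 2 + C * (1 / real (Suc n))\<^sup>2 < \<epsilon>"
    by (auto simp: eventually_sequentially)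
  ultimately show "\<exists>N. \<forall>n\<ge>N. norm (integral {0..\<tau>} (\<lambda>s. normal_density t (1 / real (Suc n)) s *\<^sub>R F s) - F t) < \<epsilon>"
    by (meson le_less_trans of_nat_0_less_iff zero_less_Suc zero_less_divide_1_iff)
qed

section \<open>Resolvents\<close>

text \<open>The resolvent enters as a two-sided inverse R with decay on S in the norm of the type,
  so that the same arguments serve when sectoriality is stated in another, equivalent norm.\<close>

locale sc_resolvent = complex_action sc for sc :: "complex \<Rightarrow> 'v \<Rightarrow> 'v::banach" +
  fixes D :: "'v set" and A :: "'v \<Rightarrow> 'v" and R :: "complex \<Rightarrow> 'v \<Rightarrow> 'v"
    and S :: "complex set" and C\<^sub>R :: real
  assumes D_add: "x \<in> D \<Longrightarrow> y \<in> D \<Longrightarrow> x + y \<in> D"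
    and A_add: "x \<in> D \<Longrightarrow> y \<in> D \<Longrightarrow> A (x + y) = A x + A y"
    and D_sc: "x \<in> D \<Longrightarrow> sc a x \<in> D"
    and A_sc: "x \<in> D \<Longrightarrow> A (sc a x) = sc a (A x)"
    and R_D: "m \<in> S \<Longrightarrow> R m x \<in> D"
    and R_right: "m \<in> S \<Longrightarrow> sc m (R m x) - A (R m x) = x"
    and R_left: "m \<in> S \<Longrightarrow> x \<in> D \<Longrightarrow> R m (sc m x - A x) = x"
    and R_norm: "m \<in> S \<Longrightarrow> norm (R m x) \<le> C\<^sub>R / cmod m * norm x"
    and C\<^sub>R: "0 \<le> C\<^sub>R" and zero_notin: "0 \<notin> S"
begin

lemma R_eqI: "m \<in> S \<Longrightarrow> y \<in> D \<Longrightarrow> sc m y - A y = x \<Longrightarrow> R m x = y"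
  using R_left by blast

lemma R_add:
  assumes m: "m \<in> S"
  shows "R m (x + y) = R m x + R m y"
proof (rule R_eqI[OF m])
  show "R m x + R m y \<in> D" by (intro D_add R_D m)
  show "sc m (R m x + R m y) - A (R m x + R m y) = x + y"
    using R_right[OF m, of x] R_right[OF m, of y]
    by (simp add: A_add R_D m sc_add_right algebra_simps)
qed

lemma R_sc:
  assumes m: "m \<in> S"
  shows "R m (sc a x) = sc a (R m x)"
proof (rule R_eqI[OF m])
  show "sc a (R m x) \<in> D" by (intro D_sc R_D m)
  have "sc m (sc a (R m x)) = sc a (sc m (R m x))"
    by (metis mult.commute sc_mult)
  then have "sc m (sc a (R m x)) - A (sc a (R m x)) = sc a (sc m (R m x) - A (R m x))"
    by (simp add: A_sc R_D m diff_right)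
  then show "sc m (sc a (R m x)) - A (sc a (R m x)) = sc a x"
    by (simp add: R_right m)
qed

lemma bounded_linear_R:
  assumes m: "m \<in> S"
  shows "bounded_linear (R m)"
proof (rule bounded_linear_intro[where K="C\<^sub>R / cmod m"])
  show "R m (r *\<^sub>R x) = r *\<^sub>R R m x" for r x
    using R_sc[OF m, of "of_real r" x] by (simp add: sc_of_real)
  show "norm (R m x) \<le> norm x * (C\<^sub>R / cmod m)" for x
    using R_norm[OF m, of x] by (simp add: mult.commute)
qed (rule R_add[OF m])

lemma resolvent_identity:
  assumes "m \<in> S" "l \<in> S"
  shows "R m x - R l x = sc (l - m) (R m (R l x))"
proof -
  interpret Rm: bounded_linear "R m" by (rule bounded_linear_R[OF assms(1)])
  have "R l x = R m (sc m (R l x) - A (R l x))"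
    using assms by (simp add: R_left R_D)
  also have "sc m (R l x) - A (R l x) = sc (m - l) (R l x) + x"
    using R_right[OF assms(2), of x] by (simp add: diff_left algebra_simps)
  finally have "R l x = sc (m - l) (R m (R l x)) + R m x"
    by (simp add: Rm.add R_sc assms)
  then show ?thesis by (simp add: diff_left algebra_simps)
qed

lemma R_A: "m \<in> S \<Longrightarrow> x \<in> D \<Longrightarrow> R m (A x) = sc m (R m x) - x"
  using R_left[of m x] linear_diff[OF bounded_linear.linear[OF bounded_linear_R], of m "sc m x" "A x"]
  by (simp add: R_sc algebra_simps)

end

section \<open>The Laplace multiplier of the Volterra equation on a half plane\<close>

locale volterra_resolvent = sc_resolvent sc D A R S C\<^sub>R + weak_kernel \<alpha> \<beta> \<nu> \<tau>
  for sc :: "complex \<Rightarrow> 'v \<Rightarrow> 'v::banach" and D A R S C\<^sub>R and \<alpha> \<beta> \<nu> \<tau> +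
  fixes \<sigma>\<^sub>0 :: real
  assumes \<sigma>\<^sub>0: "1 \<le> \<sigma>\<^sub>0"
    and khat_half: "\<sigma>\<^sub>0 < Re z \<Longrightarrow> cmod (khat z) \<le> 1 / 2"
    and mu_S: "\<sigma>\<^sub>0 < Re z \<Longrightarrow> z * inverse (1 + khat z) \<in> S"
begin

definition H where "H = {z. \<sigma>\<^sub>0 < Re z}"

lemma open_H: "open H"
  unfolding H_def by (intro open_Collect_less continuous_intros)

lemma H_norm: "z \<in> H \<Longrightarrow> 1 \<le> cmod z"
  using \<sigma>\<^sub>0 complex_Re_le_cmod[of z] unfolding H_def by simp

text \<open>Transforming condition (c) formally gives z v = x + (1 + khat z) A v. Multiplied by
  \<psi> z this becomes (\<mu> z - A) v = \<psi> z x, which the resolvent at \<mu> z solves. The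
  primed functions are the derivatives.\<close>

definition \<psi> where "\<psi> z = inverse (1 + khat z)"
definition \<psi>' where "\<psi>' z = - khat' z * \<psi> z * \<psi> z"
definition \<mu> where "\<mu> z = z * \<psi> z"
definition \<mu>' where "\<mu>' z = \<psi> z + z * \<psi>' z"

lemma one_plus_khat:
  assumes "z \<in> H"
  shows "1 + khat z \<noteq> 0" "1 / 2 \<le> cmod (1 + khat z)" "cmod (1 + khat z) \<le> 3 / 2"
proof -
  show 2: "1 / 2 \<le> cmod (1 + khat z)"
    using khat_half[of z] assms norm_diff_ineq[of 1 "khat z"] by (simp add: H_def)
  show "cmod (1 + khat z) \<le> 3 / 2"
    using khat_half[of z] assms norm_triangle_ineq[of 1 "khat z"] by (simp add: H_def)
  show "1 + khat z \<noteq> 0" using 2 by auto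
qed

lemma \<psi>_bounds:
  assumes "z \<in> H"
  shows "cmod (\<psi> z) \<le> 2" "1 / 2 \<le> cmod (\<psi> z)" "\<psi> z \<noteq> 0"
proof -
  note * = one_plus_khat[OF assms]
  show "cmod (\<psi> z) \<le> 2"
    using le_imp_inverse_le[OF *(2)] by (simp add: \<psi>_def norm_inverse)
  show "1 / 2 \<le> cmod (\<psi> z)"
    using le_imp_inverse_le[OF *(3)] * by (simp add: \<psi>_def norm_inverse)
  show "\<psi> z \<noteq> 0" using * by (simp add: \<psi>_def)
qed

lemma \<mu>_in: "z \<in> H \<Longrightarrow> \<mu> z \<in> S"
  using mu_S by (auto simp: H_def \<mu>_def \<psi>_def)

lemma \<mu>_norm: "z \<in> H \<Longrightarrow> cmod z / 2 \<le> cmod (\<mu> z)"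
  using mult_left_mono[OF \<psi>_bounds(2), of z "cmod z"] by (simp add: \<mu>_def norm_mult)

lemma has_field_derivative_\<psi>: "z \<in> H \<Longrightarrow> (\<psi> has_field_derivative \<psi>' z) (at z)"
  unfolding \<psi>_def[abs_def] \<psi>'_def using one_plus_khat(1)[of z]
  by (auto intro!: derivative_eq_intros has_field_derivative_khat simp: \<psi>_def field_simps)

lemma has_field_derivative_\<mu>: "z \<in> H \<Longrightarrow> (\<mu> has_field_derivative \<mu>' z) (at z)"
  unfolding \<mu>_def[abs_def] \<mu>'_def
  by (auto intro!: derivative_eq_intros has_field_derivative_\<psi>)

lemma continuous_\<psi>: "continuous_on H \<psi>"
  using has_field_derivative_\<psi> DERIV_isCont continuous_at_imp_continuous_on by blast

lemma continuous_\<psi>': "continuous_on H \<psi>'"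
  unfolding \<psi>'_def[abs_def]
  by (intro continuous_intros continuous_\<psi> continuous_on_subset[OF continuous_khat']) auto

lemma continuous_\<mu>': "continuous_on H \<mu>'"
  unfolding \<mu>'_def[abs_def] by (intro continuous_intros continuous_\<psi> continuous_\<psi>')

definition Rm where "Rm z x = R (\<mu> z) x"

lemma bounded_linear_Rm: "z \<in> H \<Longrightarrow> bounded_linear (Rm z)"
  unfolding Rm_def by (intro bounded_linear_R \<mu>_in)

lemma Rm_norm:
  assumes "z \<in> H"
  shows "norm (Rm z x) \<le> 2 * C\<^sub>R / cmod z * norm x"
proof -
  have "norm (Rm z x) \<le> C\<^sub>R / cmod (\<mu> z) * norm x"
    unfolding Rm_def by (rule R_norm[OF \<mu>_in[OF assms]])
  also have "C\<^sub>R / cmod (\<mu> z) \<le> C\<^sub>R / (cmod z / 2)"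
    using \<mu>_norm[OF assms] C\<^sub>R H_norm[OF assms] by (intro divide_left_mono mult_pos_pos) auto
  finally show ?thesis by (simp add: mult_right_mono mult.commute)
qed

lemma Rm_norm': "z \<in> H \<Longrightarrow> norm (Rm z x) \<le> 2 * C\<^sub>R * norm x"
proof -
  assume z: "z \<in> H"
  have "2 * C\<^sub>R / cmod z \<le> 2 * C\<^sub>R" using H_norm[OF z] C\<^sub>R by (simp add: divide_le_eq mult_le_cancel_left1)
  from order_trans[OF Rm_norm[OF z] mult_right_mono[OF this norm_ge_zero]] show ?thesis .
qed

text \<open>By the resolvent identity the difference is \<mu> z - \<mu> w acting on a product of
  uniformly bounded resolvents.\<close>

lemma tendsto_Rm:
  assumes z: "z \<in> H"
  shows "((\<lambda>w. Rm w x) \<longlongrightarrow> Rm z x) (at z)"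
proof (rule LIM_zero_cancel, rule Lim_null_comparison)
  show "\<forall>\<^sub>F w in at z. norm (Rm w x - Rm z x) \<le> 2 * cmod (\<mu> z - \<mu> w) * (2 * C\<^sub>R * norm (Rm z x))"
    using eventually_at_in_open'[OF open_H z]
  proof eventually_elim
    fix w assume w: "w \<in> H"
    have "Rm w x - Rm z x = sc (\<mu> z - \<mu> w) (Rm w (Rm z x))"
      unfolding Rm_def by (intro resolvent_identity \<mu>_in w z)
    also have "norm \<dots> \<le> 2 * cmod (\<mu> z - \<mu> w) * norm (Rm w (Rm z x))" by (rule sc_norm)
    also have "\<dots> \<le> 2 * cmod (\<mu> z - \<mu> w) * (2 * C\<^sub>R * norm (Rm z x))"
      by (intro mult_left_mono Rm_norm' w) auto
    finally show "norm (Rm w x - Rm z x) \<le> 2 * cmod (\<mu> z - \<mu> w) * (2 * C\<^sub>R * norm (Rm z x))" .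
  qed
  have "(\<mu> \<longlongrightarrow> \<mu> z) (at z)"
    using DERIV_isCont[OF has_field_derivative_\<mu>[OF z]] by (simp add: isCont_def)
  then have "((\<lambda>w. 2 * cmod (\<mu> z - \<mu> w) * (2 * C\<^sub>R * norm (Rm z x))) \<longlongrightarrow>
      2 * cmod (\<mu> z - \<mu> z) * (2 * C\<^sub>R * norm (Rm z x))) (at z)"
    by (intro tendsto_intros)
  then show "((\<lambda>w. 2 * cmod (\<mu> z - \<mu> w) * (2 * C\<^sub>R * norm (Rm z x))) \<longlongrightarrow> 0) (at z)" by simp
qed

lemma tendsto_Rm_Rm:
  assumes z: "z \<in> H"
  shows "((\<lambda>w. Rm w (Rm w x)) \<longlongrightarrow> Rm z (Rm z x)) (at z)"
proof -
  have "((\<lambda>w. Rm w (Rm w x - Rm z x)) \<longlongrightarrow> 0) (at z)"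
  proof (rule Lim_null_comparison)
    show "\<forall>\<^sub>F w in at z. norm (Rm w (Rm w x - Rm z x)) \<le> 2 * C\<^sub>R * norm (Rm w x - Rm z x)"
      using eventually_at_in_open'[OF open_H z] by eventually_elim (rule Rm_norm')
    show "((\<lambda>w. 2 * C\<^sub>R * norm (Rm w x - Rm z x)) \<longlongrightarrow> 0) (at z)"
      using tendsto_Rm[OF z, of x] by (intro tendsto_mult_right_zero tendsto_norm_zero LIM_zero)
  qed
  from tendsto_add[OF this tendsto_Rm[OF z, of "Rm z x"]]
  have "((\<lambda>w. Rm w (Rm w x - Rm z x) + Rm w (Rm z x)) \<longlongrightarrow> Rm z (Rm z x)) (at z)" by simp
  then show ?thesis
  proof (rule Lim_transform_eventually)
    show "\<forall>\<^sub>F w in at z. Rm w (Rm w x - Rm z x) + Rm w (Rm z x) = Rm w (Rm w x)"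
      using eventually_at_in_open'[OF open_H z]
      by eventually_elim (simp add: linear_diff[OF bounded_linear.linear[OF bounded_linear_Rm]])
  qed
qed

text \<open>The chain rule for R after \<mu> with R' = - R^2, obtained from the resolvent identity
  at the level of difference quotients.\<close>

lemma has_sc_derivative_Rm:
  assumes z: "z \<in> H"
  shows "has_sc_derivative (\<lambda>w. Rm w x) (sc (- \<mu>' z) (Rm z (Rm z x))) z"
proof (rule has_sc_derivativeI)
  have "((\<lambda>w. (\<mu> w - \<mu> z) / (w - z)) \<longlongrightarrow> \<mu>' z) (at z)"
    using has_field_derivative_\<mu>[OF z] by (simp add: has_field_derivative_iff)
  from tendsto[OF tendsto_minus[OF this] tendsto_Rm[OF z, of "Rm z x"]]
  show "((\<lambda>w. sc (inverse (w - z)) (Rm w x - Rm z x)) \<longlongrightarrow> sc (- \<mu>' z) (Rm z (Rm z x))) (at z)"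
  proof (rule Lim_transform_eventually)
    show "\<forall>\<^sub>F w in at z. sc (- ((\<mu> w - \<mu> z) / (w - z))) (Rm w (Rm z x)) = sc (inverse (w - z)) (Rm w x - Rm z x)"
      using eventually_at_in_open'[OF open_H z]
    proof eventually_elim
      fix w assume w: "w \<in> H"
      have "Rm w x - Rm z x = sc (\<mu> z - \<mu> w) (Rm w (Rm z x))"
        unfolding Rm_def by (intro resolvent_identity \<mu>_in w z)
      moreover have "- ((\<mu> w - \<mu> z) / (w - z)) = inverse (w - z) * (\<mu> z - \<mu> w)"
        by (simp add: divide_inverse algebra_simps)
      ultimately show "sc (- ((\<mu> w - \<mu> z) / (w - z))) (Rm w (Rm z x)) = sc (inverse (w - z)) (Rm w x - Rm z x)"
        by (simp only: sc_mult)
    qed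
  qed
qed

definition M where "M x z = sc (\<psi> z) (Rm z x)"
definition M' where "M' x z = sc (\<psi>' z) (Rm z x) - sc (\<psi> z * \<mu>' z) (Rm z (Rm z x))"

lemma has_sc_derivative_M: "z \<in> H \<Longrightarrow> has_sc_derivative (M x) (M' x z) z"
  using has_sc_derivative_sc[OF has_field_derivative_\<psi> has_sc_derivative_Rm, of z x]
  by (simp add: M_def[abs_def] M'_def minus_left minus_right sc_mult)

lemma continuous_M: "continuous_on H (M x)"
  using has_sc_derivative_M has_sc_derivative_isCont continuous_at_imp_continuous_on by blast

lemma continuous_M': "continuous_on H (M' x)"
proof -
  have "continuous_on H (\<lambda>w. Rm w x)" "continuous_on H (\<lambda>w. Rm w (Rm w x))"
    using tendsto_Rm tendsto_Rm_Rm by (auto intro!: continuous_at_imp_continuous_on simp: isCont_def)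
  from continuous_on_diff[OF continuous_on[OF continuous_\<psi>' this(1)]
      continuous_on[OF continuous_on_mult[OF continuous_\<psi> continuous_\<mu>'] this(2)]]
  show ?thesis unfolding M'_def[abs_def] .
qed

lemma M_bound: "z \<in> H \<Longrightarrow> norm (M x z) \<le> 8 * C\<^sub>R * norm x"
proof -
  assume z: "z \<in> H"
  have "norm (M x z) \<le> 2 * cmod (\<psi> z) * norm (Rm z x)" unfolding M_def by (rule sc_norm)
  also have "\<dots> \<le> (2 * 2) * (2 * C\<^sub>R * norm x)"
    using \<psi>_bounds[OF z] by (intro mult_mono Rm_norm' z) (auto simp: C\<^sub>R)
  finally show ?thesis by simp
qed

text \<open>One factor \<open>Rm z x\<close> is deliberately left unestimated: for x = Q n y - y it
  will supply the factor n^(-1/2). The other factor 1/|z| comes from \<psi>' in the first term and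
  from the second resolvent in the other.\<close>

lemma M'_bound:
  obtains C where "0 \<le> C" "\<And>z x. z \<in> H \<Longrightarrow> norm (M' x z) \<le> C / cmod z * norm (Rm z x)"
proof -
  obtain C where C: "0 \<le> C" "\<And>z. 0 < Re z \<Longrightarrow> cmod (khat' z) \<le> C / cmod z"
    using khat'_bound by blast
  show ?thesis
  proof (rule that[of "8 * C + 8 * (2 + 4 * C) * C\<^sub>R"])
    show "0 \<le> 8 * C + 8 * (2 + 4 * C) * C\<^sub>R" using C C\<^sub>R by simp
    fix z x assume z: "z \<in> H"
    have z1: "1 \<le> cmod z" by (rule H_norm[OF z])
    have c: "cmod (\<psi> z) \<le> 2" by (rule \<psi>_bounds[OF z])
    have "cmod (khat' z) \<le> C / cmod z" using z \<sigma>\<^sub>0 by (intro C) (auto simp: H_def)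
    then have "cmod (\<psi>' z) \<le> (C / cmod z) * 2 * 2"
      unfolding \<psi>'_def norm_mult norm_minus_cancel using C c by (intro mult_mono) auto
    then have c': "cmod (\<psi>' z) \<le> 4 * C / cmod z" by simp
    have "cmod (z * \<psi>' z) \<le> 4 * C"
      using mult_left_mono[OF c' norm_ge_zero[of z]] z1 by (simp add: norm_mult split: if_splits)
    then have m': "cmod (\<mu>' z) \<le> 2 + 4 * C"
      unfolding \<mu>'_def using c norm_triangle_ineq[of "\<psi> z" "z * \<psi>' z"] by linarith
    have "norm (sc (\<psi>' z) (Rm z x)) \<le> 2 * (4 * C / cmod z) * norm (Rm z x)"
      by (rule order_trans[OF sc_norm]) (intro mult_right_mono mult_left_mono c', auto)
    moreover have "norm (sc (\<psi> z * \<mu>' z) (Rm z (Rm z x))) \<le> 2 * (2 * (2 + 4 * C)) * (2 * C\<^sub>R / cmod z * norm (Rm z x))"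
    proof (rule order_trans[OF sc_norm])
      have "cmod (\<psi> z * \<mu>' z) \<le> 2 * (2 + 4 * C)"
        unfolding norm_mult using C by (intro mult_mono c m') auto
      then show "2 * cmod (\<psi> z * \<mu>' z) * norm (Rm z (Rm z x)) \<le> 2 * (2 * (2 + 4 * C)) * (2 * C\<^sub>R / cmod z * norm (Rm z x))"
        using C by (intro mult_mono Rm_norm z) auto
    qed
    ultimately have "norm (M' x z) \<le> 2 * (4 * C / cmod z) * norm (Rm z x) + 2 * (2 * (2 + 4 * C)) * (2 * C\<^sub>R / cmod z * norm (Rm z x))"
      unfolding M'_def using norm_triangle_ineq4[of "sc (\<psi>' z) (Rm z x)" "sc (\<psi> z * \<mu>' z) (Rm z (Rm z x))"] by linarith
    also have "\<dots> = (8 * C + 8 * (2 + 4 * C) * C\<^sub>R) / cmod z * norm (Rm z x)"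
      by (simp add: add_divide_distrib distrib_right)
    finally show "norm (M' x z) \<le> (8 * C + 8 * (2 + 4 * C) * C\<^sub>R) / cmod z * norm (Rm z x)" .
  qed
qed

section \<open>Truncated Laplace transforms and the transformed equation\<close>

definition laplace :: "(real \<Rightarrow> 'v) \<Rightarrow> complex \<Rightarrow> 'v" where
  "laplace f z = integral {0..\<tau>} (\<lambda>s. sc (exp (- z * of_real s)) (f s))"

text \<open>Since mm vanishes at negative arguments, the triangle s <= t can be filled up to a
  square with a continuous integrand, to which Fubini applies. The substitution r = t - s then
  leaves the range [0, \<tau> - s] for the inner integral.\<close>

lemma laplace_convolution:
  assumes b: "continuous_on {0..\<tau>} b"
  shows "laplace (\<lambda>t. integral {0..t} (\<lambda>s. mm (t - s) *\<^sub>R b s)) z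
    = integral {0..\<tau>} (\<lambda>s. sc (exp (- z * of_real s) * integral {0..\<tau> - s} (\<lambda>r. of_real (mm r) * exp (- z * of_real r))) (b s))"
proof -
  define e where "e t = exp (- z * of_real t)" for t
  have e: "continuous_on X e" for X unfolding e_def by (intro continuous_intros)
  have "laplace (\<lambda>t. integral {0..t} (\<lambda>s. mm (t - s) *\<^sub>R b s)) z
      = integral {0..\<tau>} (\<lambda>t. integral {0..\<tau>} (\<lambda>s. sc (of_real (mm (t - s)) * e t) (b s)))"
    unfolding laplace_def e_def[symmetric]
  proof (rule Henstock_Kurzweil_Integration.integral_cong)
    fix t assume t: "t \<in> {0..\<tau>}"
    have int: "(\<lambda>s. mm (t - s) *\<^sub>R b s) integrable_on {0..\<tau>}"
      by (intro integrable_continuous_interval continuous_on_scaleR b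
          continuous_on_compose2[OF continuous_mm_UNIV[of UNIV]] continuous_intros) auto
    have "integral {t..\<tau>} (\<lambda>s. mm (t - s) *\<^sub>R b s) = integral {t..\<tau>} (\<lambda>s. 0)"
      by (rule Henstock_Kurzweil_Integration.integral_cong) (simp add: mm_nonpos)
    then have "integral {0..t} (\<lambda>s. mm (t - s) *\<^sub>R b s) = integral {0..\<tau>} (\<lambda>s. mm (t - s) *\<^sub>R b s)"
      using Henstock_Kurzweil_Integration.integral_combine[OF _ _ int, of t] t by simp
    then show "sc (e t) (integral {0..t} (\<lambda>s. mm (t - s) *\<^sub>R b s))
      = integral {0..\<tau>} (\<lambda>s. sc (of_real (mm (t - s)) * e t) (b s))"
      by (simp add: integral_sc[OF int, symmetric] sc_mult sc_of_real sc_scaleR_right)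
  qed
  also have "\<dots> = integral {0..\<tau>} (\<lambda>s. integral {0..\<tau>} (\<lambda>t. sc (of_real (mm (t - s)) * e t) (b s)))"
  proof -
    have "continuous_on (cbox (0, 0) (\<tau>, \<tau>)) (\<lambda>(t, s). sc (of_real (mm (t - s)) * e t) (b s))"
      unfolding split_beta
    proof (rule continuous_on)
      show "continuous_on (cbox (0, 0) (\<tau>, \<tau>)) (\<lambda>x. of_real (mm (fst x - snd x)) * e (fst x))"
        by (intro continuous_on_mult continuous_on_of_real continuous_on_compose2[OF continuous_mm_UNIV[of UNIV]]
            continuous_on_compose2[OF e[of UNIV]] continuous_intros) auto
      show "continuous_on (cbox (0, 0) (\<tau>, \<tau>)) (\<lambda>x. b (snd x))"
        by (rule continuous_on_compose2[OF b]) (auto intro!: continuous_intros simp: cbox_Pair_eq)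
    qed
    from integral_swap_continuous[OF this] show ?thesis by (simp add: cbox_interval)
  qed
  also have "\<dots> = integral {0..\<tau>} (\<lambda>s. sc (e s * integral {0..\<tau> - s} (\<lambda>r. of_real (mm r) * e r)) (b s))"
  proof (rule Henstock_Kurzweil_Integration.integral_cong)
    fix s assume s: "s \<in> {0..\<tau>}"
    have c: "continuous_on X (\<lambda>t. of_real (mm (t - s)) * e t)" for X
      by (intro continuous_on_mult continuous_on_of_real continuous_on_compose2[OF continuous_mm_UNIV[of UNIV]]
          e continuous_intros) auto
    have int: "(\<lambda>t. of_real (mm (t - s)) * e t) integrable_on {0..\<tau>}"
      by (intro integrable_continuous_interval c)
    have "integral {0..\<tau>} (\<lambda>t. sc (of_real (mm (t - s)) * e t) (b s)) = sc (integral {0..\<tau>} (\<lambda>t. of_real (mm (t - s)) * e t)) (b s)"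
      using integral_linear[OF int bounded_linear_left[of "b s"]] by (simp add: o_def)
    also have "integral {0..\<tau>} (\<lambda>t. of_real (mm (t - s)) * e t) = integral {s..\<tau>} (\<lambda>t. of_real (mm (t - s)) * e t)"
    proof -
      have "integral {0..s} (\<lambda>t. of_real (mm (t - s)) * e t) = integral {0..s} (\<lambda>t. 0)"
        by (rule Henstock_Kurzweil_Integration.integral_cong) (simp add: mm_nonpos)
      then show ?thesis using Henstock_Kurzweil_Integration.integral_combine[OF _ _ int, of s] s by simp
    qed
    also have "\<dots> = integral {0..\<tau> - s} (\<lambda>r. of_real (mm r) * e (r + s))"
      using integral_shift[where a=0 and b="\<tau> - s" and c=s and f="\<lambda>t. of_real (mm (t - s)) * e t"] c by (simp add: o_def)
    also have "(\<lambda>r. of_real (mm r) * e (r + s)) = (\<lambda>r. e s * (of_real (mm r) * e r))"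
    proof
      have "- z * of_real (r + s) = - z * of_real s + - z * of_real r" for r by (simp add: distrib_left)
      then have "e (r + s) = e s * e r" for r unfolding e_def by (simp only: exp_add)
      then show "of_real (mm r) * e (r + s) = e s * (of_real (mm r) * e r)" for r by simp
    qed
    also have "integral {0..\<tau> - s} \<dots> = e s * integral {0..\<tau> - s} (\<lambda>r. of_real (mm r) * e r)"
      by (rule integral_mult_right)
    finally show "integral {0..\<tau>} (\<lambda>t. sc (of_real (mm (t - s)) * e t) (b s))
      = sc (e s * integral {0..\<tau> - s} (\<lambda>r. of_real (mm r) * e r)) (b s)" .
  qed
  finally show ?thesis unfolding e_def .
qed

text \<open>Integration by parts; unlike for a transform over the half line, the boundary term at
  \<tau> survives.\<close>

lemma laplace_integral:
  assumes b: "continuous_on {0..\<tau>} b" and z: "z \<noteq> 0"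
  shows "laplace (\<lambda>t. integral {0..t} b) z = sc (1 / z) (laplace b z - sc (exp (- z * of_real \<tau>)) (integral {0..\<tau>} b))"
proof -
  define e where "e t = exp (- z * of_real t)" for t
  have e: "continuous_on X e" for X unfolding e_def by (intro continuous_intros)
  define Q where "Q t = integral {0..t} b" for t
  have bi: "b integrable_on {0..\<tau>}" by (rule integrable_continuous_interval[OF b])
  have Q: "continuous_on {0..\<tau>} Q" unfolding Q_def by (rule indefinite_integral_continuous_1[OF bi])
  have 1: "(\<lambda>t. sc (e t) (Q t)) integrable_on {0..\<tau>}" and 2: "(\<lambda>t. sc (e t) (b t)) integrable_on {0..\<tau>}"
    by (intro integrable_continuous_interval continuous_on e Q b)+
  have "((\<lambda>t. sc (e t) (b t) + sc (- z * e t) (Q t)) has_integral (sc (e \<tau>) (Q \<tau>) - sc (e 0) (Q 0))) {0..\<tau>}"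
  proof (rule fundamental_theorem_of_calculus)
    fix t assume t: "t \<in> {0..\<tau>}"
    have "(Q has_vector_derivative b t) (at t within {0..\<tau>})"
      unfolding Q_def by (rule integral_has_vector_derivative[OF b t])
    moreover have "(e has_vector_derivative - z * e t) (at t within {0..\<tau>})"
    proof -
      have "((\<lambda>w. exp (- z * w)) has_field_derivative - z * exp (- z * of_real t)) (at (of_real t))"
        by (auto intro!: derivative_eq_intros)
      from has_vector_derivative_at_within[OF has_vector_derivative_real_field[OF this]]
      show ?thesis unfolding e_def .
    qed
    ultimately show "((\<lambda>t. sc (e t) (Q t)) has_vector_derivative sc (e t) (b t) + sc (- z * e t) (Q t)) (at t within {0..\<tau>})"
      by (intro has_vector_derivative)
  qed (use \<tau> in simp)
  then have "integral {0..\<tau>} (\<lambda>t. sc (e t) (b t) + sc (- z) (sc (e t) (Q t))) = sc (e \<tau>) (Q \<tau>)"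
    by (auto simp: Q_def zero_right dest!: integral_unique simp flip: sc_mult)
  also have "integral {0..\<tau>} (\<lambda>t. sc (e t) (b t) + sc (- z) (sc (e t) (Q t)))
      = laplace b z + sc (- z) (laplace Q z)"
    unfolding laplace_def e_def[symmetric]
    using 1 2 integrable_linear[OF 1 bounded_linear_right[of "-z"]]
    by (simp add: Henstock_Kurzweil_Integration.integral_add integral_sc o_def)
  finally have "sc z (laplace Q z) = laplace b z - sc (e \<tau>) (Q \<tau>)"
    by (simp add: minus_left algebra_simps)
  then have "sc (1 / z) (sc z (laplace Q z)) = sc (1 / z) (laplace b z - sc (e \<tau>) (Q \<tau>))" by simp
  then show ?thesis using z by (simp add: Q_def[abs_def] e_def flip: sc_mult)
qed

text \<open>Truncating the orbit at \<open>\<tau>\<close> spoils the Laplace transformed equation only by terms of size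
  \<open>exp (- \<tau> * Re z)\<close>, so no exponential bound for the orbit is required.\<close>

lemma laplace_representation:
  assumes v: "continuous_on {0..\<tau>} v" and b: "continuous_on {0..\<tau>} b"
    and D: "\<And>s. s \<in> {0..\<tau>} \<Longrightarrow> v s \<in> D" and Av: "\<And>s. s \<in> {0..\<tau>} \<Longrightarrow> A (v s) = b s"
    and eq: "\<And>t. t \<in> {0..\<tau>} \<Longrightarrow> v t = x + integral {0..t} b + integral {0..t} (\<lambda>s. mm (t - s) *\<^sub>R b s)"
  obtains K where "0 \<le> K" "\<And>z. z \<in> H \<Longrightarrow> norm (laplace v z - M x z) \<le> K * exp (- \<tau> * Re z)"
proof -
  obtain C where C: "0 \<le> C" "\<And>z x. 1 \<le> Re z \<Longrightarrow> 0 \<le> x \<Longrightarrow> x \<le> \<tau> \<Longrightarrow>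
    cmod (integral {0..x} (\<lambda>r. of_real (mm r) * exp (- z * of_real r)) - khat z / z) \<le> C * exp (- Re z * x)"
    using mm_laplace by blast
  obtain B where B: "\<And>s. s \<in> {0..\<tau>} \<Longrightarrow> norm (b s) \<le> B"
    using compact_imp_bounded[OF compact_continuous_image[OF b compact_Icc]] by (fastforce simp: bounded_iff)
  have B0: "0 \<le> B" using B[of 0] \<tau> norm_ge_zero[of "b 0"] by (simp del: norm_ge_zero)
  \<comment> \<open>The cut transforms of the constant x and of the primitive of b both leave a
    boundary term at \<tau>; together these are - exp (- z \<tau>) / z acting on y.\<close>
  define y where "y = x + integral {0..\<tau>} b"
  \<comment> \<open>The factor \<open>2 * C\<^sub>R\<close> is the cost of \<mu> z times the
    resolvent. The bracket bounds all truncation errors: \<open>2 * norm y\<close> for the boundary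
    terms, \<open>2 * C * B * \<tau>\<close> for the error of \<open>mm_laplace\<close> integrated
    against b.\<close>
  define K where "K = 2 * C\<^sub>R * (2 * norm y + 2 * C * B * \<tau>)"
  show ?thesis
  proof (rule that[of K])
    show "0 \<le> K" using C\<^sub>R C B0 \<tau> by (simp add: K_def)
    fix z assume z: "z \<in> H"
    have z1: "1 \<le> cmod z" "z \<noteq> 0" using H_norm[OF z] by auto
    have Rez: "1 \<le> Re z" using z \<sigma>\<^sub>0 by (simp add: H_def)
    define e where "e t = exp (- z * of_real t)" for t
    have e: "continuous_on X e" for X unfolding e_def by (intro continuous_intros)
    define \<Theta> where "\<Theta> u = integral {0..u} (\<lambda>r. of_real (mm r) * e r)" for u
    have cm: "continuous_on X (\<lambda>r. of_real (mm r) * e r)" for X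
      by (intro continuous_on_mult continuous_on_of_real continuous_mm_UNIV e)
    have \<Theta>: "continuous_on {0..\<tau>} (\<lambda>s. \<Theta> (\<tau> - s))"
      by (rule continuous_on_compose2[of "{0..\<tau>}" \<Theta>])
         (auto simp: \<Theta>_def intro!: continuous_intros indefinite_integral_continuous_1 integrable_continuous_interval cm)
    define W where "W t = integral {0..t} (\<lambda>s. mm (t - s) *\<^sub>R b s)" for t
    define q where "q = laplace b z"
    define p where "p = laplace v z"
    have W: "continuous_on {0..\<tau>} W"
    proof -
      have "continuous_on {0..\<tau>} (\<lambda>t. v t - x - integral {0..t} b)"
        by (intro continuous_intros v indefinite_integral_continuous_1 integrable_continuous_interval b)
      then show ?thesis by (rule continuous_on_eq) (simp add: eq W_def)
    qed
    have Q: "continuous_on {0..\<tau>} (\<lambda>t. integral {0..t} b)"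
      by (intro indefinite_integral_continuous_1 integrable_continuous_interval b)
    have i: "(\<lambda>t. sc (e t) (h t)) integrable_on {0..\<tau>}" if "continuous_on {0..\<tau>} h" for h
      by (intro integrable_continuous_interval continuous_on e that)
    have "p = integral {0..\<tau>} (\<lambda>t. sc (e t) x + sc (e t) (integral {0..t} b) + sc (e t) (W t))"
      unfolding p_def laplace_def e_def[symmetric]
      by (rule Henstock_Kurzweil_Integration.integral_cong) (simp add: eq W_def sc_add_right)
    also have "\<dots> = laplace (\<lambda>_. x) z + laplace (\<lambda>t. integral {0..t} b) z + laplace W z"
      unfolding laplace_def e_def[symmetric]
      by (simp add: Henstock_Kurzweil_Integration.integral_add i Q W integrable_add)
    also have "laplace (\<lambda>_. x) z = sc ((1 - e \<tau>) / z) x"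
    proof -
      have "((\<lambda>t. e t) has_integral (- e \<tau> / z - (- e 0 / z))) {0..\<tau>}"
      proof (rule fundamental_theorem_of_calculus)
        fix t :: real
        have "((\<lambda>w. - exp (- z * w) / z) has_field_derivative exp (- z * of_real t)) (at (of_real t))"
          using z1 by (auto intro!: derivative_eq_intros)
        from has_vector_derivative_at_within[OF has_vector_derivative_real_field[OF this]]
        show "((\<lambda>t. - e t / z) has_vector_derivative e t) (at t within {0..\<tau>})" unfolding e_def .
      qed (use \<tau> in simp)
      from has_integral_linear[OF this bounded_linear_left[of x]] show ?thesis
        unfolding laplace_def e_def[symmetric]
        by (auto simp: o_def e_def diff_divide_distrib dest!: integral_unique)
    qed
    also have "laplace W z = integral {0..\<tau>} (\<lambda>s. sc (e s * \<Theta> (\<tau> - s)) (b s))"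
      unfolding W_def laplace_convolution[OF b] e_def \<Theta>_def ..
    also have "\<dots> = integral {0..\<tau>} (\<lambda>s. sc (e s * (\<Theta> (\<tau> - s) - khat z / z)) (b s) + sc (khat z / z) (sc (e s) (b s)))"
      by (rule Henstock_Kurzweil_Integration.integral_cong) (simp add: algebra_simps diff_left flip: sc_mult)
    also have "\<dots> = integral {0..\<tau>} (\<lambda>s. sc (e s * (\<Theta> (\<tau> - s) - khat z / z)) (b s)) + sc (khat z / z) q"
      unfolding q_def laplace_def e_def[symmetric]
      using integrable_linear[OF i[OF b] bounded_linear_right[of "khat z / z"]]
      by (subst Henstock_Kurzweil_Integration.integral_add)
         (auto simp: integral_sc i b o_def intro!: integrable_continuous_interval continuous_on continuous_on_mult continuous_on_diff \<Theta> e continuous_intros)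
    also have "laplace (\<lambda>t. integral {0..t} b) z = sc (1 / z) (q - sc (e \<tau>) (integral {0..\<tau>} b))"
      unfolding q_def e_def by (rule laplace_integral[OF b \<open>z \<noteq> 0\<close>])
    finally have p: "p = sc ((1 - e \<tau>) / z) x + sc (1 / z) (q - sc (e \<tau>) (integral {0..\<tau>} b))
      + (integral {0..\<tau>} (\<lambda>s. sc (e s * (\<Theta> (\<tau> - s) - khat z / z)) (b s)) + sc (khat z / z) q)" .
    \<comment> \<open>Everything that the cut at \<tau> adds to the formal equation.\<close>
    define r where "r = integral {0..\<tau>} (\<lambda>s. sc (e s * (\<Theta> (\<tau> - s) - khat z / z)) (b s)) - sc (e \<tau> / z) y"
    have inv: "1 / \<mu> z = (1 + khat z) / z"
      by (simp add: \<mu>_def \<psi>_def field_simps)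
    have p: "p = r + sc (1 / z) x + sc (1 / \<mu> z) q"
      unfolding p r_def y_def inv
      by (simp add: diff_divide_distrib add_divide_distrib diff_left sc_add_left sc_add_right diff_right algebra_simps flip: sc_mult)
    have et: "cmod (e s) = exp (- Re z * s)" for s by (simp add: e_def)
    have r: "norm r \<le> (2 * norm y + 2 * C * B * \<tau>) * exp (- \<tau> * Re z)"
    proof -
      have "norm (integral {0..\<tau>} (\<lambda>s. sc (e s * (\<Theta> (\<tau> - s) - khat z / z)) (b s))) \<le> (2 * C * B * exp (- \<tau> * Re z)) * (\<tau> - 0)"
      proof (rule integral_bound)
        show "continuous_on {0..\<tau>} (\<lambda>s. sc (e s * (\<Theta> (\<tau> - s) - khat z / z)) (b s))"
          by (intro continuous_on continuous_on_mult continuous_on_diff \<Theta> e b continuous_on_const)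
        fix s assume s: "s \<in> {0..\<tau>}"
        have "cmod (\<Theta> (\<tau> - s) - khat z / z) \<le> C * exp (- Re z * (\<tau> - s))"
          unfolding \<Theta>_def e_def using s by (intro C Rez) auto
        then have "cmod (e s * (\<Theta> (\<tau> - s) - khat z / z)) \<le> exp (- Re z * s) * (C * exp (- Re z * (\<tau> - s)))"
          unfolding norm_mult et by (intro mult_left_mono) auto
        also have "\<dots> = C * exp (- \<tau> * Re z)"
          by (simp add: mult.left_commute[of _ C] algebra_simps flip: exp_add)
        finally have "2 * cmod (e s * (\<Theta> (\<tau> - s) - khat z / z)) * norm (b s) \<le> 2 * (C * exp (- \<tau> * Re z)) * B"
          using B[OF s] C by (intro mult_mono) auto
        from order_trans[OF sc_norm this]
        show "norm (sc (e s * (\<Theta> (\<tau> - s) - khat z / z)) (b s)) \<le> 2 * C * B * exp (- \<tau> * Re z)"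
          by (simp add: mult_ac)
      qed (use \<tau> in simp)
      moreover have "norm (sc (e \<tau> / z) y) \<le> 2 * exp (- \<tau> * Re z) * norm y"
      proof (rule order_trans[OF sc_norm], rule mult_right_mono)
        show "2 * cmod (e \<tau> / z) \<le> 2 * exp (- \<tau> * Re z)"
          using z1 by (simp add: norm_divide et divide_le_eq mult.commute[of \<tau>] mult_le_cancel_left1)
      qed simp
      ultimately show ?thesis unfolding r_def
        by (intro order_trans[OF norm_triangle_ineq4]) (simp add: algebra_simps)
    qed
    have \<mu>0: "\<mu> z \<noteq> 0" using \<mu>_norm[OF z] z1 by auto
    interpret Rz: bounded_linear "Rm z" by (rule bounded_linear_Rm[OF z])
    have iv: "(\<lambda>s. sc (e s) (v s)) integrable_on {0..\<tau>}" and ib: "(\<lambda>s. sc (e s) (b s)) integrable_on {0..\<tau>}"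
      by (rule i[OF v], rule i[OF b])
    have Rsc: "Rm z (sc a u) = sc a (Rm z u)" for a u
      unfolding Rm_def by (rule R_sc[OF \<mu>_in[OF z]])
    \<comment> \<open>The bounded operator \<open>Rm z\<close>, applied pointwise to \<mu> z v s - A
      (v s), passes through the integral and yields p = Rm z (\<mu> z p - q). With the formula for p
      this eliminates q, the transform of A v.\<close>
    have "p = integral {0..\<tau>} (\<lambda>s. sc (\<mu> z) (Rm z (sc (e s) (v s))) - Rm z (sc (e s) (b s)))"
      unfolding p_def laplace_def e_def[symmetric]
    proof (rule Henstock_Kurzweil_Integration.integral_cong)
      fix s assume s: "s \<in> {0..\<tau>}"
      have "v s = Rm z (sc (\<mu> z) (v s) - b s)"
        using R_left[OF \<mu>_in[OF z] D[OF s]] Av[OF s] by (simp add: Rm_def)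
      also have "\<dots> = sc (\<mu> z) (Rm z (v s)) - Rm z (b s)" by (simp add: Rz.diff Rsc)
      finally have "sc (e s) (v s) = sc (e s) (sc (\<mu> z) (Rm z (v s)) - Rm z (b s))" by simp
      also have "sc (e s) (sc (\<mu> z) (Rm z (v s)) - Rm z (b s)) = sc (\<mu> z) (Rm z (sc (e s) (v s))) - Rm z (sc (e s) (b s))"
        by (simp add: Rsc diff_right mult.commute flip: sc_mult)
      finally show "sc (e s) (v s) = sc (\<mu> z) (Rm z (sc (e s) (v s))) - Rm z (sc (e s) (b s))" .
    qed
    also have "\<dots> = sc (\<mu> z) (Rm z p) - Rm z q"
      unfolding p_def q_def laplace_def e_def[symmetric]
      using integral_linear[OF iv Rz.bounded_linear] integral_linear[OF ib Rz.bounded_linear]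
        integrable_linear[OF iv Rz.bounded_linear] integrable_linear[OF ib Rz.bounded_linear]
        integrable_linear[OF integrable_linear[OF iv Rz.bounded_linear] bounded_linear_right[of "\<mu> z"]]
      by (subst Henstock_Kurzweil_Integration.integral_diff) (auto simp: o_def integral_sc)
    also have "\<dots> = Rm z (sc (\<mu> z) p - q)" by (simp add: Rz.diff Rsc)
    also have "sc (\<mu> z) p - q = sc (\<mu> z) r + sc (\<psi> z) x"
    proof -
      have "sc (\<mu> z) (sc (1 / \<mu> z) q) = q" "sc (\<mu> z) (sc (1 / z) x) = sc (\<psi> z) x"
        using \<mu>0 z1 by (simp_all add: \<mu>_def flip: sc_mult)
      then show ?thesis unfolding p by (simp add: sc_add_right)
    qed
    finally have "p - M x z = sc (\<mu> z) (Rm z r)"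
      by (simp add: Rz.add Rsc M_def)
    \<comment> \<open>The growth of \<mu> z is cancelled by the decay of the resolvent at \<mu>
      z.\<close>
    then have "norm (p - M x z) \<le> 2 * cmod (\<mu> z) * norm (Rm z r)" using sc_norm by simp
    also have "\<dots> \<le> 2 * cmod (\<mu> z) * (C\<^sub>R / cmod (\<mu> z) * norm r)"
      unfolding Rm_def by (intro mult_left_mono R_norm \<mu>_in z) auto
    also have "\<dots> = 2 * C\<^sub>R * norm r" using \<mu>0 by simp
    also have "\<dots> \<le> 2 * C\<^sub>R * ((2 * norm y + 2 * C * B * \<tau>) * exp (- \<tau> * Re z))"
      using C\<^sub>R by (intro mult_left_mono r) auto
    finally show "norm (laplace v z - M x z) \<le> K * exp (- \<tau> * Re z)"
      by (simp only: K_def p_def mult.assoc)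
  qed
qed

end

section \<open>The Gaussian regularised inversion kernel\<close>

definition gker :: "real \<Rightarrow> real \<Rightarrow> complex \<Rightarrow> complex" where
  "gker n t z = exp (z * of_real t + z\<^sup>2 / of_real (2 * n\<^sup>2))"

definition gker' :: "real \<Rightarrow> real \<Rightarrow> complex \<Rightarrow> complex" where
  "gker' n t z = (of_real t + z / of_real (n\<^sup>2)) * gker n t z"

definition gker'' :: "real \<Rightarrow> real \<Rightarrow> complex \<Rightarrow> complex" where
  "gker'' n t z = gker n t z / of_real (n\<^sup>2) + (of_real t + z / of_real (n\<^sup>2)) * gker' n t z"

lemma gker_derivs:
  assumes "0 < n"
  shows "(gker n t has_field_derivative gker' n t z) (at z)"
    and "(gker' n t has_field_derivative gker'' n t z) (at z)"
proof -
  show 1: "(gker n t has_field_derivative gker' n t z) (at z)" for z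
    unfolding gker_def[abs_def] gker'_def
    using assms by (auto intro!: derivative_eq_intros simp: field_simps)
  show "(gker' n t has_field_derivative gker'' n t z) (at z)"
    unfolding gker''_def gker'_def[abs_def]
    using assms by (auto intro!: derivative_eq_intros 1 simp: field_simps gker'_def)
qed

lemma continuous_gker: "0 < n \<Longrightarrow> continuous_on X (gker n t)" "0 < n \<Longrightarrow> continuous_on X (gker' n t)"
  "0 < n \<Longrightarrow> continuous_on X (gker'' n t)"
proof -
  show 1: "0 < n \<Longrightarrow> continuous_on X (gker n t)" for X
    unfolding gker_def[abs_def] by (intro continuous_intros) auto
  show 2: "0 < n \<Longrightarrow> continuous_on X (gker' n t)" for X
    unfolding gker'_def[abs_def] by (intro continuous_intros 1) auto
  show "0 < n \<Longrightarrow> continuous_on X (gker'' n t)"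
    unfolding gker''_def[abs_def] by (intro continuous_intros 1 2) auto
qed

lemma norm_gker: "0 < n \<Longrightarrow> cmod (gker n t (Complex s y)) = exp (s * t + s\<^sup>2 / (2 * n\<^sup>2)) * gauss n y"
  by (simp add: gker_def gauss_def diff_divide_distrib power2_eq_square algebra_simps Re_divide_of_real flip: exp_add of_real_mult of_real_power)

lemma norm_gker':
  assumes n: "0 < n" and t: "0 \<le> t" and s: "0 \<le> s"
  shows "cmod (gker' n t (Complex s y)) \<le> (t + (s + \<bar>y\<bar>) / n\<^sup>2) * (exp (s * t + s\<^sup>2 / (2 * n\<^sup>2)) * gauss n y)"
proof -
  have "cmod (of_real t + Complex s y / of_real (n\<^sup>2)) \<le> t + cmod (Complex s y) / n\<^sup>2"
    using norm_triangle_ineq[of "of_real t" "Complex s y / of_real (n\<^sup>2)"] t by (simp add: norm_divide norm_power)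
  also have "cmod (Complex s y) \<le> s + \<bar>y\<bar>" using cmod_le[of "Complex s y"] s by simp
  finally have "cmod (of_real t + Complex s y / of_real (n\<^sup>2)) \<le> t + (s + \<bar>y\<bar>) / n\<^sup>2"
    using n by (simp add: divide_right_mono)
  then show ?thesis
    unfolding gker'_def norm_mult norm_gker[OF n] by (intro mult_right_mono) (auto simp: gauss_def)
qed

text \<open>The derivative of gker n t z exp (- z s) is (gker' - s gker) exp (- z s), so up to end
  point terms gker' may be replaced by s gker. Completing the square, the integral of gker n t z exp
  (- z s) over the whole line is 2 \<pi> times the normal density with mean t and deviation 1/n at
  s, for every abscissa \<sigma>.\<close>

lemma gker_fourier:
  assumes n: "0 < n" and Y: "0 < Y" and s: "0 \<le> s" and \<sigma>: "0 \<le> \<sigma>"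
  shows "cmod (integral {-Y..Y} (\<lambda>y. gker' n t (Complex \<sigma> y) * exp (- Complex \<sigma> y * of_real s))
      - of_real (2 * pi * s * normal_density t (1 / n) s))
    \<le> exp (\<sigma> * t + \<sigma>\<^sup>2 / (2 * n\<^sup>2)) * (2 * gauss n Y + s * (sqrt (2 * pi) * n ^ 3 / Y\<^sup>2))"
proof -
  define g where "g z = gker n t z * exp (- z * of_real s)" for z
  define E where "E = exp (\<sigma> * (t - s) + \<sigma>\<^sup>2 / (2 * n\<^sup>2))"
  have E: "0 \<le> E" "E \<le> exp (\<sigma> * t + \<sigma>\<^sup>2 / (2 * n\<^sup>2))"
    using s \<sigma> by (auto simp: E_def right_diff_distrib)
  \<comment> \<open>The frequency that remains once the real exponent, collected in E, is split off;
    \<sigma> / n^2 comes from the cross term of z^2.\<close>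
  define x where "x = t - s + \<sigma> / n\<^sup>2"
  have g: "g (Complex \<sigma> y) = of_real E * (of_real (gauss n y) * exp (\<i> * of_real (x * y)))" for y
  proof -
    have "Complex \<sigma> y * of_real t + (Complex \<sigma> y)\<^sup>2 / of_real (2 * n\<^sup>2) + - Complex \<sigma> y * of_real s
      = of_real (\<sigma> * (t - s) + \<sigma>\<^sup>2 / (2 * n\<^sup>2)) + (of_real (- (y\<^sup>2 / (2 * n\<^sup>2))) + \<i> * of_real (x * y))"
      using n by (simp add: complex_eq_iff x_def power2_eq_square field_simps Re_divide_of_real Im_divide_of_real
          flip: of_real_mult of_real_power)
    then show ?thesis
      by (simp only: g_def gker_def E_def gauss_def exp_of_real[symmetric] exp_add[symmetric] mult_exp_exp)
  qed
  have cg: "continuous_on X (\<lambda>y. g (Complex \<sigma> y))" for X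
    unfolding g
    by (intro continuous_intros continuous_on_of_real continuous_on_gauss)
  have "((\<lambda>y. \<i> * (gker' n t (Complex \<sigma> y) * exp (- Complex \<sigma> y * of_real s) - of_real s * g (Complex \<sigma> y)))
      has_integral g (Complex \<sigma> Y) - g (Complex \<sigma> (-Y))) {-Y..Y}"
  proof (rule fundamental_theorem_of_calculus)
    fix y assume "y \<in> {-Y..Y}"
    have "(g has_field_derivative gker' n t z * exp (- z * of_real s) - of_real s * g z) (at z)" for z
      unfolding g_def[abs_def]
      by (auto intro!: derivative_eq_intros gker_derivs n simp: algebra_simps)
    moreover have "((\<lambda>y. Complex \<sigma> y) has_vector_derivative \<i>) (at y within {-Y..Y})"
      unfolding Complex_eq has_vector_derivative_def by (auto intro!: derivative_eq_intros simp: scaleR_conv_of_real)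
    ultimately show "((\<lambda>y. g (Complex \<sigma> y)) has_vector_derivative
        \<i> * (gker' n t (Complex \<sigma> y) * exp (- Complex \<sigma> y * of_real s) - of_real s * g (Complex \<sigma> y))) (at y within {-Y..Y})"
      using field_vector_diff_chain_within[of "Complex \<sigma>" \<i> y "{-Y..Y}" g]
      by (auto simp: o_def intro: has_field_derivative_at_within)
  qed (use Y in simp)
  from has_integral_add[OF has_integral_mult_right[OF this, of "-\<i>"]
    has_integral_mult_right[OF integrable_integral[OF integrable_continuous_interval[OF cg]], of "of_real s" "-Y" Y]]
  have "((\<lambda>y. gker' n t (Complex \<sigma> y) * exp (- Complex \<sigma> y * of_real s)) has_integral
      - \<i> * (g (Complex \<sigma> Y) - g (Complex \<sigma> (-Y))) + of_real s * integral {-Y..Y} (\<lambda>y. g (Complex \<sigma> y))) {-Y..Y}"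
    by (simp add: mult.assoc[symmetric])
  then have I: "integral {-Y..Y} (\<lambda>y. gker' n t (Complex \<sigma> y) * exp (- Complex \<sigma> y * of_real s))
      = - \<i> * (g (Complex \<sigma> Y) - g (Complex \<sigma> (-Y))) + of_real s * integral {-Y..Y} (\<lambda>y. g (Complex \<sigma> y))"
    by (rule integral_unique)
  have "E * (n * sqrt (2 * pi) * exp (- ((n * x)\<^sup>2 / 2))) = 2 * pi * normal_density t (1 / n) s"
  proof -
    have "E * exp (- ((n * x)\<^sup>2 / 2)) = exp (- (n\<^sup>2 * (s - t)\<^sup>2 / 2))"
      using n unfolding E_def mult_exp_exp x_def
      by (simp add: power2_eq_square field_simps)
    moreover have "2 * pi * normal_density t (1 / n) s = n * sqrt (2 * pi) * exp (- (n\<^sup>2 * (s - t)\<^sup>2 / 2))"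
    proof -
      have "2 * pi / sqrt (2 * pi * (1 / n)\<^sup>2) = n * sqrt (2 * pi)"
        using n by (simp add: real_sqrt_mult real_sqrt_divide real_div_sqrt power_divide field_simps)
      then show ?thesis
        unfolding normal_density_def using n by (simp add: field_simps)
    qed
    ultimately show ?thesis by (simp add: mult_ac)
  qed
  then have eq: "of_real (2 * pi * s * normal_density t (1 / n) s)
      = of_real s * (of_real E * of_real (n * sqrt (2 * pi) * exp (- ((n * x)\<^sup>2 / 2))) :: complex)"
    by (simp only: of_real_mult[symmetric]) (simp add: mult_ac)
  define J where "J = integral {-Y..Y} (\<lambda>y. of_real (gauss n y) * exp (\<i> * of_real (x * y)))"
  have "integral {-Y..Y} (\<lambda>y. g (Complex \<sigma> y)) = of_real E * J"
    unfolding g J_def by (rule integral_mult_right)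
  then have "integral {-Y..Y} (\<lambda>y. gker' n t (Complex \<sigma> y) * exp (- Complex \<sigma> y * of_real s))
      - of_real (2 * pi * s * normal_density t (1 / n) s)
    = - \<i> * (g (Complex \<sigma> Y) - g (Complex \<sigma> (-Y)))
      + of_real s * (of_real E * (J - of_real (n * sqrt (2 * pi) * exp (- ((n * x)\<^sup>2 / 2)))))"
    unfolding I eq by (simp only: right_diff_distrib) (simp add: algebra_simps)
  also have "cmod \<dots> \<le> 2 * (E * gauss n Y) + s * (E * (sqrt (2 * pi) * n ^ 3 / Y\<^sup>2))"
  proof (rule norm_triangle_le, rule add_mono)
    have "cmod (g (Complex \<sigma> y)) = E * gauss n y" for y
      using E unfolding g by (simp add: norm_mult)
    then show "cmod (- \<i> * (g (Complex \<sigma> Y) - g (Complex \<sigma> (-Y)))) \<le> 2 * (E * gauss n Y)"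
      using norm_triangle_ineq4[of "g (Complex \<sigma> Y)" "g (Complex \<sigma> (-Y))"] by (simp add: norm_mult)
    show "cmod (of_real s * (of_real E * (J - of_real (n * sqrt (2 * pi) * exp (- ((n * x)\<^sup>2 / 2))))))
      \<le> s * (E * (sqrt (2 * pi) * n ^ 3 / Y\<^sup>2))"
      using s E gauss_fourier_error[OF n Y, of x, folded J_def]
      unfolding norm_mult norm_of_real by (intro mult_mono) auto
  qed
  also have "\<dots> = E * (2 * gauss n Y + s * (sqrt (2 * pi) * n ^ 3 / Y\<^sup>2))" by (simp add: algebra_simps)
  also have "\<dots> \<le> exp (\<sigma> * t + \<sigma>\<^sup>2 / (2 * n\<^sup>2)) * (2 * gauss n Y + s * (sqrt (2 * pi) * n ^ 3 / Y\<^sup>2))"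
    using E n s by (intro mult_right_mono) auto
  finally show ?thesis .
qed

lemma integral_powr_three_halves:
  assumes "0 \<le> Y"
  shows "(\<lambda>y. (1 + \<bar>y\<bar>) powr (- 3 / 2)) integrable_on {-Y..Y}"
    and "integral {-Y..Y} (\<lambda>y::real. (1 + \<bar>y\<bar>) powr (- 3 / 2)) \<le> 4"
proof -
  show i: "(\<lambda>y. (1 + \<bar>y\<bar>) powr (- 3 / 2)) integrable_on {-Y..Y}"
    by (intro integrable_continuous_interval continuous_intros) auto
  have "((\<lambda>y::real. (1 + \<bar>y\<bar>) powr (- 3 / 2)) has_integral (- 2 * (1 + Y) powr (- 1 / 2) - (- 2 * (1 + 0) powr (- 1 / 2)))) {0..Y}"
  proof (rule fundamental_theorem_of_calculus)
    fix y assume y: "y \<in> {0..Y}"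
    then have "((\<lambda>y. - 2 * (1 + y) powr (- 1 / 2)) has_real_derivative (1 + \<bar>y\<bar>) powr (- 3 / 2)) (at y within {0..Y})"
      by (auto intro!: derivative_eq_intros)
    then show "((\<lambda>y. - 2 * (1 + y) powr (- 1 / 2)) has_vector_derivative (1 + \<bar>y\<bar>) powr (- 3 / 2)) (at y within {0..Y})"
      by (simp add: has_real_derivative_iff_has_vector_derivative)
  qed (use assms in simp)
  then have 1: "integral {0..Y} (\<lambda>y::real. (1 + \<bar>y\<bar>) powr (- 3 / 2)) \<le> 2"
    by (auto dest!: integral_unique)
  have "integral {-Y..0} (\<lambda>y::real. (1 + \<bar>y\<bar>) powr (- 3 / 2)) = integral {0..Y} (\<lambda>y::real. (1 + \<bar>y\<bar>) powr (- 3 / 2))"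
    using Henstock_Kurzweil_Integration.integral_reflect_real[of Y 0 "\<lambda>y::real. (1 + \<bar>y\<bar>) powr (- 3 / 2)"] by simp
  with 1 show "integral {-Y..Y} (\<lambda>y::real. (1 + \<bar>y\<bar>) powr (- 3 / 2)) \<le> 4"
    using Henstock_Kurzweil_Integration.integral_combine[OF _ _ i, of 0] assms by simp
qed

text \<open>The linear factor coming from gker' is absorbed by widening the Gaussian by sqrt 2,
  through u <= 1 + u^2 / 4 <= exp (u^2 / 4) with u = |y| / n.\<close>

lemma gauss_linear_le:
  assumes n: "1 \<le> n" and \<tau>: "0 \<le> \<tau>"
  shows "(\<tau> + \<bar>y\<bar> / n\<^sup>2) * gauss n y \<le> (\<tau> + 1) * gauss (sqrt 2 * n) y"
proof -
  define u where "u = \<bar>y\<bar> / n"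
  have u: "0 \<le> u" using n by (simp add: u_def)
  have "u \<le> 1 + u\<^sup>2 / 4" using zero_le_power2[of "u / 2 - 1"] by (simp add: power2_eq_square field_simps)
  also have "\<dots> \<le> exp (u\<^sup>2 / 4)" by (rule exp_ge_add_one_self)
  finally have "u \<le> exp (u\<^sup>2 / 4)" .
  moreover have "1 \<le> exp (u\<^sup>2 / 4)" by simp
  moreover have "\<bar>y\<bar> / n\<^sup>2 \<le> u"
  proof -
    have "\<bar>y\<bar> / n\<^sup>2 = u / n" by (simp add: u_def power2_eq_square)
    also have "\<dots> \<le> u" using n u by (simp add: divide_le_eq mult_le_cancel_left1)
    finally show ?thesis .
  qed
  ultimately have "\<tau> + \<bar>y\<bar> / n\<^sup>2 \<le> (\<tau> + 1) * exp (u\<^sup>2 / 4)"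
    using mult_left_mono[of 1 "exp (u\<^sup>2 / 4)" \<tau>] \<tau> by (simp add: distrib_right)
  then have "(\<tau> + \<bar>y\<bar> / n\<^sup>2) * gauss n y \<le> (\<tau> + 1) * exp (u\<^sup>2 / 4) * gauss n y"
    by (intro mult_right_mono) auto
  also have "(\<tau> + 1) * exp (u\<^sup>2 / 4) * gauss n y = (\<tau> + 1) * gauss (sqrt 2 * n) y"
  proof -
    have "exp (u\<^sup>2 / 4) * gauss n y = gauss (sqrt 2 * n) y"
      using n unfolding gauss_def mult_exp_exp u_def by (simp add: power_divide power_mult_distrib field_simps)
    then show ?thesis by (simp only: mult.assoc)
  qed
  finally show ?thesis .
qed

section \<open>Laplace inversion and the smoothing estimate\<close>

context volterra_resolvent
begin

text \<open>At fixed n and Y, Fubini moves the inversion under the time integral, where the error in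
  \<open>gker_fourier\<close> is bounded uniformly for s in [0, \<tau>]. Using gker' in place of
  gker puts the weight s on v s; in the limit of large n it becomes the factor t of the
  estimate.\<close>

lemma laplace_inversion:
  assumes v: "continuous_on {0..\<tau>} v" and n: "0 < n" and \<sigma>: "0 \<le> \<sigma>"
  shows "((\<lambda>Y. integral {-Y..Y} (\<lambda>y. sc (gker' n t (Complex \<sigma> y)) (laplace v (Complex \<sigma> y)))) \<longlongrightarrow>
    (2 * pi) *\<^sub>R integral {0..\<tau>} (\<lambda>s. normal_density t (1 / n) s *\<^sub>R (s *\<^sub>R v s))) at_top"
proof -
  let ?c = "\<lambda>Y s. integral {-Y..Y} (\<lambda>y. gker' n t (Complex \<sigma> y) * exp (- Complex \<sigma> y * of_real s))"
  let ?N = "normal_density t (1 / n)"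
  obtain B where B: "\<And>s. s \<in> {0..\<tau>} \<Longrightarrow> norm (v s) \<le> B"
    using compact_imp_bounded[OF compact_continuous_image[OF v compact_Icc]] by (fastforce simp: bounded_iff)
  have B0: "0 \<le> B" using B[of 0] \<tau> norm_ge_zero[of "v 0"] by (simp del: norm_ge_zero)
  have cC: "continuous_on X (\<lambda>y. Complex \<sigma> y)" for X
    unfolding Complex_eq by (intro continuous_intros)
  have cg: "continuous_on X (\<lambda>y. gker' n t (Complex \<sigma> y))" for X
    by (rule continuous_on_compose2[OF continuous_gker(2)[OF n, of UNIV] cC]) simp
  have ck: "continuous_on X (\<lambda>x. gker' n t (Complex \<sigma> (fst x)) * exp (- Complex \<sigma> (fst x) * of_real (snd x)))" for X
    by (intro continuous_intros continuous_on_compose2[OF cg[of UNIV]] continuous_on_compose2[OF cC[of UNIV]]) auto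
  have cN: "continuous_on X ?N" for X
    unfolding normal_density_def[abs_def] divide_inverse by (intro continuous_intros)
  have *: "norm (integral {-Y..Y} (\<lambda>y. sc (gker' n t (Complex \<sigma> y)) (laplace v (Complex \<sigma> y)))
      - (2 * pi) *\<^sub>R integral {0..\<tau>} (\<lambda>s. ?N s *\<^sub>R (s *\<^sub>R v s)))
    \<le> 2 * (exp (\<sigma> * t + \<sigma>\<^sup>2 / (2 * n\<^sup>2)) * (2 * gauss n Y + \<tau> * (sqrt (2 * pi) * n ^ 3 / Y\<^sup>2))) * B * (\<tau> - 0)"
    if Y: "0 < Y" for Y
  proof -
    have cc: "continuous_on {0..\<tau>} (?c Y)"
      using integral_continuous_on_param[of "{0..\<tau>}" "-Y" Y "\<lambda>s y. gker' n t (Complex \<sigma> y) * exp (- Complex \<sigma> y * of_real s)"]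
        continuous_on_compose2[OF ck[of UNIV] continuous_on_swap[of "{0..\<tau>} \<times> {-Y..Y}"]]
      by (auto simp: split_beta prod.swap_def)
    have "integral {-Y..Y} (\<lambda>y. sc (gker' n t (Complex \<sigma> y)) (laplace v (Complex \<sigma> y)))
      = integral {-Y..Y} (\<lambda>y. integral {0..\<tau>} (\<lambda>s. sc (gker' n t (Complex \<sigma> y) * exp (- Complex \<sigma> y * of_real s)) (v s)))"
      unfolding laplace_def
      by (intro Henstock_Kurzweil_Integration.integral_cong)
         (simp add: sc_mult integral_sc integrable_continuous_interval continuous_on v continuous_intros)
    also have "\<dots> = integral {0..\<tau>} (\<lambda>s. integral {-Y..Y} (\<lambda>y. sc (gker' n t (Complex \<sigma> y) * exp (- Complex \<sigma> y * of_real s)) (v s)))"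
    proof -
      have "continuous_on (cbox (-Y, 0) (Y, \<tau>)) (\<lambda>(y, s). sc (gker' n t (Complex \<sigma> y) * exp (- Complex \<sigma> y * of_real s)) (v s))"
        unfolding split_beta
        by (intro continuous_on[OF ck] continuous_on_compose2[OF v]) (auto intro!: continuous_intros simp: cbox_Pair_eq)
      from integral_swap_continuous[OF this] show ?thesis by (simp add: cbox_interval)
    qed
    also have "\<dots> = integral {0..\<tau>} (\<lambda>s. sc (?c Y s) (v s))"
    proof (rule Henstock_Kurzweil_Integration.integral_cong)
      fix s
      have "(\<lambda>y. gker' n t (Complex \<sigma> y) * exp (- Complex \<sigma> y * of_real s)) integrable_on {-Y..Y}"
        by (intro integrable_continuous_interval continuous_intros cg cC)
      from integral_linear[OF this bounded_linear_left[of "v s"]]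
      show "integral {-Y..Y} (\<lambda>y. sc (gker' n t (Complex \<sigma> y) * exp (- Complex \<sigma> y * of_real s)) (v s)) = sc (?c Y s) (v s)"
        by (simp add: o_def)
    qed
    finally have 1: "integral {-Y..Y} (\<lambda>y. sc (gker' n t (Complex \<sigma> y)) (laplace v (Complex \<sigma> y)))
      = integral {0..\<tau>} (\<lambda>s. sc (?c Y s) (v s))" .
    have 2: "(2 * pi) *\<^sub>R integral {0..\<tau>} (\<lambda>s. ?N s *\<^sub>R (s *\<^sub>R v s))
      = integral {0..\<tau>} (\<lambda>s. sc (of_real (2 * pi * s * ?N s)) (v s))"
      unfolding Henstock_Kurzweil_Integration.integral_cmul[symmetric] by (simp add: sc_of_real mult_ac del: of_real_mult)
    have "norm (integral {0..\<tau>} (\<lambda>s. sc (?c Y s - of_real (2 * pi * s * ?N s)) (v s)))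
      \<le> 2 * (exp (\<sigma> * t + \<sigma>\<^sup>2 / (2 * n\<^sup>2)) * (2 * gauss n Y + \<tau> * (sqrt (2 * pi) * n ^ 3 / Y\<^sup>2))) * B * (\<tau> - 0)"
    proof (rule integral_bound)
      show "continuous_on {0..\<tau>} (\<lambda>s. sc (?c Y s - of_real (2 * pi * s * ?N s)) (v s))"
        by (intro continuous_on v continuous_on_diff cc continuous_on_of_real continuous_on_mult cN continuous_intros)
      fix s assume s: "s \<in> {0..\<tau>}"
      have "cmod (?c Y s - of_real (2 * pi * s * ?N s))
        \<le> exp (\<sigma> * t + \<sigma>\<^sup>2 / (2 * n\<^sup>2)) * (2 * gauss n Y + s * (sqrt (2 * pi) * n ^ 3 / Y\<^sup>2))"
        using s by (intro gker_fourier n Y \<sigma>) auto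
      also have "\<dots> \<le> exp (\<sigma> * t + \<sigma>\<^sup>2 / (2 * n\<^sup>2)) * (2 * gauss n Y + \<tau> * (sqrt (2 * pi) * n ^ 3 / Y\<^sup>2))"
        using s n by (intro mult_left_mono add_left_mono mult_right_mono) auto
      finally show "norm (sc (?c Y s - of_real (2 * pi * s * ?N s)) (v s))
        \<le> 2 * (exp (\<sigma> * t + \<sigma>\<^sup>2 / (2 * n\<^sup>2)) * (2 * gauss n Y + \<tau> * (sqrt (2 * pi) * n ^ 3 / Y\<^sup>2))) * B"
        using B[OF s] n \<tau> by (intro order_trans[OF sc_norm] mult_mono mult_left_mono) auto
    qed (use \<tau> in simp)
    also have "integral {0..\<tau>} (\<lambda>s. sc (?c Y s - of_real (2 * pi * s * ?N s)) (v s))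
      = integral {0..\<tau>} (\<lambda>s. sc (?c Y s) (v s)) - integral {0..\<tau>} (\<lambda>s. sc (of_real (2 * pi * s * ?N s)) (v s))"
      unfolding diff_left
      by (intro Henstock_Kurzweil_Integration.integral_diff integrable_continuous_interval continuous_on v cc
          continuous_on_of_real continuous_on_mult cN continuous_on_const continuous_on_id)
    finally show ?thesis unfolding 1 2 .
  qed
  show ?thesis
  proof (rule LIM_zero_cancel, rule Lim_null_comparison)
    show "\<forall>\<^sub>F Y in at_top. norm (integral {-Y..Y} (\<lambda>y. sc (gker' n t (Complex \<sigma> y)) (laplace v (Complex \<sigma> y)))
      - (2 * pi) *\<^sub>R integral {0..\<tau>} (\<lambda>s. ?N s *\<^sub>R (s *\<^sub>R v s)))
      \<le> 2 * (exp (\<sigma> * t + \<sigma>\<^sup>2 / (2 * n\<^sup>2)) * (2 * gauss n Y + \<tau> * (sqrt (2 * pi) * n ^ 3 / Y\<^sup>2))) * B * (\<tau> - 0)"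
      using eventually_gt_at_top[of 0] by eventually_elim (rule *)
    have "((\<lambda>Y. 2 * gauss n Y + \<tau> * (sqrt (2 * pi) * n ^ 3 / Y\<^sup>2)) \<longlongrightarrow> 0) at_top"
    proof -
      have "(gauss n \<longlongrightarrow> 0) at_top"
        unfolding gauss_def[abs_def] using n by real_asymp
      moreover have "((\<lambda>Y. sqrt (2 * pi) * n ^ 3 / Y\<^sup>2) \<longlongrightarrow> 0) at_top"
        using n by real_asymp
      ultimately show ?thesis
        using tendsto_add[OF tendsto_mult_right_zero tendsto_mult_right_zero, of "gauss n" at_top
            "\<lambda>Y. sqrt (2 * pi) * n ^ 3 / Y\<^sup>2" 2 \<tau>] by simp
    qed
    then show "((\<lambda>Y. 2 * (exp (\<sigma> * t + \<sigma>\<^sup>2 / (2 * n\<^sup>2)) * (2 * gauss n Y + \<tau> * (sqrt (2 * pi) * n ^ 3 / Y\<^sup>2))) * B * (\<tau> - 0)) \<longlongrightarrow> 0) at_top"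
      by (intro tendsto_mult_left_zero tendsto_mult_right_zero)
  qed
qed

text \<open>All terms that involve \<open>norm x\<close> vanish as Y grows at fixed n, and the
  truncation constant K disappears as n grows afterwards, so B alone survives. It is B that will
  carry the factor n^(-1/2).\<close>

lemma smoothing_bound:
  assumes v: "continuous_on {0..\<tau>} v" and b: "continuous_on {0..\<tau>} b"
    and D: "\<And>s. s \<in> {0..\<tau>} \<Longrightarrow> v s \<in> D" and Av: "\<And>s. s \<in> {0..\<tau>} \<Longrightarrow> A (v s) = b s"
    and eq: "\<And>t. t \<in> {0..\<tau>} \<Longrightarrow> v t = x + integral {0..t} b + integral {0..t} (\<lambda>s. mm (t - s) *\<^sub>R b s)"
    and t: "0 < t" "t \<le> \<tau> - 1" and B: "0 \<le> B"
    and M': "\<And>y. norm (M' x (Complex (\<sigma>\<^sub>0 + 1) y)) \<le> B * (1 + \<bar>y\<bar>) powr (- 3 / 2)"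
  shows "t * norm (v t) \<le> 2 * exp ((\<sigma>\<^sub>0 + 1) * t + (\<sigma>\<^sub>0 + 1)\<^sup>2) * B"
proof -
  obtain K where K: "0 \<le> K" "\<And>z. z \<in> H \<Longrightarrow> norm (laplace v z - M x z) \<le> K * exp (- \<tau> * Re z)"
    using laplace_representation[OF v b D Av eq] by blast
  define s0 where "s0 = \<sigma>\<^sub>0 + 1"
  have s0: "1 \<le> s0" using \<sigma>\<^sub>0 by (simp add: s0_def)
  have inH: "Complex s y \<in> H" if "s0 \<le> s" for s y using that by (simp add: H_def s0_def)
  \<comment> \<open>Bounds |gker n t z| on the fixed line Re z = s0 for all n >= 1 at once.\<close>
  define E0 where "E0 = exp (s0 * t + s0\<^sup>2)"
  define I where "I n = integral {0..\<tau>} (\<lambda>s. normal_density t (1 / n) s *\<^sub>R (s *\<^sub>R v s))" for n :: real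
  \<comment> \<open>The truncation error integrated over the far line Re z = s1. Its exponent there
    is at most - n^2 / 2; the last factor is the mass of the Gaussian widened by
    \<open>gauss_linear_le\<close>.\<close>
  define rem where "rem n = 2 * K * exp (- (n\<^sup>2 / 2)) * ((\<tau> + 1) * (sqrt 2 * n * sqrt (2 * pi)))" for n :: real
  have cC: "continuous_on X (\<lambda>y. Complex \<sigma> y)" for X \<sigma>
    unfolding Complex_eq by (intro continuous_intros)
  have cM: "continuous_on X (\<lambda>y. M x (Complex \<sigma> y))" "continuous_on X (\<lambda>y. M' x (Complex \<sigma> y))" if "s0 \<le> \<sigma>" for X \<sigma>
    using that by (auto intro!: continuous_on_compose2[OF continuous_M cC] continuous_on_compose2[OF continuous_M' cC] inH)
  have bound: "2 * pi * norm (I n) \<le> rem n + 8 * E0 * B"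
    if n: "1 \<le> n" and big: "s0 \<le> (\<tau> - t) * n\<^sup>2" for n
  proof -
    have n0: "0 < n" using n by simp
    \<comment> \<open>\<open>s1\<close> minimises \<open>s * t + s\<^sup>2 / (2 * n\<^sup>2) - s * \<tau>\<close>, the exponent of the truncation error on \<open>Re z = s\<close>.\<close>
    define s1 where "s1 = (\<tau> - t) * n\<^sup>2"
    have s1: "s0 \<le> s1" "0 \<le> s1" using big s0 by (auto simp: s1_def)
    define E1 where "E1 = exp (s1 * t + s1\<^sup>2 / (2 * n\<^sup>2))"
    have cgk: "continuous_on X (\<lambda>y. gker n t (Complex \<sigma> y))" "continuous_on X (\<lambda>y. gker' n t (Complex \<sigma> y))"  for X \<sigma>
      by (rule continuous_on_compose2[OF continuous_gker(1)[OF n0, of UNIV] cC]; simp)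
         (rule continuous_on_compose2[OF continuous_gker(2)[OF n0, of UNIV] cC]; simp)
    have lap_cont: "continuous_on X (\<lambda>y. laplace v (Complex \<sigma> y))" for X \<sigma>
    proof -
      have "continuous_on (cball 0 r) (\<lambda>y. integral (cbox 0 \<tau>) (\<lambda>s. sc (exp (- Complex \<sigma> y * of_real s)) (v s)))" for r
      proof (rule integral_continuous_on_param)
        have "continuous_on (cball 0 r \<times> cbox 0 \<tau>) (\<lambda>x. sc (exp (- Complex \<sigma> (fst x) * of_real (snd x))) (v (snd x)))"
          by (intro continuous_on continuous_on_compose2[OF v] continuous_intros continuous_on_compose2[OF cC[of UNIV]]) auto
        then show "continuous_on (cball 0 r \<times> cbox 0 \<tau>) (\<lambda>(y, s). sc (exp (- Complex \<sigma> y * of_real s)) (v s))"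
          by (simp add: split_beta)
      qed
      then have L: "continuous_on (ball 0 r) (\<lambda>y. laplace v (Complex \<sigma> y))" for r
        unfolding laplace_def cbox_interval by (rule continuous_on_subset[where t="ball 0 r" and s="cball 0 r"]) auto
      have "isCont (\<lambda>y. laplace v (Complex \<sigma> y)) y" for y
        by (rule continuous_on_interior[OF L[of "\<bar>y\<bar> + 1"]]) simp
      then show ?thesis by (simp add: continuous_at_imp_continuous_on)
    qed
    \<comment> \<open>\<open>\<beta>b\<close> bounds the integrand on the horizontal sides of the
      contour shift, \<open>\<gamma>b\<close> the end point terms of the integration by parts on the
      line s0. Both tend to 0 as Y grows.\<close>
    define \<beta>b where "\<beta>b Y = 2 * ((t + (s1 + Y) / n\<^sup>2) * (E1 * gauss n Y)) * (8 * C\<^sub>R * norm x)" for Y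
    define \<gamma>b where "\<gamma>b Y = 32 * E0 * C\<^sub>R * norm x * gauss n Y * 2" for Y
    let ?L = "\<lambda>Y. integral {-Y..Y} (\<lambda>y. sc (gker' n t (Complex s1 y)) (laplace v (Complex s1 y)))"
    let ?F = "\<lambda>Y s. integral {-Y..Y} (\<lambda>y. sc (gker' n t (Complex s y)) (M x (Complex s y)))"
    have E0: "exp (s0 * t + s0\<^sup>2 / (2 * n\<^sup>2)) \<le> E0"
    proof -
      have "s0\<^sup>2 / (2 * n\<^sup>2) \<le> s0\<^sup>2" using one_le_power[OF n, of 2] by (auto simp: divide_le_eq mult_le_cancel_left1)
      then show ?thesis by (simp add: E0_def)
    qed
    have main: "norm (?L Y) \<le> rem n + 8 * E0 * B + (4 * \<beta>b Y * (s1 - s0) + \<gamma>b Y)" if Y: "0 < Y" for Y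
    proof -
      have remainder: "norm (?L Y - ?F Y s1) \<le> rem n"
      proof -
        have LF: "?L Y - ?F Y s1 = integral {-Y..Y} (\<lambda>y. sc (gker' n t (Complex s1 y)) (laplace v (Complex s1 y) - M x (Complex s1 y)))"
          unfolding diff_right
          by (intro Henstock_Kurzweil_Integration.integral_diff[symmetric] integrable_continuous_interval continuous_on cgk lap_cont cM s1)
        have "norm (?L Y - ?F Y s1) \<le> integral {-Y..Y} (\<lambda>y. 2 * K * exp (- (n\<^sup>2 / 2)) * ((\<tau> + 1) * gauss (sqrt 2 * n) y))"
          unfolding LF
        proof (rule integral_norm_bound_integral)
          show "(\<lambda>y. sc (gker' n t (Complex s1 y)) (laplace v (Complex s1 y) - M x (Complex s1 y))) integrable_on {-Y..Y}"
            by (intro integrable_continuous_interval continuous_on cgk lap_cont cM s1 continuous_on_diff)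
          show "(\<lambda>y. 2 * K * exp (- (n\<^sup>2 / 2)) * ((\<tau> + 1) * gauss (sqrt 2 * n) y)) integrable_on {-Y..Y}"
            by (intro integrable_continuous_interval continuous_intros continuous_on_gauss)
          fix y
          have "cmod (gker' n t (Complex s1 y)) \<le> (t + (s1 + \<bar>y\<bar>) / n\<^sup>2) * (E1 * gauss n y)"
            unfolding E1_def using t s1 by (intro norm_gker' n0) auto
          \<comment> \<open>The choice of s1 gives t + s1 / n^2 = \<tau>.\<close>
          also have "\<dots> = E1 * ((\<tau> + \<bar>y\<bar> / n\<^sup>2) * gauss n y)"
            using n by (simp add: s1_def add_divide_distrib)
          also have "\<dots> \<le> E1 * ((\<tau> + 1) * gauss (sqrt 2 * n) y)"
            using n \<tau> by (intro mult_left_mono gauss_linear_le) (auto simp: E1_def)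
          finally have 1: "cmod (gker' n t (Complex s1 y)) \<le> E1 * ((\<tau> + 1) * gauss (sqrt 2 * n) y)" .
          have 2: "norm (laplace v (Complex s1 y) - M x (Complex s1 y)) \<le> K * exp (- \<tau> * s1)"
            using K(2)[OF inH[OF s1(1), of y]] by simp
          \<comment> \<open>Here t <= \<tau> - 1 enters: the combined exponent is - (\<tau> - t)^2
            n^2 / 2, at most - n^2 / 2.\<close>
          have "E1 * exp (- \<tau> * s1) \<le> exp (- (n\<^sup>2 / 2))"
          proof -
            have "s1 * t + s1\<^sup>2 / (2 * n\<^sup>2) + - \<tau> * s1 = - ((\<tau> - t)\<^sup>2 * n\<^sup>2 / 2)"
              using n by (simp add: s1_def power2_eq_square field_simps)
            moreover have "1 * n\<^sup>2 \<le> (\<tau> - t)\<^sup>2 * n\<^sup>2"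
              using t power_mono[of 1 "\<tau> - t" 2] by (intro mult_right_mono) auto
            ultimately show ?thesis unfolding E1_def mult_exp_exp by simp
          qed
          then have 3: "2 * K * ((\<tau> + 1) * gauss (sqrt 2 * n) y) * (E1 * exp (- \<tau> * s1)) \<le> 2 * K * ((\<tau> + 1) * gauss (sqrt 2 * n) y) * exp (- (n\<^sup>2 / 2))"
            using K \<tau> by (intro mult_left_mono) auto
          have "norm (sc (gker' n t (Complex s1 y)) (laplace v (Complex s1 y) - M x (Complex s1 y)))
            \<le> 2 * (E1 * ((\<tau> + 1) * gauss (sqrt 2 * n) y)) * (K * exp (- \<tau> * s1))"
            using \<tau> by (intro order_trans[OF sc_norm] mult_mono 1 2 mult_left_mono) (auto simp: E1_def)
          also have "\<dots> = 2 * K * ((\<tau> + 1) * gauss (sqrt 2 * n) y) * (E1 * exp (- \<tau> * s1))" by (simp add: mult_ac)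
          finally show "norm (sc (gker' n t (Complex s1 y)) (laplace v (Complex s1 y) - M x (Complex s1 y)))
            \<le> 2 * K * exp (- (n\<^sup>2 / 2)) * ((\<tau> + 1) * gauss (sqrt 2 * n) y)"
            using 3 by (simp add: mult_ac)
        qed
        also have "\<dots> = 2 * K * exp (- (n\<^sup>2 / 2)) * ((\<tau> + 1) * integral {-Y..Y} (gauss (sqrt 2 * n)))"
          by (subst integral_mult_right)+ (rule refl)
        also have "\<dots> \<le> rem n"
          unfolding rem_def
        proof (rule mult_left_mono[OF mult_left_mono])
          show "integral {-Y..Y} (gauss (sqrt 2 * n)) \<le> sqrt 2 * n * sqrt (2 * pi)"
            by (rule integral_gauss_le) (use n in simp)
          show "0 \<le> \<tau> + 1" using \<tau> by simp
          show "0 \<le> 2 * K * exp (- (n\<^sup>2 / 2))" using K by simp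
        qed
        finally show ?thesis .
      qed
      have shift: "norm (?F Y s1 - ?F Y s0) \<le> 4 * \<beta>b Y * (s1 - s0)"
      proof (rule vertical_integral_shift[where F="\<lambda>z. sc (gker' n t z) (M x z)"
            and F'="\<lambda>z. sc (gker'' n t z) (M x z) + sc (gker' n t z) (M' x z)"])
        fix s y assume "s \<in> {s0..s1}"
        then show "has_sc_derivative (\<lambda>z. sc (gker' n t z) (M x z))
          (sc (gker'' n t (Complex s y)) (M x (Complex s y)) + sc (gker' n t (Complex s y)) (M' x (Complex s y))) (Complex s y)"
          by (intro has_sc_derivative_sc gker_derivs has_sc_derivative_M inH n0) auto
      next
        have c2: "continuous_on X (\<lambda>p. Complex (fst p) (snd p))" for X
          unfolding Complex_eq by (intro continuous_intros)
        show "continuous_on ({s0..s1} \<times> {-Y..Y}) (\<lambda>(s, y). sc (gker'' n t (Complex s y)) (M x (Complex s y)) + sc (gker' n t (Complex s y)) (M' x (Complex s y)))"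
          unfolding split_beta
          by (intro continuous_on_add continuous_on continuous_on_compose2[OF continuous_gker(3)[OF n0, of UNIV] c2]
              continuous_on_compose2[OF continuous_gker(2)[OF n0, of UNIV] c2]
              continuous_on_compose2[OF continuous_M c2] continuous_on_compose2[OF continuous_M' c2]) (auto intro!: inH)
      next
        fix s assume s: "s \<in> {s0..s1}"
        have "norm (sc (gker' n t (Complex s y)) (M x (Complex s y))) \<le> \<beta>b Y" if y: "\<bar>y\<bar> = Y" for y
        proof -
          have "cmod (gker' n t (Complex s y)) \<le> (t + (s + \<bar>y\<bar>) / n\<^sup>2) * (exp (s * t + s\<^sup>2 / (2 * n\<^sup>2)) * gauss n y)"
            using t s s0 by (intro norm_gker' n0) auto
          also have "\<dots> \<le> (t + (s1 + Y) / n\<^sup>2) * (E1 * gauss n Y)"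
          proof -
            have "gauss n y = gauss n Y" using y by (auto simp: gauss_def)
            moreover have "s * t + s\<^sup>2 / (2 * n\<^sup>2) \<le> s1 * t + s1\<^sup>2 / (2 * n\<^sup>2)"
              using s s0 t by (intro add_mono mult_right_mono divide_right_mono power_mono) auto
            ultimately show ?thesis
              using s s0 s1 t y n unfolding E1_def
              by (intro mult_mono add_mono divide_right_mono) auto
          qed
          finally have 1: "cmod (gker' n t (Complex s y)) \<le> (t + (s1 + Y) / n\<^sup>2) * (E1 * gauss n Y)" .
          have 2: "norm (M x (Complex s y)) \<le> 8 * C\<^sub>R * norm x"
            using s by (intro M_bound inH) auto
          have "norm (sc (gker' n t (Complex s y)) (M x (Complex s y))) \<le> 2 * ((t + (s1 + Y) / n\<^sup>2) * (E1 * gauss n Y)) * (8 * C\<^sub>R * norm x)"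
            using t s1 Y by (intro order_trans[OF sc_norm] mult_mono 1 2 mult_left_mono) (auto simp: E1_def)
          then show ?thesis by (simp only: \<beta>b_def)
        qed
        then show "norm (sc (gker' n t (Complex s Y)) (M x (Complex s Y))) \<le> \<beta>b Y \<and>
            norm (sc (gker' n t (Complex s (- Y))) (M x (Complex s (- Y)))) \<le> \<beta>b Y"
          using Y by simp
      qed (use Y s1 in auto)
      have parts: "norm (?F Y s0) \<le> 8 * E0 * B + \<gamma>b Y"
      proof -
        let ?P = "\<lambda>z. sc (gker n t z) (M x z)"
        have iF: "(\<lambda>y. sc (gker' n t (Complex s0 y)) (M x (Complex s0 y))) integrable_on {-Y..Y}"
          and iG: "(\<lambda>y. sc (gker n t (Complex s0 y)) (M' x (Complex s0 y))) integrable_on {-Y..Y}"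
          by (intro integrable_continuous_interval continuous_on cgk cM order_refl)+
        have "((\<lambda>y. sc (gker' n t (Complex s0 y)) (M x (Complex s0 y)) + sc (gker n t (Complex s0 y)) (M' x (Complex s0 y)))
          has_integral sc (-\<i>) (?P (Complex s0 Y) - ?P (Complex s0 (-Y)))) {-Y..Y}"
          using Y by (intro integral_vertical[where F="?P" and F'="\<lambda>z. sc (gker' n t z) (M x z) + sc (gker n t z) (M' x z)"]
              has_sc_derivative_sc gker_derivs has_sc_derivative_M inH n0) auto
        from integral_unique[OF this]
        have F: "?F Y s0 = sc (-\<i>) (?P (Complex s0 Y) - ?P (Complex s0 (-Y)))
          - integral {-Y..Y} (\<lambda>y. sc (gker n t (Complex s0 y)) (M' x (Complex s0 y)))"
          using iF iG by (simp add: Henstock_Kurzweil_Integration.integral_add algebra_simps)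
        have gE: "cmod (gker n t (Complex s0 y)) \<le> E0 * gauss n y" for y
          unfolding norm_gker[OF n0] by (intro mult_right_mono E0) auto
        have P: "norm (?P (Complex s0 y)) \<le> 2 * (E0 * gauss n y) * (8 * C\<^sub>R * norm x)" for y
          by (intro order_trans[OF sc_norm] mult_mono mult_left_mono gE M_bound inH) (auto simp: E0_def)
        have "norm (sc (-\<i>) (?P (Complex s0 Y) - ?P (Complex s0 (-Y)))) \<le> 2 * norm (?P (Complex s0 Y) - ?P (Complex s0 (-Y)))"
          using sc_norm[of "-\<i>"] by simp
        also have "\<dots> \<le> 2 * (2 * (2 * (E0 * gauss n Y) * (8 * C\<^sub>R * norm x)))"
          using P[of Y] P[of "-Y", unfolded gauss_even] norm_triangle_ineq4[of "?P (Complex s0 Y)" "?P (Complex s0 (-Y))"]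
          by linarith
        also have "\<dots> = \<gamma>b Y" by (simp add: \<gamma>b_def)
        finally have 1: "norm (sc (-\<i>) (?P (Complex s0 Y) - ?P (Complex s0 (-Y)))) \<le> \<gamma>b Y" .
        have "norm (integral {-Y..Y} (\<lambda>y. sc (gker n t (Complex s0 y)) (M' x (Complex s0 y))))
          \<le> integral {-Y..Y} (\<lambda>y. 2 * E0 * B * (1 + \<bar>y\<bar>) powr (- 3 / 2))"
        proof (rule integral_norm_bound_integral[OF iG])
          show "(\<lambda>y. 2 * E0 * B * (1 + \<bar>y\<bar>) powr (- 3 / 2)) integrable_on {-Y..Y}"
            using integral_powr_three_halves(1)[of Y] Y by (intro integrable_on_mult_right) auto
          fix y
          have "cmod (gker n t (Complex s0 y)) \<le> E0"
          proof (rule order_trans[OF gE])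
            have "gauss n y \<le> 1" by (simp add: gauss_def)
            from mult_left_mono[OF this, of E0] show "E0 * gauss n y \<le> E0" by (simp add: E0_def)
          qed
          then have "norm (sc (gker n t (Complex s0 y)) (M' x (Complex s0 y))) \<le> 2 * E0 * (B * (1 + \<bar>y\<bar>) powr (- 3 / 2))"
            using M'[of y] by (intro order_trans[OF sc_norm] mult_mono mult_left_mono) (auto simp: E0_def s0_def)
          then show "norm (sc (gker n t (Complex s0 y)) (M' x (Complex s0 y))) \<le> 2 * E0 * B * (1 + \<bar>y\<bar>) powr (- 3 / 2)"
            by (simp only: mult.assoc)
        qed
        also have "\<dots> = 2 * E0 * B * integral {-Y..Y} (\<lambda>y. (1 + \<bar>y\<bar>) powr (- 3 / 2))"
          by (rule integral_mult_right)
        also have "\<dots> \<le> 2 * E0 * B * 4"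
          using B Y by (intro mult_left_mono integral_powr_three_halves) (auto simp: E0_def)
        finally show ?thesis
          using 1 unfolding F by (intro order_trans[OF norm_triangle_ineq4]) simp
      qed
      have "norm (?L Y) \<le> norm (?L Y - ?F Y s1) + norm (?F Y s1 - ?F Y s0) + norm (?F Y s0)"
        using norm_triangle_ineq[of "?L Y - ?F Y s1" "?F Y s1 - ?F Y s0"]
          norm_triangle_ineq[of "?L Y - ?F Y s0" "?F Y s0"] by simp
      with remainder shift parts show ?thesis by linarith
    qed
    have lim: "((\<lambda>Y. norm (?L Y)) \<longlongrightarrow> norm ((2 * pi) *\<^sub>R I n)) at_top"
      unfolding I_def using s1 by (intro tendsto_norm laplace_inversion v n0)
    have "((\<lambda>Y. rem n + 8 * E0 * B + (4 * \<beta>b Y * (s1 - s0) + \<gamma>b Y)) \<longlongrightarrow> rem n + 8 * E0 * B + (4 * 0 * (s1 - s0) + 0)) at_top"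
    proof (intro tendsto_intros)
      have g: "(gauss n \<longlongrightarrow> 0) at_top"
        unfolding gauss_def[abs_def] using n0 by real_asymp
      then show "(\<gamma>b \<longlongrightarrow> 0) at_top"
        unfolding \<gamma>b_def[abs_def] by (intro tendsto_mult_left_zero tendsto_mult_right_zero)
      have "((\<lambda>Y. (t + (s1 + Y) / n\<^sup>2) * gauss n Y) \<longlongrightarrow> 0) at_top"
        unfolding gauss_def[abs_def] using n0 by real_asymp
      then have "((\<lambda>Y. ((t + (s1 + Y) / n\<^sup>2) * gauss n Y) * (2 * E1 * (8 * C\<^sub>R * norm x))) \<longlongrightarrow> 0) at_top"
        by (rule tendsto_mult_left_zero)
      then show "(\<beta>b \<longlongrightarrow> 0) at_top" unfolding \<beta>b_def[abs_def] by (simp only: mult_ac)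
    qed
    then have "((\<lambda>Y. rem n + 8 * E0 * B + (4 * \<beta>b Y * (s1 - s0) + \<gamma>b Y)) \<longlongrightarrow> rem n + 8 * E0 * B) at_top" by simp
    moreover have "\<forall>\<^sub>F Y in at_top. norm (?L Y) \<le> rem n + 8 * E0 * B + (4 * \<beta>b Y * (s1 - s0) + \<gamma>b Y)"
      using eventually_gt_at_top[of 0] by eventually_elim (rule main)
    ultimately have "norm ((2 * pi) *\<^sub>R I n) \<le> rem n + 8 * E0 * B"
      by (rule tendsto_le[OF trivial_limit_at_top_linorder _ lim])
    then show ?thesis by simp
  qed
  have lim: "(\<lambda>k. 2 * pi * norm (I (real (Suc k)))) \<longlonglongrightarrow> 2 * pi * norm (t *\<^sub>R v t)"
    unfolding I_def using t by (intro tendsto_intros normal_density_mollify continuous_on_scaleR continuous_on_id v) auto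
  have "(\<lambda>k. rem (real (Suc k))) \<longlonglongrightarrow> 0"
    unfolding rem_def by real_asymp
  then have "(\<lambda>k. rem (real (Suc k)) + 8 * E0 * B) \<longlonglongrightarrow> 0 + 8 * E0 * B" by (intro tendsto_intros)
  moreover have "\<forall>\<^sub>F k in sequentially. 2 * pi * norm (I (real (Suc k))) \<le> rem (real (Suc k)) + 8 * E0 * B"
  proof -
    \<comment> \<open>From N on the far line lies to the right of s0, because \<tau> - t >=
      1.\<close>
    obtain N :: nat where N: "s0 \<le> real N" using real_arch_simple by blast
    show ?thesis
      using eventually_ge_at_top[of N]
    proof eventually_elim
      fix k assume "N \<le> k"
      have "s0 \<le> real (Suc k)" using N \<open>N \<le> k\<close> by simp
      also have "\<dots> \<le> real (Suc k)^2" by (simp add: power2_eq_square)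
      also have "\<dots> \<le> (\<tau> - t) * real (Suc k)^2" using t mult_right_mono[of 1 "\<tau> - t" "real (Suc k)^2"] by simp
      finally show "2 * pi * norm (I (real (Suc k))) \<le> rem (real (Suc k)) + 8 * E0 * B"
        by (intro bound) auto
    qed
  qed
  ultimately have "2 * pi * norm (t *\<^sub>R v t) \<le> 8 * E0 * B"
    using tendsto_le[OF sequentially_bot _ lim] by fastforce
  then have "pi * (t * norm (v t)) \<le> 4 * (E0 * B)" using t by (simp add: mult_ac)
  \<comment> \<open>The inversion formula has 2 \<pi> on the left against 8 on the right; \<pi> > 2
    leaves the constant 2.\<close>
  moreover have "2 * (t * norm (v t)) \<le> pi * (t * norm (v t))"
    using t pi_gt3 by (intro mult_right_mono) auto
  ultimately have "t * norm (v t) \<le> 2 * (E0 * B)" by linarith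
  then show ?thesis by (simp only: E0_def s0_def mult.assoc)
qed

text \<open>The Yosida approximations of the identity.\<close>

definition Q :: "nat \<Rightarrow> 'v \<Rightarrow> 'v" where "Q n x = real n *\<^sub>R R (of_nat n) x"

lemma Q_bound:
  assumes "of_nat n \<in> S"
  shows "norm (Q n x) \<le> C\<^sub>R * norm x"
proof -
  have "norm (Q n x) \<le> real n * (C\<^sub>R / real n * norm x)"
    using mult_left_mono[OF R_norm[OF assms, of x], of "real n"] by (simp add: Q_def)
  also have "\<dots> \<le> C\<^sub>R * norm x" using C\<^sub>R by (cases "n = 0") auto
  finally show ?thesis .
qed

lemma bounded_linear_Q: "of_nat n \<in> S \<Longrightarrow> bounded_linear (Q n)"
  unfolding Q_def by (intro bounded_linear_const_scaleR bounded_linear_R)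

text \<open>An operator that commutes with A commutes with the resolvents of A. It is applied to F =
  G t.\<close>

lemma Q_commute:
  assumes n: "of_nat n \<in> S" and F: "bounded_linear F"
    and FD: "\<And>z. z \<in> D \<Longrightarrow> F z \<in> D \<and> F (A z) = A (F z)"
  shows "F (Q n x) = Q n (F x)"
proof -
  interpret F: bounded_linear F by (rule F)
  have sc_n: "sc (of_nat n) y = real n *\<^sub>R y" for y
    using sc_of_real[of "real n" y] by simp
  have "R (of_nat n) (F x) = F (R (of_nat n) x)"
  proof (rule R_eqI[OF n])
    show "F (R (of_nat n) x) \<in> D" using FD[OF R_D[OF n]] by simp
    have "sc (of_nat n) (F (R (of_nat n) x)) - A (F (R (of_nat n) x)) = F (sc (of_nat n) (R (of_nat n) x) - A (R (of_nat n) x))"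
      using FD[OF R_D[OF n, of x]] by (simp add: sc_n F.diff F.scaleR)
    then show "sc (of_nat n) (F (R (of_nat n) x)) - A (F (R (of_nat n) x)) = F x"
      by (simp add: R_right n)
  qed
  then show ?thesis by (simp add: Q_def F.scaleR)
qed

text \<open>Two estimates with one constant a: the decay of \<open>Rm z\<close> alone gives a / |z|,
  while Q n x - x = A (R n x) and the uniform boundedness of \<open>Rm z\<close> after A give a / n.
  The claim is their geometric mean. The power |z|^(-1/2) that it retains brings M' to order
  |z|^(-3/2), which is integrable on a vertical line.\<close>

lemma Rm_Q_bound:
  assumes n: "of_nat n \<in> S" "1 \<le> n" and z: "z \<in> H"
  shows "norm (Rm z (Q n x - x)) \<le> (2 * C\<^sub>R + 1) * (C\<^sub>R + 1) * norm x / sqrt (real n * cmod z)"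
proof -
  define a where "a = (2 * C\<^sub>R + 1) * (C\<^sub>R + 1) * norm x"
  define w where "w = norm (Rm z (Q n x - x))"
  have a: "0 \<le> a" and w: "0 \<le> w" using C\<^sub>R by (auto simp: a_def w_def)
  have z1: "1 \<le> cmod z" by (rule H_norm[OF z])
  have q: "norm (Q n x - x) \<le> (C\<^sub>R + 1) * norm x"
    using norm_triangle_ineq4[of "Q n x" x] Q_bound[OF n(1), of x] by (simp add: distrib_right)
  have "w \<le> 2 * C\<^sub>R / cmod z * norm (Q n x - x)" unfolding w_def by (rule Rm_norm[OF z])
  also have "\<dots> \<le> (2 * C\<^sub>R + 1) / cmod z * ((C\<^sub>R + 1) * norm x)"
    using C\<^sub>R z1 by (intro mult_mono divide_right_mono q) auto
  also have "\<dots> = a / cmod z" by (simp add: a_def)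
  finally have w1: "w \<le> a / cmod z" .
  let ?y = "R (of_nat n) x"
  have "Q n x - x = A ?y"
    using R_right[OF n(1), of x] sc_of_real[of "real n" ?y] by (simp add: Q_def algebra_simps)
  then have "Rm z (Q n x - x) = sc (\<mu> z) (Rm z ?y) - ?y"
    unfolding Rm_def by (simp add: R_A \<mu>_in z R_D n)
  then have "w \<le> norm (sc (\<mu> z) (Rm z ?y)) + norm ?y"
    unfolding w_def by (simp add: norm_triangle_ineq4)
  also have "norm (sc (\<mu> z) (Rm z ?y)) \<le> 2 * cmod (\<mu> z) * (C\<^sub>R / cmod (\<mu> z) * norm ?y)"
    unfolding Rm_def by (intro order_trans[OF sc_norm] mult_left_mono R_norm \<mu>_in z) auto
  also have "\<dots> \<le> 2 * C\<^sub>R * norm ?y" using C\<^sub>R by (cases "\<mu> z = 0") auto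
  finally have "w \<le> (2 * C\<^sub>R + 1) * norm ?y" by (simp add: distrib_right)
  also have "\<dots> \<le> (2 * C\<^sub>R + 1) * (C\<^sub>R / real n * norm x)"
    using R_norm[OF n(1), of x] C\<^sub>R by (intro mult_left_mono) auto
  also have "\<dots> \<le> (2 * C\<^sub>R + 1) * ((C\<^sub>R + 1) / real n * norm x)"
    using C\<^sub>R n by (intro mult_left_mono mult_right_mono divide_right_mono) auto
  also have "\<dots> = a / real n" by (simp add: a_def)
  finally have w2: "w \<le> a / real n" .
  have "w * w \<le> (a / cmod z) * (a / real n)" using w w1 w2 by (intro mult_mono) auto
  then have "w\<^sup>2 \<le> (a / sqrt (real n * cmod z))\<^sup>2"
    using n z1 by (simp add: power2_eq_square power_divide mult.commute real_sqrt_mult_self)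
  then have "w \<le> a / sqrt (real n * cmod z)"
    using a by (intro power2_le_imp_le[of w]) auto
  then show ?thesis by (simp add: w_def a_def)
qed

text \<open>By commutation the orbit of Q n z - z is Q n (G t z) - G t z, so the smoothing bound for
  that initial value is the claim for z in D. Both sides are continuous in z, which extends it to
  the closure of D.\<close>

lemma smoothing_Q:
  fixes G :: "real \<Rightarrow> 'v \<Rightarrow> 'v"
  assumes nS: "\<And>n. 1 \<le> n \<Longrightarrow> of_nat n \<in> S" and dense: "closure D = UNIV"
    and bl: "\<And>t. 0 \<le> t \<Longrightarrow> bounded_linear (G t)"
    and cont: "\<And>z. continuous_on {0..} (\<lambda>t. G t z)"
    and comm: "\<And>z t. z \<in> D \<Longrightarrow> 0 \<le> t \<Longrightarrow> G t z \<in> D \<and> G t (A z) = A (G t z)"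
    and eq: "\<And>z t. z \<in> D \<Longrightarrow> 0 \<le> t \<Longrightarrow> t \<le> \<tau> \<Longrightarrow>
      G t z = z + integral {0..t} (\<lambda>s. (1 + mm (t - s)) *\<^sub>R A (G s z))"
  obtains C where "0 \<le> C" "\<And>n t x. 1 \<le> n \<Longrightarrow> 0 \<le> t \<Longrightarrow> t \<le> \<tau> - 1 \<Longrightarrow>
    t * norm (G t x - Q n (G t x)) \<le> C / sqrt (real n) * norm x"
proof -
  obtain C1 where C1: "0 \<le> C1" "\<And>z x. z \<in> H \<Longrightarrow> norm (M' x z) \<le> C1 / cmod z * norm (Rm z x)"
    using M'_bound by blast
  define a where "a = (2 * C\<^sub>R + 1) * (C\<^sub>R + 1)"
  have a: "0 \<le> a" using C\<^sub>R by (simp add: a_def)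
  define E where "E = 2 * exp ((\<sigma>\<^sub>0 + 1) * \<tau> + (\<sigma>\<^sub>0 + 1)\<^sup>2)"
  define C where "C = E * (4 * C1 * a)"
  show ?thesis
  proof (rule that[of C])
    show "0 \<le> C" using a C1 by (simp add: C_def E_def)
    fix n :: nat and t :: real and x :: 'v
    assume n: "1 \<le> n" and t: "0 \<le> t" "t \<le> \<tau> - 1"
    note nS = nS[OF n]
    interpret Gt: bounded_linear "G t" by (rule bl[OF t(1)])
    interpret Qn: bounded_linear "Q n" by (rule bounded_linear_Q[OF nS])
    show "t * norm (G t x - Q n (G t x)) \<le> C / sqrt (real n) * norm x"
    proof (cases "t = 0")
      case True
      then show ?thesis using a C1 by (simp add: C_def E_def)
    next
      case False
      then have t0: "0 < t" using t by simp
      have "t * norm (G t z - Q n (G t z)) \<le> C / sqrt (real n) * norm z" if z: "z \<in> D" for z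
      proof -
        define x' where "x' = Q n z - z"
        have x': "x' \<in> D"
          using D_add[OF D_sc[OF R_D[OF nS], of "of_real (real n)"] D_sc[OF z, of "of_real (-1)"], of z]
          by (simp add: x'_def Q_def sc_of_real del: of_real_of_nat_eq of_real_minus)
        define v where "v s = G s x'" for s
        \<comment> \<open>By commutation this is A (v s); written as an orbit it is visibly
          continuous.\<close>
        define b where "b s = G s (A x')" for s
        have cb: "continuous_on X b" and cv: "continuous_on X v" if "X \<subseteq> {0..}" for X
          unfolding v_def[abs_def] b_def[abs_def] using cont that continuous_on_subset by blast+
        have "t * norm (v t) \<le> 2 * exp ((\<sigma>\<^sub>0 + 1) * t + (\<sigma>\<^sub>0 + 1)\<^sup>2) * (4 * C1 * a * norm z / sqrt (real n))"
        proof (rule smoothing_bound)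
          show "v s \<in> D" "A (v s) = b s" if "s \<in> {0..\<tau>}" for s
            using comm[OF x', of s] that by (auto simp: v_def b_def)
          show "v s = x' + integral {0..s} b + integral {0..s} (\<lambda>r. mm (s - r) *\<^sub>R b r)" if s: "s \<in> {0..\<tau>}" for s
          proof -
            have "v s = x' + integral {0..s} (\<lambda>r. (1 + mm (s - r)) *\<^sub>R A (G r x'))"
              unfolding v_def using s by (intro eq[OF x']) auto
            also have "integral {0..s} (\<lambda>r. (1 + mm (s - r)) *\<^sub>R A (G r x')) = integral {0..s} (\<lambda>r. b r + mm (s - r) *\<^sub>R b r)"
              by (rule Henstock_Kurzweil_Integration.integral_cong)
                 (use comm[OF x'] in \<open>auto simp: b_def scaleR_add_left\<close>)
            also have "\<dots> = integral {0..s} b + integral {0..s} (\<lambda>r. mm (s - r) *\<^sub>R b r)"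
              by (intro Henstock_Kurzweil_Integration.integral_add integrable_continuous_interval cb continuous_on_scaleR
                  continuous_on_compose2[OF continuous_mm_UNIV[of UNIV]] continuous_intros) auto
            finally show ?thesis by simp
          qed
          show "0 \<le> 4 * C1 * a * norm z / sqrt (real n)" using C1 a by simp
          fix y
          define w where "w = Complex (\<sigma>\<^sub>0 + 1) y"
          have w: "w \<in> H" by (simp add: w_def H_def)
          have w1: "1 \<le> cmod w" by (rule H_norm[OF w])
          \<comment> \<open>The mean of the two bounds |w| >= 1 and |w| >= |y|; it keeps the
            majorant finite at y = 0.\<close>
          have w2: "(1 + \<bar>y\<bar>) / 2 \<le> cmod w"
            using w1 abs_Im_le_cmod[of w] by (simp add: w_def)
          have "norm (M' x' w) \<le> C1 / cmod w * (a * norm z / sqrt (real n * cmod w))"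
            using C1 Rm_Q_bound[OF nS n w, of z] unfolding x'_def a_def
            by (intro order_trans[OF C1(2)[OF w]] mult_left_mono) auto
          also have "\<dots> = (C1 * a * norm z / sqrt (real n)) * (1 / (cmod w * sqrt (cmod w)))"
            by (simp add: real_sqrt_mult mult.left_commute)
          also have "\<dots> \<le> (C1 * a * norm z / sqrt (real n)) * (4 * (1 + \<bar>y\<bar>) powr (- 3 / 2))"
          proof (rule mult_left_mono)
            have "1 / (cmod w * sqrt (cmod w)) = cmod w powr (- 3 / 2)"
            proof -
              have "cmod w powr (3 / 2) = cmod w powr 1 * cmod w powr (1 / 2)" by (subst powr_add[symmetric]) simp
              also have "\<dots> = cmod w * sqrt (cmod w)" using w1 by (simp add: powr_half_sqrt)
              finally show ?thesis by (simp add: powr_minus_divide)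
            qed
            also have "\<dots> \<le> ((1 + \<bar>y\<bar>) / 2) powr (- 3 / 2)"
              using w2 by (intro powr_mono2') auto
            also have "\<dots> = (1 + \<bar>y\<bar>) powr (- 3 / 2) * 2 powr (3 / 2)"
              by (simp add: powr_divide powr_minus_divide)
            also have "\<dots> \<le> (1 + \<bar>y\<bar>) powr (- 3 / 2) * 4"
            proof (rule mult_left_mono)
              have "2 powr (3 / 2) \<le> 2 powr (2::real)" by (rule powr_mono) auto
              then show "2 powr (3 / 2) \<le> (4::real)" by simp
            qed simp
            finally show "1 / (cmod w * sqrt (cmod w)) \<le> 4 * (1 + \<bar>y\<bar>) powr (- 3 / 2)" by simp
            show "0 \<le> C1 * a * norm z / sqrt (real n)" using C1 a by simp
          qed
          finally show "norm (M' x' (Complex (\<sigma>\<^sub>0 + 1) y)) \<le> 4 * C1 * a * norm z / sqrt (real n) * (1 + \<bar>y\<bar>) powr (- 3 / 2)"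
            by (simp add: w_def mult_ac)
        qed (use cb cv t0 t in auto)
        also have "\<dots> \<le> E * (4 * C1 * a * norm z / sqrt (real n))"
          unfolding E_def using t C1 a \<sigma>\<^sub>0 by (intro mult_right_mono) auto
        also have "\<dots> = C / sqrt (real n) * norm z" by (simp add: C_def)
        also have "v t = Q n (G t z) - G t z"
          unfolding v_def x'_def Gt.diff using Q_commute[OF nS Gt.bounded_linear] comm t by simp
        finally show ?thesis by (simp add: norm_minus_commute)
      qed
      moreover have "closed {x. t * norm (G t x - Q n (G t x)) \<le> C / sqrt (real n) * norm x}"
        by (intro closed_Collect_le continuous_intros Gt.continuous_on Qn.continuous_on)
      ultimately have "closure D \<subseteq> {x. t * norm (G t x - Q n (G t x)) \<le> C / sqrt (real n) * norm x}"
        by (intro closure_minimal) auto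
      then show ?thesis using dense by auto
    qed
  qed
qed

end

section \<open>Strongly measurable functions and the Bochner integral\<close>

text \<open>In a complete space every modification on a null set remains measurable.\<close>

lemma (in complete_measure) borel_measurable_AE_cong:
  fixes f g :: "'a \<Rightarrow> 'b::topological_space"
  assumes f: "f \<in> borel_measurable M" and ae: "AE x in M. f x = g x"
  shows "g \<in> borel_measurable M"
proof (rule measurableI)
  fix B :: "'b set" assume B: "B \<in> sets borel"
  have "f -` B \<inter> space M \<in> sets M" using measurable_sets[OF f B] .
  then show "g -` B \<inter> space M \<in> sets M"
    by (rule in_sets_AE[rotated]) (use ae in auto)
qed simp

lemma (in complete_measure) borel_measurable_AE_LIMSEQ:
  fixes f :: "nat \<Rightarrow> 'a \<Rightarrow> real"
  assumes f: "\<And>i. f i \<in> borel_measurable M" and lim: "AE x in M. (\<lambda>i. f i x) \<longlonglongrightarrow> g x"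
  shows "g \<in> borel_measurable M"
proof (rule borel_measurable_AE_cong)
  have [measurable]: "\<And>i. f i \<in> borel_measurable M" by (rule f)
  show "(\<lambda>x. lim (\<lambda>i. f i x)) \<in> borel_measurable M" by measurable
  show "AE x in M. lim (\<lambda>i. f i x) = g x" using lim by eventually_elim (rule limI)
qed

text \<open>On a complete measure space, strong measurability amounts to measurability of the distances to all
  points together with an almost everywhere separable range; in this form it is closed under
  almost everywhere limits.\<close>

lemma strongly_measurableD:
  fixes f :: "'a \<Rightarrow> 'b::real_normed_vector"
  assumes M: "complete_measure M" and f: "strongly_measurable M f"
  obtains C where "countable C" "0 \<in> C" "\<And>c. (\<lambda>x. dist (f x) c) \<in> borel_measurable M" "AE x in M. f x \<in> closure C"
proof -
  interpret complete_measure M by (rule M)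
  obtain s where s: "\<And>i. simple_function M (s i)" and lim: "AE x in M. (\<lambda>i. s i x) \<longlonglongrightarrow> f x"
    using f by (auto simp: strongly_measurable_def)
  define C where "C = insert 0 (\<Union>i. s i ` space M)"
  show ?thesis
  proof (rule that[of C])
    show "countable C" "0 \<in> C"
      using s by (auto simp: C_def simple_function_def intro: countable_finite)
    show "(\<lambda>x. dist (f x) c) \<in> borel_measurable M" for c
    proof (rule borel_measurable_AE_LIMSEQ)
      show "(\<lambda>x. dist (s i x) c) \<in> borel_measurable M" for i
        using simple_function_compose1[OF s[of i], of "\<lambda>y. dist y c"] by (rule borel_measurable_simple_function)
      show "AE x in M. (\<lambda>i. dist (s i x) c) \<longlonglongrightarrow> dist (f x) c"
        using lim by eventually_elim (intro tendsto_intros)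
    qed
    show "AE x in M. f x \<in> closure C"
      using lim AE_space
    proof eventually_elim
      fix x assume "(\<lambda>i. s i x) \<longlonglongrightarrow> f x" "x \<in> space M"
      then show "f x \<in> closure C"
        unfolding closure_sequential by (intro exI[of _ "\<lambda>i. s i x"]) (auto simp: C_def)
    qed
  qed
qed

text \<open>The n-th approximant is the nearest among the first n + 1 points of an enumeration of C.
  Taking the least such index makes the choice measurable, since the index is determined by the
  measurable distances.\<close>

lemma strongly_measurable_approx:
  fixes f :: "'a \<Rightarrow> 'b::real_normed_vector"
  assumes C: "countable C" "0 \<in> C" and d: "\<And>c. (\<lambda>x. dist (f x) c) \<in> borel_measurable M"
    and cl: "AE x in M. f x \<in> closure C"
  obtains s where "\<And>i. simple_function M (s i)" "\<And>i x. norm (f x - s i x) \<le> norm (f x)"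
    "AE x in M. (\<lambda>i. s i x) \<longlonglongrightarrow> f x"
proof -
  \<comment> \<open>Position 0 is reserved for the point 0: an approximant is then never farther
    from f x than 0 is, which is the domination by norm (f x).\<close>
  define e where "e n = (if n = 0 then 0 else from_nat_into C (n - 1))" for n
  have e: "C \<subseteq> range e"
  proof
    fix c assume "c \<in> C"
    then obtain n where "from_nat_into C n = c" using C from_nat_into_surj by metis
    then have "e (Suc n) = c" by (simp add: e_def)
    then show "c \<in> range e" by blast
  qed
  define j where "j n x = (LEAST k. k \<le> n \<and> (\<forall>l\<le>n. dist (f x) (e k) \<le> dist (f x) (e l)))" for n x
  have jP: "j n x \<le> n \<and> (\<forall>l\<le>n. dist (f x) (e (j n x)) \<le> dist (f x) (e l))" for n x
  proof -
    have "\<exists>k. k \<le> n \<and> (\<forall>l\<le>n. dist (f x) (e k) \<le> dist (f x) (e l))"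
    proof -
      have "finite {..n}" "{..n} \<noteq> {}" by auto
      from arg_min_if_finite(1)[OF this, of "\<lambda>k. dist (f x) (e k)"] arg_min_least[OF this, of _ "\<lambda>k. dist (f x) (e k)"]
      show ?thesis by auto
    qed
    from LeastI_ex[OF this] show ?thesis unfolding j_def .
  qed
  define s where "s n x = e (j n x)" for n x
  show ?thesis
  proof (rule that[of s])
    show "norm (f x - s n x) \<le> norm (f x)" for n x
      using jP[of n x] by (auto simp: s_def dist_norm dest!: conjunct2 spec[of _ 0]) (simp add: e_def)
    show "simple_function M (s n)" for n
    proof -
      have [measurable]: "(\<lambda>x. dist (f x) (e k)) \<in> borel_measurable M" for k by (rule d)
      have "j n \<in> measurable M (count_space UNIV)" unfolding j_def by measurable
      moreover have "j n ` space M \<subseteq> {..n}" using jP by auto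
      ultimately have "simple_function M (j n)"
        by (auto simp: simple_function_def finite_subset intro: measurable_sets)
      from simple_function_compose1[OF this, of e] show ?thesis unfolding s_def[abs_def] .
    qed
    show "AE x in M. (\<lambda>i. s i x) \<longlonglongrightarrow> f x"
      using cl
    proof eventually_elim
      fix x assume x: "f x \<in> closure C"
      show "(\<lambda>i. s i x) \<longlonglongrightarrow> f x"
      proof (rule LIMSEQ_I)
        fix r :: real assume "0 < r"
        then obtain c where "c \<in> C" "dist c (f x) < r" using x closure_approachable by metis
        then obtain k where k: "dist (f x) (e k) < r" using e by (auto simp: dist_commute)
        have "norm (s n x - f x) < r" if "k \<le> n" for n
          using jP[of n x] that k unfolding s_def by (auto simp: dist_norm norm_minus_commute intro: le_less_trans)
        then show "\<exists>no. \<forall>n\<ge>no. norm (s n x - f x) < r" by blast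
      qed
    qed
  qed
qed

lemma strongly_measurableI:
  fixes f :: "'a \<Rightarrow> 'b::real_normed_vector"
  assumes "countable C" "\<And>c. (\<lambda>x. dist (f x) c) \<in> borel_measurable M" "AE x in M. f x \<in> closure C"
  shows "strongly_measurable M f"
proof -
  have "AE x in M. f x \<in> closure (insert 0 C)"
    using assms(3) closure_mono[of C "insert 0 C"] by (auto elim!: eventually_mono)
  then show ?thesis
    using strongly_measurable_approx[of "insert 0 C" f M] assms unfolding strongly_measurable_def
    by (metis countable_insert insertI1)
qed

lemma strongly_measurable_norm:
  assumes "complete_measure M" "strongly_measurable M f"
  shows "(\<lambda>x. norm (f x)) \<in> borel_measurable M"
proof -
  obtain C where "\<And>c. (\<lambda>x. dist (f x) c) \<in> borel_measurable M"
    using strongly_measurableD[OF assms] by blast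
  from this[of 0] show ?thesis by simp
qed

lemma strongly_measurable_LIMSEQ:
  fixes f :: "nat \<Rightarrow> 'a \<Rightarrow> 'b::real_normed_vector"
  assumes M: "complete_measure M" and f: "\<And>i. strongly_measurable M (f i)"
    and lim: "AE x in M. (\<lambda>i. f i x) \<longlonglongrightarrow> g x"
  shows "strongly_measurable M g"
proof -
  interpret complete_measure M by (rule M)
  have "\<exists>C. countable C \<and> (\<forall>c. (\<lambda>x. dist (f i x) c) \<in> borel_measurable M) \<and> (AE x in M. f i x \<in> closure C)" for i
    using strongly_measurableD[OF M f[of i]] by blast
  then obtain C where C: "\<And>i. countable (C i)" "\<And>i c. (\<lambda>x. dist (f i x) c) \<in> borel_measurable M"
    "\<And>i. AE x in M. f i x \<in> closure (C i)" by metis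
  show ?thesis
  proof (rule strongly_measurableI)
    show "countable (\<Union>i. C i)" using C by auto
    show "(\<lambda>x. dist (g x) c) \<in> borel_measurable M" for c
    proof (rule borel_measurable_AE_LIMSEQ)
      show "AE x in M. (\<lambda>i. dist (f i x) c) \<longlonglongrightarrow> dist (g x) c"
        using lim by eventually_elim (intro tendsto_intros)
    qed (rule C)
    have "AE x in M. \<forall>i. f i x \<in> closure (C i)" using C by (simp add: AE_all_countable)
    then show "AE x in M. g x \<in> closure (\<Union>i. C i)"
      using lim
    proof eventually_elim
      fix x assume 1: "\<forall>i. f i x \<in> closure (C i)" "(\<lambda>i. f i x) \<longlonglongrightarrow> g x"
      have "f i x \<in> closure (\<Union>i. C i)" for i
        using 1(1) closure_mono[of "C i" "\<Union>i. C i"] by auto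
      then show "g x \<in> closure (\<Union>i. C i)"
        by (intro closed_sequentially[OF closed_closure _ 1(2)])
    qed
  qed
qed

lemma strongly_measurable_simple: "simple_function M f \<Longrightarrow> strongly_measurable M f"
  unfolding strongly_measurable_def by (intro exI[of _ "\<lambda>_. f"]) auto

lemma strongly_measurable_compose2:
  fixes p :: "'b::real_normed_vector \<Rightarrow> 'c::real_normed_vector \<Rightarrow> 'd::real_normed_vector"
  assumes "strongly_measurable M f" "strongly_measurable M g" and p: "continuous_on UNIV (\<lambda>(x, y). p x y)"
  shows "strongly_measurable M (\<lambda>x. p (f x) (g x))"
proof -
  obtain s t where s: "\<And>i. simple_function M (s i)" "AE x in M. (\<lambda>i. s i x) \<longlonglongrightarrow> f x"
    and t: "\<And>i. simple_function M (t i)" "AE x in M. (\<lambda>i. t i x) \<longlonglongrightarrow> g x"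
    using assms by (auto simp: strongly_measurable_def)
  have "simple_function M (\<lambda>x. p (s i x) (t i x))" for i
    using s(1)[of i] t(1)[of i] by (rule simple_function_compose2)
  moreover have "AE x in M. (\<lambda>i. p (s i x) (t i x)) \<longlonglongrightarrow> p (f x) (g x)"
    using s(2) t(2)
  proof eventually_elim
    fix x assume "(\<lambda>i. s i x) \<longlonglongrightarrow> f x" "(\<lambda>i. t i x) \<longlonglongrightarrow> g x"
    then have "(\<lambda>i. (s i x, t i x)) \<longlonglongrightarrow> (f x, g x)" by (rule tendsto_Pair)
    with continuous_on_tendsto_compose[OF p this] show "(\<lambda>i. p (s i x) (t i x)) \<longlonglongrightarrow> p (f x) (g x)"
      by simp
  qed
  ultimately show ?thesis unfolding strongly_measurable_def
    by (intro exI[of _ "\<lambda>i x. p (s i x) (t i x)"]) simp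
qed

lemma strongly_measurable_compose:
  assumes "strongly_measurable M f" "continuous_on UNIV p"
  shows "strongly_measurable M (\<lambda>x. p (f x))"
proof (rule strongly_measurable_compose2[OF assms(1) assms(1), of "\<lambda>x y. p x"])
  show "continuous_on UNIV (\<lambda>(x, y). p x)"
    unfolding split_beta by (rule continuous_on_compose2[OF assms(2)]) (auto intro: continuous_intros)
qed

lemma strongly_measurable_add:
  "strongly_measurable M f \<Longrightarrow> strongly_measurable M g \<Longrightarrow> strongly_measurable M (\<lambda>x. f x + g x)"
  by (rule strongly_measurable_compose2) (auto simp: split_beta intro!: continuous_intros)

lemma strongly_measurable_diff:
  "strongly_measurable M f \<Longrightarrow> strongly_measurable M g \<Longrightarrow> strongly_measurable M (\<lambda>x. f x - g x)"
  by (rule strongly_measurable_compose2) (auto simp: split_beta intro!: continuous_intros)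

text \<open>If \<open>g\<close> is simple, the composition is a finite sum over the level sets of \<open>g\<close>.\<close>

lemma strongly_measurable_caratheodory:
  fixes F :: "'a \<Rightarrow> 'b::real_normed_vector \<Rightarrow> 'c::real_normed_vector"
  assumes M: "complete_measure M" and F: "\<And>y. strongly_measurable M (\<lambda>x. F x y)"
    and cont: "AE x in M. continuous_on UNIV (F x)" and g: "strongly_measurable M g"
  shows "strongly_measurable M (\<lambda>x. F x (g x))"
proof -
  obtain s where s: "\<And>i. simple_function M (s i)" "AE x in M. (\<lambda>i. s i x) \<longlonglongrightarrow> g x"
    using g by (auto simp: strongly_measurable_def)
  have "strongly_measurable M (\<lambda>x. F x (s i x))" for i
  proof -
    have fin: "finite (s i ` space M)" using s by (simp add: simple_function_def)
    have "\<exists>t. (\<forall>k. simple_function M (t k)) \<and> (AE x in M. (\<lambda>k. t k x) \<longlonglongrightarrow> F x y)" for y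
      using F[of y] by (simp add: strongly_measurable_def)
    then obtain t where t: "\<And>y k. simple_function M (t y k)" "\<And>y. AE x in M. (\<lambda>k. t y k x) \<longlonglongrightarrow> F x y"
      by metis
    have "simple_function M (\<lambda>x. t (s i x) k x)" for k
    proof -
      let ?h = "\<lambda>x. t (s i x) k x"
      have "finite (?h ` space M)"
      proof (rule finite_subset)
        show "?h ` space M \<subseteq> (\<Union>y\<in>s i ` space M. t y k ` space M)" by auto
        show "finite (\<Union>y\<in>s i ` space M. t y k ` space M)"
          by (rule finite_UN_I[OF fin]) (rule simple_functionD(1)[OF t(1)])
      qed
      moreover have "?h -` {z} \<inter> space M \<in> sets M" for z
      proof -
        have eq: "?h -` {z} \<inter> space M = (\<Union>y\<in>s i ` space M. (s i -` {y} \<inter> space M) \<inter> (t y k -` {z} \<inter> space M))"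
          by auto
        have m: "s i -` {y} \<inter> space M \<in> sets M" "t y k -` {z} \<inter> space M \<in> sets M" for y
          using simple_functionD(2)[OF s(1)] simple_functionD(2)[OF t(1)] by blast+
        show ?thesis unfolding eq
          by (rule sets.finite_UN[OF fin]) (rule sets.Int[OF m])
      qed
      ultimately show ?thesis by (simp add: simple_function_def)
    qed
    moreover have "AE x in M. (\<lambda>k. t (s i x) k x) \<longlonglongrightarrow> F x (s i x)"
    proof -
      \<comment> \<open>The simple function takes finitely many values, so one null set serves for
        all of them.\<close>
      have "AE x in M. \<forall>y\<in>s i ` space M. (\<lambda>k. t y k x) \<longlonglongrightarrow> F x y"
        using fin t by (intro AE_finite_allI) auto
      then show ?thesis using AE_space by eventually_elim auto
    qed
    ultimately show ?thesis unfolding strongly_measurable_def by (intro exI[of _ "\<lambda>k x. t (s i x) k x"]) simp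
  qed
  moreover have "AE x in M. (\<lambda>i. F x (s i x)) \<longlonglongrightarrow> F x (g x)"
    using s(2) cont by eventually_elim (auto intro: continuous_on_tendsto_compose)
  ultimately show ?thesis by (rule strongly_measurable_LIMSEQ[OF M])
qed

section \<open>Existence and estimates of the Bochner integral\<close>

lemma complete_measure_lebesgue_on:
  assumes "S \<in> sets lebesgue"
  shows "complete_measure (lebesgue_on S)"
proof
  fix A B assume "B \<subseteq> A" "A \<in> null_sets (lebesgue_on S)"
  then show "B \<in> sets (lebesgue_on S)"
    using assms completion.complete2[of B A lborel]
    by (auto simp: null_sets_restrict_space sets_restrict_space_iff)
qed

text \<open>f is interposed between s and t. This inequality gives the Cauchy property in the
  existence proof, the norm bound (with t = 0), and the comparison of approximants in the
  restriction lemma.\<close>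

lemma simple_bochner_integral_dist_le:
  fixes f :: "'a \<Rightarrow> 'b::real_normed_vector"
  assumes M: "complete_measure M" and f: "strongly_measurable M f"
    and s: "Bochner_Integration.simple_bochner_integrable M s" and t: "Bochner_Integration.simple_bochner_integrable M t"
  shows "ennreal (norm (Bochner_Integration.simple_bochner_integral M s - Bochner_Integration.simple_bochner_integral M t))
    \<le> (\<integral>\<^sup>+ x. norm (f x - s x) \<partial>M) + (\<integral>\<^sup>+ x. norm (f x - t x) \<partial>M)"
proof -
  have "simple_function M s" "simple_function M t"
    using s t by (auto elim: Bochner_Integration.simple_bochner_integrable.cases)
  then have st: "strongly_measurable M s" "strongly_measurable M t"
    by (simp_all add: strongly_measurable_simple)
  have [measurable]: "(\<lambda>x. norm (f x - s x)) \<in> borel_measurable M" "(\<lambda>x. norm (f x - t x)) \<in> borel_measurable M"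
    by (intro strongly_measurable_norm[OF M] strongly_measurable_diff f st)+
  have "ennreal (norm (Bochner_Integration.simple_bochner_integral M s - Bochner_Integration.simple_bochner_integral M t))
      = norm (Bochner_Integration.simple_bochner_integral M (\<lambda>x. s x - t x))"
    using s t by (subst simple_bochner_integral_diff) auto
  also have "\<dots> \<le> Bochner_Integration.simple_bochner_integral M (\<lambda>x. norm (s x - t x))"
    using simple_bochner_integrable_compose2[of "(-)" M s t] s t
    by (auto intro!: simple_bochner_integral_norm_bound)
  also have "\<dots> = (\<integral>\<^sup>+x. norm (s x - t x) \<partial>M)"
    using simple_bochner_integrable_compose2[of "\<lambda>x y. norm (x - y)" M s t] s t
    by (auto intro!: simple_bochner_integral_eq_nn_integral)
  also have "\<dots> \<le> (\<integral>\<^sup>+x. ennreal (norm (f x - s x)) + ennreal (norm (f x - t x)) \<partial>M)"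
    using norm_triangle_ineq4[of "f x - t x" "f x - s x" for x]
    by (intro nn_integral_mono) (simp add: add.commute flip: ennreal_plus)
  also have "\<dots> = (\<integral>\<^sup>+ x. norm (f x - s x) \<partial>M) + (\<integral>\<^sup>+ x. norm (f x - t x) \<partial>M)"
    by (rule nn_integral_add) auto
  finally show ?thesis .
qed

text \<open>On a finite measure space every simple function is integrable. The approximants satisfy
  norm (f x - s i x) <= norm (f x), so dominated convergence makes them converge in mean and
  completeness of the space does the rest.\<close>

lemma strong_bochner_integral_exists:
  fixes f :: "'a \<Rightarrow> 'b::banach"
  assumes M: "complete_measure M" "finite_measure M" and f: "strongly_measurable M f"
    and fin: "(\<integral>\<^sup>+ x. norm (f x) \<partial>M) < \<infinity>"
  obtains I where "strong_has_bochner_integral M f I"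
proof -
  interpret finite_measure M by (rule M)
  obtain C where C: "countable C" "0 \<in> C" "\<And>c. (\<lambda>x. dist (f x) c) \<in> borel_measurable M" "AE x in M. f x \<in> closure C"
    using strongly_measurableD[OF M(1) f] by blast
  obtain s where s: "\<And>i. simple_function M (s i)" "\<And>i x. norm (f x - s i x) \<le> norm (f x)"
    "AE x in M. (\<lambda>i. s i x) \<longlonglongrightarrow> f x"
    using strongly_measurable_approx[OF C] by blast
  have sb: "Bochner_Integration.simple_bochner_integrable M (s i)" for i
    by (rule Bochner_Integration.simple_bochner_integrable.intros[OF s(1)]) simp
  have m: "(\<lambda>x. norm (f x - s i x)) \<in> borel_measurable M" "(\<lambda>x. norm (f x)) \<in> borel_measurable M" for i
    by (intro strongly_measurable_norm[OF M(1)] strongly_measurable_diff f strongly_measurable_simple s)+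
  have lim: "(\<lambda>i. \<integral>\<^sup>+ x. norm (f x - s i x) \<partial>M) \<longlonglongrightarrow> 0"
  proof -
    have "(\<lambda>i. \<integral>\<^sup>+ x. norm (f x - s i x) \<partial>M) \<longlonglongrightarrow> (\<integral>\<^sup>+ x. ennreal 0 \<partial>M)"
    proof (rule nn_integral_dominated_convergence[where w="\<lambda>x. ennreal (norm (f x))"])
      show "AE x in M. (\<lambda>i. ennreal (norm (f x - s i x))) \<longlonglongrightarrow> ennreal 0"
        using s(3)
      proof eventually_elim
        fix x assume "(\<lambda>i. s i x) \<longlonglongrightarrow> f x"
        then have "(\<lambda>i. norm (f x - s i x)) \<longlonglongrightarrow> norm (f x - f x)" by (intro tendsto_intros)
        then have "(\<lambda>i. ennreal (norm (f x - s i x))) \<longlonglongrightarrow> ennreal (norm (f x - f x))" by (rule tendsto_ennrealI)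
        then show "(\<lambda>i. ennreal (norm (f x - s i x))) \<longlonglongrightarrow> ennreal 0" by simp
      qed
    qed (use m fin s(2) in \<open>auto intro!: ennreal_leI\<close>)
    then show ?thesis by simp
  qed
  let ?I = "\<lambda>i. Bochner_Integration.simple_bochner_integral M (s i)"
  have "Cauchy ?I"
  proof (rule CauchyI)
    fix r :: real assume "0 < r"
    then have "\<forall>\<^sub>F i in sequentially. (\<integral>\<^sup>+ x. norm (f x - s i x) \<partial>M) < ennreal (r / 2)"
      using lim by (intro order_tendstoD(2)) auto
    then obtain N where N: "\<And>i. N \<le> i \<Longrightarrow> (\<integral>\<^sup>+ x. norm (f x - s i x) \<partial>M) < ennreal (r / 2)"
      by (auto simp: eventually_sequentially)
    have "norm (?I i - ?I j) < r" if "N \<le> i" "N \<le> j" for i j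
    proof -
      have "ennreal (norm (?I i - ?I j)) \<le> (\<integral>\<^sup>+ x. norm (f x - s i x) \<partial>M) + (\<integral>\<^sup>+ x. norm (f x - s j x) \<partial>M)"
        by (rule simple_bochner_integral_dist_le[OF M(1) f sb sb])
      also have "\<dots> < ennreal (r / 2) + ennreal (r / 2)"
        using N that by (intro add_strict_mono) auto
      also have "\<dots> = ennreal r" using \<open>0 < r\<close> by (simp flip: ennreal_plus)
      finally show ?thesis by (simp add: ennreal_less_iff)
    qed
    then show "\<exists>N. \<forall>i\<ge>N. \<forall>j\<ge>N. norm (?I i - ?I j) < r" by blast
  qed
  then obtain I where "?I \<longlonglongrightarrow> I" using Cauchy_convergent convergent_def by blast
  then have "strong_has_bochner_integral M f I"
    unfolding strong_has_bochner_integral_def using f sb lim by blast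
  then show ?thesis by (rule that)
qed

lemma strong_bochner_integral_norm_le:
  fixes f :: "'a \<Rightarrow> 'b::real_normed_vector"
  assumes M: "complete_measure M" and f: "strong_has_bochner_integral M f I"
  shows "ennreal (norm I) \<le> (\<integral>\<^sup>+ x. norm (f x) \<partial>M)"
proof -
  obtain s where s: "\<And>i. Bochner_Integration.simple_bochner_integrable M (s i)"
    "(\<lambda>i. \<integral>\<^sup>+x. norm (f x - s i x) \<partial>M) \<longlonglongrightarrow> 0"
    "(\<lambda>i. Bochner_Integration.simple_bochner_integral M (s i)) \<longlonglongrightarrow> I"
    and sm: "strongly_measurable M f"
    using f unfolding strong_has_bochner_integral_def by auto
  have z: "Bochner_Integration.simple_bochner_integrable M (\<lambda>x. 0)"
    by (rule Bochner_Integration.simple_bochner_integrable.intros) auto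
  have z0: "Bochner_Integration.simple_bochner_integral M (\<lambda>x. 0 :: 'b) = 0"
    unfolding Bochner_Integration.simple_bochner_integral_def by (rule sum.neutral) auto
  have "ennreal (norm (Bochner_Integration.simple_bochner_integral M (s i))) \<le> (\<integral>\<^sup>+x. norm (f x - s i x) \<partial>M) + (\<integral>\<^sup>+ x. norm (f x) \<partial>M)" for i
    using simple_bochner_integral_dist_le[OF M sm s(1)[of i] z]
    by (simp add: z0)
  then have le: "\<exists>N. \<forall>i\<ge>N. ennreal (norm (Bochner_Integration.simple_bochner_integral M (s i))) \<le> (\<integral>\<^sup>+x. norm (f x - s i x) \<partial>M) + (\<integral>\<^sup>+ x. norm (f x) \<partial>M)"
    by blast
  have l1: "(\<lambda>i. ennreal (norm (Bochner_Integration.simple_bochner_integral M (s i)))) \<longlonglongrightarrow> ennreal (norm I)"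
    by (intro tendsto_ennrealI tendsto_norm s)
  have l2: "(\<lambda>i. (\<integral>\<^sup>+x. norm (f x - s i x) \<partial>M) + (\<integral>\<^sup>+ x. norm (f x) \<partial>M)) \<longlonglongrightarrow> 0 + (\<integral>\<^sup>+ x. norm (f x) \<partial>M)"
    by (intro tendsto_add s tendsto_const)
  show ?thesis using LIMSEQ_le[OF l1 l2 le] by simp
qed

lemma strong_bochner_integral_norm_le_integral:
  assumes M: "complete_measure M" and f: "strong_has_bochner_integral M f I"
    and h: "integrable M h" and le: "AE x in M. norm (f x) \<le> h x"
  shows "norm I \<le> integral\<^sup>L M h"
proof -
  have nn: "AE x in M. 0 \<le> h x" using le by eventually_elim (rule order_trans[OF norm_ge_zero])
  have "ennreal (norm I) \<le> (\<integral>\<^sup>+ x. norm (f x) \<partial>M)" by (rule strong_bochner_integral_norm_le[OF M f])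
  also have "\<dots> \<le> (\<integral>\<^sup>+ x. h x \<partial>M)"
    using le by (intro nn_integral_mono_AE) (auto elim!: eventually_mono intro: ennreal_leI)
  also have "\<dots> = ennreal (integral\<^sup>L M h)" by (rule nn_integral_eq_integral[OF h nn])
  finally show ?thesis using integral_nonneg_AE[OF nn] by simp
qed

lemma strong_bochner_integrable_bound:
  fixes f :: "'a \<Rightarrow> 'b::banach"
  assumes M: "complete_measure M" "finite_measure M" and f: "strongly_measurable M f"
    and h: "integrable M h" and le: "AE x in M. norm (f x) \<le> h x"
  obtains I where "strong_has_bochner_integral M f I"
proof (rule strong_bochner_integral_exists[OF M f _ that])
  have nn: "AE x in M. 0 \<le> h x" using le by eventually_elim (rule order_trans[OF norm_ge_zero])
  have "(\<integral>\<^sup>+ x. norm (f x) \<partial>M) \<le> (\<integral>\<^sup>+ x. h x \<partial>M)"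
    using le by (intro nn_integral_mono_AE) (auto elim!: eventually_mono intro: ennreal_leI)
  also have "\<dots> = ennreal (integral\<^sup>L M h)" by (rule nn_integral_eq_integral[OF h nn])
  finally show "(\<integral>\<^sup>+ x. norm (f x) \<partial>M) < \<infinity>" by (simp add: le_less_trans[OF _ ennreal_less_top])
qed

lemma strong_bochner_integral_diff:
  assumes M: "complete_measure M" and f: "strong_has_bochner_integral M f I" and g: "strong_has_bochner_integral M g J"
  shows "strong_has_bochner_integral M (\<lambda>x. f x - g x) (I - J)"
proof -
  obtain s where s: "\<And>i. Bochner_Integration.simple_bochner_integrable M (s i)"
    "(\<lambda>i. \<integral>\<^sup>+x. norm (f x - s i x) \<partial>M) \<longlonglongrightarrow> 0"
    "(\<lambda>i. Bochner_Integration.simple_bochner_integral M (s i)) \<longlonglongrightarrow> I"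
    and fm: "strongly_measurable M f"
    using f unfolding strong_has_bochner_integral_def by auto
  obtain t where t: "\<And>i. Bochner_Integration.simple_bochner_integrable M (t i)"
    "(\<lambda>i. \<integral>\<^sup>+x. norm (g x - t i x) \<partial>M) \<longlonglongrightarrow> 0"
    "(\<lambda>i. Bochner_Integration.simple_bochner_integral M (t i)) \<longlonglongrightarrow> J"
    and gm: "strongly_measurable M g"
    using g unfolding strong_has_bochner_integral_def by auto
  have sm: "strongly_measurable M (s i)" "strongly_measurable M (t i)" for i
    using s(1)[of i] t(1)[of i] by (auto intro!: strongly_measurable_simple elim: Bochner_Integration.simple_bochner_integrable.cases)
  have [measurable]: "(\<lambda>x. norm (f x - s i x)) \<in> borel_measurable M" "(\<lambda>x. norm (g x - t i x)) \<in> borel_measurable M" for i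
    by (intro strongly_measurable_norm[OF M] strongly_measurable_diff fm gm sm)+
  have sb: "Bochner_Integration.simple_bochner_integrable M (\<lambda>x. s i x - t i x)" for i
    using simple_bochner_integrable_compose2[of "(-)" M "s i" "t i"] s t by simp
  have "(\<lambda>i. \<integral>\<^sup>+x. norm ((f x - g x) - (s i x - t i x)) \<partial>M) \<longlonglongrightarrow> 0"
  proof (rule tendsto_sandwich[OF _ _ tendsto_const])
    have "(\<integral>\<^sup>+x. norm ((f x - g x) - (s i x - t i x)) \<partial>M)
      \<le> (\<integral>\<^sup>+x. ennreal (norm (f x - s i x)) + ennreal (norm (g x - t i x)) \<partial>M)" for i
    proof (rule nn_integral_mono)
      fix x
      have "(f x - g x) - (s i x - t i x) = (f x - s i x) - (g x - t i x)" by simp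
      then have "norm ((f x - g x) - (s i x - t i x)) \<le> norm (f x - s i x) + norm (g x - t i x)"
        by (metis norm_triangle_ineq4)
      then show "ennreal (norm ((f x - g x) - (s i x - t i x))) \<le> ennreal (norm (f x - s i x)) + ennreal (norm (g x - t i x))"
        by (simp flip: ennreal_plus)
    qed
    then show "\<forall>\<^sub>F i in sequentially. (\<integral>\<^sup>+x. norm ((f x - g x) - (s i x - t i x)) \<partial>M)
      \<le> (\<integral>\<^sup>+x. norm (f x - s i x) \<partial>M) + (\<integral>\<^sup>+x. norm (g x - t i x) \<partial>M)"
      by (intro always_eventually allI) (simp add: nn_integral_add)
    show "(\<lambda>i. (\<integral>\<^sup>+x. norm (f x - s i x) \<partial>M) + (\<integral>\<^sup>+x. norm (g x - t i x) \<partial>M)) \<longlonglongrightarrow> 0"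
      using tendsto_add[OF s(2) t(2)] by simp
  qed auto
  moreover have "(\<lambda>i. Bochner_Integration.simple_bochner_integral M (\<lambda>x. s i x - t i x)) \<longlonglongrightarrow> I - J"
    using tendsto_diff[OF s(3) t(3)] by (simp add: simple_bochner_integral_diff s t)
  ultimately show ?thesis
    unfolding strong_has_bochner_integral_def using strongly_measurable_diff[OF fm gm] sb
    by (intro conjI exI[of _ "\<lambda>i x. s i x - t i x"]) auto
qed

lemma strong_bochner_integral_linear:
  assumes M: "complete_measure M" and f: "strong_has_bochner_integral M f I" and F: "bounded_linear F"
  shows "strong_has_bochner_integral M (\<lambda>x. F (f x)) (F I)"
proof -
  interpret F: bounded_linear F by (rule F)
  obtain K where K: "0 \<le> K" "\<And>x. norm (F x) \<le> norm x * K" using F.nonneg_bounded by auto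
  obtain s where s: "\<And>i. Bochner_Integration.simple_bochner_integrable M (s i)"
    "(\<lambda>i. \<integral>\<^sup>+x. norm (f x - s i x) \<partial>M) \<longlonglongrightarrow> 0"
    "(\<lambda>i. Bochner_Integration.simple_bochner_integral M (s i)) \<longlonglongrightarrow> I"
    and fm: "strongly_measurable M f"
    using f unfolding strong_has_bochner_integral_def by auto
  have [measurable]: "(\<lambda>x. norm (f x - s i x)) \<in> borel_measurable M" for i
    using s(1)[of i] by (intro strongly_measurable_norm[OF M] strongly_measurable_diff fm strongly_measurable_simple)
      (auto elim: Bochner_Integration.simple_bochner_integrable.cases)
  have sb: "Bochner_Integration.simple_bochner_integrable M (\<lambda>x. F (s i x))" for i
    using simple_bochner_integrable_compose2[of "\<lambda>x y. F x" M "s i" "s i"] s by (simp add: F.zero)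
  have "(\<lambda>i. \<integral>\<^sup>+x. norm (F (f x) - F (s i x)) \<partial>M) \<longlonglongrightarrow> 0"
  proof (rule tendsto_sandwich[OF _ _ tendsto_const])
    have "(\<integral>\<^sup>+x. norm (F (f x) - F (s i x)) \<partial>M) \<le> (\<integral>\<^sup>+x. ennreal K * ennreal (norm (f x - s i x)) \<partial>M)" for i
      using K by (intro nn_integral_mono) (simp add: mult.commute flip: ennreal_mult F.diff)
    then show "\<forall>\<^sub>F i in sequentially. (\<integral>\<^sup>+x. norm (F (f x) - F (s i x)) \<partial>M) \<le> ennreal K * (\<integral>\<^sup>+x. norm (f x - s i x) \<partial>M)"
      by (intro always_eventually allI) (simp add: nn_integral_cmult)
    show "(\<lambda>i. ennreal K * (\<integral>\<^sup>+x. norm (f x - s i x) \<partial>M)) \<longlonglongrightarrow> 0"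
      using ennreal_tendsto_cmult[OF _ s(2), of "ennreal K"] by simp
  qed auto
  moreover have "(\<lambda>i. Bochner_Integration.simple_bochner_integral M (\<lambda>x. F (s i x))) \<longlonglongrightarrow> F I"
    using F.tendsto[OF s(3)] by (simp add: simple_bochner_integral_linear[OF F.linear] s)
  ultimately show ?thesis
    unfolding strong_has_bochner_integral_def using strongly_measurable_compose[OF fm F.continuous_on[OF continuous_on_id]] sb
    by (intro conjI exI[of _ "\<lambda>i x. F (s i x)"]) auto
qed

lemma strongly_measurable_restrict:
  assumes \<Omega>: "\<Omega> \<in> sets M" and f: "strongly_measurable M f"
  shows "strongly_measurable (restrict_space M \<Omega>) f"
proof -
  obtain s where s: "\<And>i. simple_function M (s i)" "AE x in M. (\<lambda>i. s i x) \<longlonglongrightarrow> f x"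
    using f by (auto simp: strongly_measurable_def)
  have o: "\<Omega> \<inter> space M \<in> sets M" using \<Omega> by auto
  have "simple_function (restrict_space M \<Omega>) (s i)" for i
    unfolding simple_function_restrict_space[OF o]
    using simple_function_compose2[OF simple_function_indicator[OF \<Omega>] s(1)[of i], of "(*\<^sub>R)"] .
  moreover have "AE x in restrict_space M \<Omega>. (\<lambda>i. s i x) \<longlonglongrightarrow> f x"
    using s(2) o by (simp add: AE_restrict_space_iff) (auto elim: eventually_mono)
  ultimately show ?thesis unfolding strongly_measurable_def by blast
qed

lemma strong_bochner_integral_restrict:
  assumes M: "complete_measure M" and \<Omega>: "\<Omega> \<in> sets M" and fm: "strongly_measurable M f"
    and f: "strong_has_bochner_integral M (\<lambda>x. indicator \<Omega> x *\<^sub>R f x) I"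
  shows "strong_has_bochner_integral (restrict_space M \<Omega>) f I"
proof -
  let ?g = "\<lambda>x. indicator \<Omega> x *\<^sub>R f x"
  have o: "\<Omega> \<inter> space M \<in> sets M" using \<Omega> by auto
  obtain s where s: "\<And>i. Bochner_Integration.simple_bochner_integrable M (s i)"
    "(\<lambda>i. \<integral>\<^sup>+x. norm (?g x - s i x) \<partial>M) \<longlonglongrightarrow> 0"
    "(\<lambda>i. Bochner_Integration.simple_bochner_integral M (s i)) \<longlonglongrightarrow> I"
    and gm: "strongly_measurable M ?g"
    using f unfolding strong_has_bochner_integral_def by auto
  \<comment> \<open>The given approximants need not vanish outside \<Omega>. Cutting them off can
    only decrease their distance to the integrand, and leaves the limit of their integrals
    unchanged.\<close>
  let ?t = "\<lambda>i x. indicator \<Omega> x *\<^sub>R s i x"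
  have tb: "Bochner_Integration.simple_bochner_integrable M (?t i)" for i
  proof (rule Bochner_Integration.simple_bochner_integrable.intros)
    have si: "simple_function M (s i)" and fin: "emeasure M {y \<in> space M. s i y \<noteq> 0} \<noteq> \<infinity>"
      using s(1)[of i] by (auto elim: Bochner_Integration.simple_bochner_integrable.cases)
    show "simple_function M (?t i)"
      using simple_function_compose2[OF simple_function_indicator[OF \<Omega>] si, of "(*\<^sub>R)"] .
    have "emeasure M {y \<in> space M. ?t i y \<noteq> 0} \<le> emeasure M {y \<in> space M. s i y \<noteq> 0}"
      using simple_functionD(2)[OF si, of "- {0}"] by (intro emeasure_mono) (auto simp: vimage_def Int_def conj_commute)
    then show "emeasure M {y \<in> space M. ?t i y \<noteq> 0} \<noteq> \<infinity>" using fin by (auto simp: top_unique)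
  qed
  have le: "(\<integral>\<^sup>+x. norm (?g x - ?t i x) \<partial>M) \<le> (\<integral>\<^sup>+x. norm (?g x - s i x) \<partial>M)" for i
    by (intro nn_integral_mono) (auto simp: indicator_def)
  have lt: "(\<lambda>i. \<integral>\<^sup>+x. norm (?g x - ?t i x) \<partial>M) \<longlonglongrightarrow> 0"
    by (rule tendsto_sandwich[OF _ _ tendsto_const s(2)]) (use le in auto)
  let ?S = "\<lambda>i. Bochner_Integration.simple_bochner_integral M (s i)"
  let ?T = "\<lambda>i. Bochner_Integration.simple_bochner_integral M (?t i)"
  have "(\<lambda>i. ennreal (norm (?T i - ?S i))) \<longlonglongrightarrow> 0"
  proof (rule tendsto_sandwich[OF _ _ tendsto_const])
    show "\<forall>\<^sub>F i in sequentially. ennreal (norm (?T i - ?S i)) \<le> (\<integral>\<^sup>+x. norm (?g x - ?t i x) \<partial>M) + (\<integral>\<^sup>+x. norm (?g x - s i x) \<partial>M)"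
      by (intro always_eventually allI simple_bochner_integral_dist_le[OF M gm tb s(1)])
    show "(\<lambda>i. (\<integral>\<^sup>+x. norm (?g x - ?t i x) \<partial>M) + (\<integral>\<^sup>+x. norm (?g x - s i x) \<partial>M)) \<longlonglongrightarrow> 0"
      using tendsto_add[OF lt s(2)] by simp
  qed auto
  then have "(\<lambda>i. norm (?T i - ?S i)) \<longlonglongrightarrow> 0"
    using tendsto_ennreal_iff[where F=sequentially and f="\<lambda>i. norm (?T i - ?S i)" and x=0]
    by (simp add: ennreal_0[symmetric] del: ennreal_0)
  then have T: "?T \<longlonglongrightarrow> I"
    using Lim_transform[OF s(3), of ?T] tendsto_norm_zero_cancel by fastforce
  have sbr: "Bochner_Integration.simple_bochner_integrable (restrict_space M \<Omega>) (s i)" for i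
    using tb[of i] simple_bochner_integrable_restrict_space[OF o, of "s i"] by simp
  have "(\<integral>\<^sup>+x. norm (f x - s i x) \<partial>restrict_space M \<Omega>) = (\<integral>\<^sup>+x. norm (?g x - ?t i x) \<partial>M)" for i
    by (subst nn_integral_restrict_space[OF o]) (auto intro!: nn_integral_cong simp: indicator_def)
  then show ?thesis
    unfolding strong_has_bochner_integral_def
    using strongly_measurable_restrict[OF \<Omega> fm] sbr lt T
    by (intro conjI exI[of _ s]) (auto simp: simple_bochner_integral_restrict_space[OF o])
qed

text \<open>Baire category: one of the closed sublevel sets X k contains a ball. Applied to G on
  [0, T], it turns strong continuity into a common operator bound.\<close>

lemma uniform_boundedness:
  fixes F :: "'j \<Rightarrow> 'a::banach \<Rightarrow> 'b::real_normed_vector"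
  assumes F: "\<And>j. j \<in> J \<Longrightarrow> bounded_linear (F j)" and b: "\<And>x. bounded ((\<lambda>j. F j x) ` J)"
  obtains K where "0 \<le> K" "\<And>j x. j \<in> J \<Longrightarrow> norm (F j x) \<le> K * norm x"
proof -
  define X where "X k = {x. \<forall>j\<in>J. norm (F j x) \<le> real k}" for k
  have X: "closed (X k)" for k
  proof -
    have "X k = (\<Inter>j\<in>J. {x. norm (F j x) \<le> real k})" by (auto simp: X_def)
    then show ?thesis
      using F by (auto intro!: closed_INT closed_Collect_le continuous_intros bounded_linear.continuous_on[OF F])
  qed
  have cover: "\<Union>(range X) = UNIV"
  proof -
    have "\<exists>k. x \<in> X k" for x
    proof -
      obtain c where c: "\<And>j. j \<in> J \<Longrightarrow> norm (F j x) \<le> c" using b[of x] by (auto simp: bounded_iff)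
      obtain k where "c \<le> real k" using real_arch_simple by blast
      then have "x \<in> X k" using c by (force simp: X_def)
      then show ?thesis by blast
    qed
    then show ?thesis by blast
  qed
  have "\<exists>k. interior (X k) \<noteq> {}"
  proof (rule ccontr)
    assume "\<nexists>k. interior (X k) \<noteq> {}"
    then have "closedin euclidean T \<and> euclidean interior_of T = {}" if "T \<in> range X" for T
      using that X by (auto simp flip: closed_closedin)
    then have "euclidean interior_of \<Union>(range X) = {}"
      by (intro Baire_category_alt disjI1 completely_metrizable_space_euclidean) auto
    then show False unfolding cover by simp
  qed
  then obtain k where "interior (X k) \<noteq> {}" by auto
  then obtain x0 r where r: "0 < r" "ball x0 r \<subseteq> X k"
    by (meson equals0I mem_interior)
  show ?thesis
  \<comment> \<open>A vector of norm r / 2 is the difference of two points of the ball, whence 2 k;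
    rescaling to this norm contributes 2 / r.\<close>
  proof (rule that[of "2 * real k * (2 / r)"])
    show "0 \<le> 2 * real k * (2 / r)" using r by simp
    fix j x assume j: "j \<in> J"
    interpret bounded_linear "F j" by (rule F[OF j])
    show "norm (F j x) \<le> 2 * real k * (2 / r) * norm x"
    proof (cases "x = 0")
      case False
      define y where "y = (r / (2 * norm x)) *\<^sub>R x"
      have ny: "norm y = r / 2" using False r by (simp add: y_def)
      have "x0 + y \<in> X k" "x0 \<in> X k" using r ny by (auto simp: subset_eq dist_norm)
      then have "norm (F j (x0 + y)) \<le> real k" "norm (F j x0) \<le> real k" using j by (auto simp: X_def)
      then have "norm (F j y) \<le> 2 * real k"
        using norm_triangle_ineq4[of "F j (x0 + y)" "F j x0"] by (simp add: add)
      moreover have "norm (F j y) = r / (2 * norm x) * norm (F j x)"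
        using r by (simp add: y_def scaleR)
      ultimately show ?thesis using r False by (simp add: field_simps)
    qed (simp add: zero)
  qed
qed

text \<open>The image of the rationals is countable, and dense in the range by continuity.\<close>

lemma strongly_measurable_continuous:
  fixes \<phi> :: "real \<Rightarrow> 'b::real_normed_vector"
  assumes S: "S \<in> sets lebesgue" and \<phi>: "continuous_on UNIV \<phi>"
  shows "strongly_measurable (lebesgue_on S) \<phi>"
proof (rule strongly_measurableI[of "\<phi> ` \<rat>"])
  show "countable (\<phi> ` \<rat>)" by (simp add: countable_rat)
  show "(\<lambda>x. dist (\<phi> x) c) \<in> borel_measurable (lebesgue_on S)" for c
    by (intro continuous_imp_measurable_on_sets_lebesgue S continuous_intros continuous_on_subset[OF \<phi>]) auto
  have "\<phi> ` closure \<rat> \<subseteq> closure (\<phi> ` \<rat>)"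
    by (rule image_closure_subset[OF continuous_on_subset[OF \<phi>] _ closure_subset[THEN subset_trans]])
       (auto simp: closure_subset)
  moreover have "closure \<rat> = (UNIV :: real set)"
  proof -
    have "\<exists>q\<in>\<rat>. dist q x < e" if "0 < e" for x e :: real
    proof -
      obtain q where "q \<in> \<rat>" "x < q" "q < x + e" using Rats_dense_in_real[of x "x + e"] \<open>0 < e\<close> by auto
      then show ?thesis by (intro bexI[of _ q]) (auto simp: dist_real_def)
    qed
    then show ?thesis by (auto simp: closure_approachable)
  qed
  ultimately show "AE x in lebesgue_on S. \<phi> x \<in> closure (\<phi> ` \<rat>)"
    by (auto simp: image_subset_iff)
qed

lemma strongly_measurable_cong:
  assumes "\<And>x. x \<in> space M \<Longrightarrow> f x = g x"
  shows "strongly_measurable M f \<longleftrightarrow> strongly_measurable M g"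
  unfolding strongly_measurable_def using assms by (simp cong: AE_cong)

lemma strong_has_bochner_integral_cong:
  assumes "\<And>x. x \<in> space M \<Longrightarrow> f x = g x" "strong_has_bochner_integral M f I"
  shows "strong_has_bochner_integral M g I"
proof -
  have "strongly_measurable M f = strongly_measurable M g"
    unfolding strongly_measurable_def using assms(1) by (simp cong: AE_cong)
  moreover have "(\<integral>\<^sup>+x. norm (f x - s x) \<partial>M) = (\<integral>\<^sup>+x. norm (g x - s x) \<partial>M)" for s
    by (intro nn_integral_cong) (simp add: assms(1))
  ultimately show ?thesis using assms(2) unfolding strong_has_bochner_integral_def by simp
qed

text \<open>Absolute continuity of the integral, uniform in the position of the interval: truncating
  h at a height n leaves a small remainder, and the bounded part contributes at most n times the
  length.\<close>

lemma integral_Icc_small: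
  fixes h :: "real \<Rightarrow> real"
  assumes h: "integrable (lebesgue_on {0..T}) h" and nn: "\<And>s. 0 \<le> h s" and \<epsilon>: "0 < \<epsilon>"
  obtains \<delta> where "0 < \<delta>" "\<And>a b. b - a \<le> \<delta> \<Longrightarrow> (LINT s|lebesgue_on {0..T}. indicator {a..b} s * h s) \<le> \<epsilon>"
proof -
  let ?M = "lebesgue_on {0..T}"
  have [measurable]: "h \<in> borel_measurable ?M" using h by auto
  have "(\<lambda>n. LINT s|?M. h s - min (h s) (real n)) \<longlonglongrightarrow> (LINT s|?M. 0)"
  proof (rule integral_dominated_convergence[where w=h])
    have "(\<lambda>n. h s - min (h s) (real n)) \<longlonglongrightarrow> 0" for s
    proof (rule tendsto_eventually)
      obtain N :: nat where "h s \<le> real N" using real_arch_simple by blast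
      then show "\<forall>\<^sub>F n in sequentially. h s - min (h s) (real n) = 0"
        by (intro eventually_sequentiallyI[of N]) (simp add: min_def)
    qed
    then show "AE s in ?M. (\<lambda>n. h s - min (h s) (real n)) \<longlonglongrightarrow> 0" by simp
    show "AE s in ?M. norm (h s - min (h s) (real n)) \<le> h s" for n
      using nn by (intro AE_I2) (auto simp: min_def)
  qed (use h in auto)
  then have "\<forall>\<^sub>F n in sequentially. (LINT s|?M. h s - min (h s) (real n)) < \<epsilon> / 2"
    using \<epsilon> by (intro order_tendstoD(2)) auto
  then obtain n where n: "(LINT s|?M. h s - min (h s) (real n)) < \<epsilon> / 2"
    using eventually_happens'[OF sequentially_bot] by blast
  \<comment> \<open>n + 1 in place of n covers n = 0; in any case n \<delta> <= \<epsilon> /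
    2.\<close>
  define \<delta> where "\<delta> = \<epsilon> / (2 * (real n + 1))"
  show ?thesis
  proof (rule that[of \<delta>])
    show "0 < \<delta>" using \<epsilon> by (simp add: \<delta>_def)
    fix a b assume ab: "b - a \<le> \<delta>"
    have im: "integrable ?M (\<lambda>s. h s - min (h s) (real n))"
      by (rule Bochner_Integration.integrable_bound[OF h]) (use nn in \<open>auto simp: min_def\<close>)
    have ms: "{a..b} \<inter> {0..T} \<in> sets ?M" by (simp add: sets_restrict_space_iff)
    have fin: "emeasure ?M ({a..b} \<inter> {0..T}) < \<infinity>"
      by (cases "max a 0 \<le> min b T") (simp_all add: emeasure_restrict_space)
    have ii: "integrable ?M (\<lambda>s. real n * indicator ({a..b} \<inter> {0..T}) s)"
      using ms fin by (intro integrable_mult_right integrable_real_indicator)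
    have "(LINT s|?M. indicator {a..b} s * h s) \<le> (LINT s|?M. (h s - min (h s) (real n)) + real n * indicator ({a..b} \<inter> {0..T}) s)"
    proof (rule integral_mono)
      show "integrable ?M (\<lambda>s. indicator {a..b} s * h s)"
        using integrable_mult_indicator[OF ms h] by (rule Bochner_Integration.integrable_cong[THEN iffD1, rotated -1]) (auto simp: indicator_def)
      show "integrable ?M (\<lambda>s. (h s - min (h s) (real n)) + real n * indicator ({a..b} \<inter> {0..T}) s)"
        using im ii by (rule Bochner_Integration.integrable_add)
      show "indicator {a..b} s * h s \<le> (h s - min (h s) (real n)) + real n * indicator ({a..b} \<inter> {0..T}) s"
        if "s \<in> space ?M" for s
        using that nn[of s] by (auto simp: indicator_def min_def)
    qed
    also have "\<dots> = (LINT s|?M. h s - min (h s) (real n)) + real n * measure ?M ({a..b} \<inter> {0..T})"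
      using im ii ms by simp
    also have "measure ?M ({a..b} \<inter> {0..T}) \<le> \<delta>"
    proof -
      have "measure ?M ({a..b} \<inter> {0..T}) = measure lebesgue ({a..b} \<inter> {0..T})"
        by (simp add: measure_restrict_space)
      also have "\<dots> \<le> measure lebesgue {a..b}"
        by (rule measure_mono_fmeasurable) auto
      also have "\<dots> \<le> \<delta>" using ab \<open>0 < \<delta>\<close> by (cases "a \<le> b") auto
      finally show ?thesis .
    qed
    then have "real n * measure ?M ({a..b} \<inter> {0..T}) \<le> real n * \<delta>" by (rule mult_left_mono) simp
    also have "\<dots> \<le> \<epsilon> / 2" using \<epsilon> by (simp add: \<delta>_def field_simps)
    finally show "(LINT s|?M. indicator {a..b} s * h s) \<le> \<epsilon>" using n by simp
  qed
qed

lemma simple_bochner_has_integral: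
  fixes s :: "real \<Rightarrow> 'a::banach"
  assumes "Bochner_Integration.simple_bochner_integrable (lebesgue_on {a..b}) s"
  shows "(s has_integral Bochner_Integration.simple_bochner_integral (lebesgue_on {a..b}) s) {a..b}"
proof -
  have sf: "simple_function (lebesgue_on {a..b}) s"
    using assms by (auto elim: Bochner_Integration.simple_bochner_integrable.cases)
  have fin: "finite (s ` {a..b})" using simple_functionD(1)[OF sf] by simp
  define E where "E y = {x \<in> {a..b}. s x = y}" for y
  have E: "E y \<in> lmeasurable" for y
  proof -
    have "E y = s -` {y} \<inter> space (lebesgue_on {a..b})" by (auto simp: E_def)
    then have "E y \<in> sets (lebesgue_on {a..b})" using simple_functionD(2)[OF sf, of "{y}"] by simp
    then have "E y \<in> sets lebesgue" by (simp add: sets_restrict_space_iff)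
    then show ?thesis
      by (rule fmeasurableI2[of "{a..b}", rotated 2]) (auto simp: E_def)
  qed
  have "((\<lambda>x. indicator (E y) x *\<^sub>R y) has_integral measure lebesgue (E y) *\<^sub>R y) {a..b}" for y
  proof -
    have "((indicator (E y) :: real \<Rightarrow> real) has_integral measure lebesgue (E y)) UNIV"
      using E lmeasurable_iff_has_integral by blast
    moreover have "(indicator (E y) :: real \<Rightarrow> real) = (\<lambda>x. if x \<in> {a..b} then indicator (E y) x else 0)"
      by (auto simp: fun_eq_iff E_def indicator_def)
    ultimately have "((indicator (E y) :: real \<Rightarrow> real) has_integral measure lebesgue (E y)) {a..b}"
      using has_integral_restrict_UNIV by metis
    from has_integral_scaleR_left[OF this] show ?thesis .
  qed
  then have "((\<lambda>x. \<Sum>y\<in>s ` {a..b}. indicator (E y) x *\<^sub>R y) has_integral (\<Sum>y\<in>s ` {a..b}. measure lebesgue (E y) *\<^sub>R y)) {a..b}"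
    using fin by (intro has_integral_sum) auto
  also have "(\<Sum>y\<in>s ` {a..b}. measure lebesgue (E y) *\<^sub>R y) = Bochner_Integration.simple_bochner_integral (lebesgue_on {a..b}) s"
    unfolding Bochner_Integration.simple_bochner_integral_def
  proof (rule sum.cong)
    fix y
    have "{x \<in> space (lebesgue_on {a..b}). s x = y} = E y" by (simp add: E_def)
    moreover have "measure (lebesgue_on {a..b}) (E y) = measure lebesgue (E y)"
      by (rule measure_restrict_space) (auto simp: E_def)
    ultimately show "measure lebesgue (E y) *\<^sub>R y = measure (lebesgue_on {a..b}) {x \<in> space (lebesgue_on {a..b}). s x = y} *\<^sub>R y"
      by simp
  qed simp
  finally show ?thesis
  proof (rule has_integral_eq[rotated])
    fix x assume x: "x \<in> {a..b}"
    have "(\<Sum>y\<in>s ` {a..b}. indicator (E y) x *\<^sub>R y) = (\<Sum>y\<in>s ` {a..b}. if y = s x then y else 0)"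
      using x by (intro sum.cong) (auto simp: E_def indicator_def)
    then show "(\<Sum>y\<in>s ` {a..b}. indicator (E y) x *\<^sub>R y) = s x" using fin x by simp
  qed
qed

text \<open>Connects condition (c), stated with the Bochner integral, with the gauge integral used
  for the transforms. On simple functions the two integrals coincide, and both are controlled by the
  L1 distance to the approximants.\<close>

lemma strong_bochner_integral_eq_integral:
  fixes f :: "real \<Rightarrow> 'a::banach"
  assumes f: "strong_has_bochner_integral (lebesgue_on {a..b}) f I" and i: "f integrable_on {a..b}"
  shows "I = integral {a..b} f"
proof -
  let ?M = "lebesgue_on {a..b}"
  have M: "complete_measure ?M" by (rule complete_measure_lebesgue_on) simp
  obtain s where s: "\<And>i. Bochner_Integration.simple_bochner_integrable ?M (s i)"
    "(\<lambda>i. \<integral>\<^sup>+x. norm (f x - s i x) \<partial>?M) \<longlonglongrightarrow> 0"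
    "(\<lambda>i. Bochner_Integration.simple_bochner_integral ?M (s i)) \<longlonglongrightarrow> I"
    and fm: "strongly_measurable ?M f"
    using f unfolding strong_has_bochner_integral_def by auto
  have m: "(\<lambda>x. norm (f x - s i x)) \<in> borel_measurable ?M" for i
    using s(1)[of i] by (intro strongly_measurable_norm[OF M] strongly_measurable_diff fm strongly_measurable_simple)
      (auto elim: Bochner_Integration.simple_bochner_integrable.cases)
  let ?S = "\<lambda>i. Bochner_Integration.simple_bochner_integral ?M (s i)"
  have "(\<lambda>i. ennreal (norm (integral {a..b} f - ?S i))) \<longlonglongrightarrow> 0"
  proof (rule tendsto_sandwich[OF _ _ tendsto_const s(2)])
    have "\<forall>\<^sub>F i in sequentially. (\<integral>\<^sup>+x. norm (f x - s i x) \<partial>?M) < \<infinity>"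
      using s(2) by (rule order_tendstoD(2)) simp
    then show "\<forall>\<^sub>F i in sequentially. ennreal (norm (integral {a..b} f - ?S i)) \<le> (\<integral>\<^sup>+x. norm (f x - s i x) \<partial>?M)"
    proof eventually_elim
      fix i assume fin: "(\<integral>\<^sup>+x. norm (f x - s i x) \<partial>?M) < \<infinity>"
      have int: "integrable ?M (\<lambda>x. norm (f x - s i x))"
        by (rule integrableI_bounded) (use m fin in auto)
      note hs = simple_bochner_has_integral[OF s(1)[of i]]
      have le: "norm (integral {a..b} (\<lambda>x. f x - s i x)) \<le> integral {a..b} (\<lambda>x. norm (f x - s i x))"
        using i hs int by (intro integral_norm_bound_integral integrable_diff)
          (auto simp: integrable_on_lebesgue_on)
      have e1: "integral {a..b} (\<lambda>x. norm (f x - s i x)) = integral\<^sup>L ?M (\<lambda>x. norm (f x - s i x))"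
        using int by (intro lebesgue_integral_eq_integral[symmetric]) auto
      have e2: "integral {a..b} (\<lambda>x. f x - s i x) = integral {a..b} f - ?S i"
        using Henstock_Kurzweil_Integration.integral_diff[OF i has_integral_integrable[OF hs]] integral_unique[OF hs] by simp
      have "ennreal (norm (integral {a..b} f - ?S i)) \<le> ennreal (integral\<^sup>L ?M (\<lambda>x. norm (f x - s i x)))"
        using le unfolding e1 e2 by (rule ennreal_leI)
      also have "\<dots> = (\<integral>\<^sup>+x. norm (f x - s i x) \<partial>?M)"
        using int by (intro nn_integral_eq_integral[symmetric]) auto
      finally show "ennreal (norm (integral {a..b} f - ?S i)) \<le> (\<integral>\<^sup>+x. norm (f x - s i x) \<partial>?M)" .
    qed
  qed simp
  then have "(\<lambda>i. norm (integral {a..b} f - ?S i)) \<longlonglongrightarrow> 0"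
    using tendsto_ennreal_iff[where F=sequentially and f="\<lambda>i. norm (integral {a..b} f - ?S i)" and x=0]
    by (simp add: ennreal_0[symmetric] del: ennreal_0)
  then have "(\<lambda>i. integral {a..b} f - ?S i) \<longlonglongrightarrow> 0" by (rule tendsto_norm_zero_cancel)
  from tendsto_diff[OF tendsto_const[of "integral {a..b} f"] this]
  have "?S \<longlonglongrightarrow> integral {a..b} f" by simp
  then show ?thesis by (rule LIMSEQ_unique[OF s(3)])
qed

section \<open>Tonelli's method for the integral equation\<close>

text \<open>The interface between the two halves of the proof: from here on the operator A, the
  sector and the kernel are hidden behind the approximants Q. The function h is one integrable bound
  for all forcing terms that will occur.\<close>

locale smoothing_family =
  fixes G :: "real \<Rightarrow> 'w \<Rightarrow> 'w::banach" and Q :: "nat \<Rightarrow> 'w \<Rightarrow> 'w"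
    and T C K :: real and h :: "real \<Rightarrow> real"
  assumes T: "0 < T" and C: "0 \<le> C" and K: "0 \<le> K"
    and G_linear: "0 \<le> t \<Longrightarrow> bounded_linear (G t)"
    and G_continuous: "continuous_on {0..} (\<lambda>t. G t z)"
    and G_0: "G 0 z = z"
    and G_bound: "0 \<le> t \<Longrightarrow> t \<le> T \<Longrightarrow> norm (G t z) \<le> K * norm z"
    and Q_linear: "1 \<le> n \<Longrightarrow> bounded_linear (Q n)"
    and Q_compact: "1 \<le> n \<Longrightarrow> compact_operator (Q n)"
    and Q_bound: "1 \<le> n \<Longrightarrow> norm (Q n z) \<le> C * norm z"
    and G_Q: "1 \<le> n \<Longrightarrow> 0 \<le> t \<Longrightarrow> G t (Q n z) = Q n (G t z)"
    and smoothing: "1 \<le> n \<Longrightarrow> 0 \<le> t \<Longrightarrow> t \<le> T \<Longrightarrow> t * norm (G t z - Q n (G t z)) \<le> C / sqrt (real n) * norm z"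
    and h_integrable: "integrable (lebesgue_on {0..T}) h" and h_nonneg: "\<And>s. 0 \<le> h s"
begin

abbreviation "L \<equiv> lebesgue_on {0..T}"

lemma L_complete: "complete_measure L" by (rule complete_measure_lebesgue_on) simp

lemma L_finite: "finite_measure L" by (rule finite_measure_lebesgue_on) simp

definition admissible :: "(real \<Rightarrow> 'w) \<Rightarrow> bool" where
  "admissible g \<longleftrightarrow> strongly_measurable L g \<and> (AE s in L. norm (g s) \<le> h s)"

text \<open>The indicator lets all t share the measure space over [0, T]; \<open>max 0\<close> keeps
  the argument of G nonnegative, where linearity and continuity are known.\<close>

definition kern :: "real \<Rightarrow> (real \<Rightarrow> 'w) \<Rightarrow> real \<Rightarrow> 'w" where
  "kern t g s = indicator {0..t} s *\<^sub>R G (max 0 (t - s)) (g s)"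

text \<open>The convolution of G with g at time t, made a total function by choice.\<close>

definition V :: "real \<Rightarrow> (real \<Rightarrow> 'w) \<Rightarrow> 'w" where
  "V t g = (SOME I. strong_has_bochner_integral L (kern t g) I)"

lemma G_continuous_UNIV: "continuous_on UNIV (\<lambda>s. G (max 0 (t - s)) z)"
  by (rule continuous_on_compose2[OF G_continuous]) (auto intro!: continuous_intros)

lemma strongly_measurable_G:
  assumes "strongly_measurable L g"
  shows "strongly_measurable L (\<lambda>s. G (max 0 (t - s)) (g s))"
  by (rule strongly_measurable_caratheodory[OF L_complete _ _ assms])
     (auto intro!: strongly_measurable_continuous G_continuous_UNIV bounded_linear.continuous_on[OF G_linear] continuous_on_id)

lemma strongly_measurable_kern:
  assumes "strongly_measurable L g"
  shows "strongly_measurable L (kern t g)"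
proof -
  have "simple_function L (indicator ({0..t} \<inter> {0..T}) :: real \<Rightarrow> real)"
    by (rule simple_function_indicator) (simp add: sets_restrict_space_iff)
  then have "strongly_measurable L (indicator ({0..t} \<inter> {0..T}) :: real \<Rightarrow> real)"
    by (rule strongly_measurable_simple)
  from strongly_measurable_compose2[OF this strongly_measurable_G[OF assms, of t], of "(*\<^sub>R)"]
  have "strongly_measurable L (\<lambda>s. indicator ({0..t} \<inter> {0..T}) s *\<^sub>R G (max 0 (t - s)) (g s))"
    by (simp add: split_beta continuous_intros)
  then show ?thesis
    by (rule strongly_measurable_cong[THEN iffD1, rotated]) (auto simp: kern_def indicator_def)
qed

lemma integrable_indicator_h: "integrable L (\<lambda>s. indicator {a..b} s * h s)"
proof -
  have "integrable L (\<lambda>s. indicator ({a..b} \<inter> {0..T}) s *\<^sub>R h s)"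
    by (rule integrable_mult_indicator[OF _ h_integrable]) (simp add: sets_restrict_space_iff)
  then show ?thesis
    by (rule Bochner_Integration.integrable_cong[THEN iffD1, rotated -1]) (auto simp: indicator_def)
qed

lemma kern_bound:
  assumes "admissible g" "t \<le> T"
  shows "AE s in L. norm (kern t g s) \<le> K * (indicator {0..t} s * h s)"
proof -
  have "AE s in L. norm (g s) \<le> h s" using assms by (simp add: admissible_def)
  then show ?thesis
  proof eventually_elim
    fix s assume g: "norm (g s) \<le> h s"
    show "norm (kern t g s) \<le> K * (indicator {0..t} s * h s)"
    proof (cases "s \<in> {0..t}")
      case True
      then have "norm (G (max 0 (t - s)) (g s)) \<le> K * norm (g s)" using assms by (intro G_bound) auto
      also have "\<dots> \<le> K * h s" using g K by (rule mult_left_mono)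
      finally show ?thesis using True by (simp add: kern_def)
    qed (simp add: kern_def)
  qed
qed

lemma has_integral_V:
  assumes g: "admissible g" and t: "t \<le> T"
  shows "strong_has_bochner_integral L (kern t g) (V t g)"
proof -
  obtain I where "strong_has_bochner_integral L (kern t g) I"
    using strong_bochner_integrable_bound[OF L_complete L_finite strongly_measurable_kern
        integrable_mult_right[OF integrable_indicator_h] kern_bound[OF g t]] g
    by (auto simp: admissible_def)
  then show ?thesis unfolding V_def by (rule someI)
qed

lemma has_integral_V_restrict:
  assumes g: "admissible g" and t: "0 \<le> t" "t \<le> T"
  shows "strong_has_bochner_integral (lebesgue_on {0..t}) (\<lambda>s. G (t - s) (g s)) (V t g)"
proof -
  have "strong_has_bochner_integral (restrict_space L {0..t}) (\<lambda>s. G (max 0 (t - s)) (g s)) (V t g)"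
  proof (rule strong_bochner_integral_restrict[OF L_complete])
    show "{0..t} \<in> sets L" using t by (simp add: sets_restrict_space_iff)
    show "strongly_measurable L (\<lambda>s. G (max 0 (t - s)) (g s))"
      using g by (intro strongly_measurable_G) (simp add: admissible_def)
    show "strong_has_bochner_integral L (\<lambda>s. indicator {0..t} s *\<^sub>R G (max 0 (t - s)) (g s)) (V t g)"
      using has_integral_V[OF g t(2)] unfolding kern_def[abs_def] .
  qed
  also have "restrict_space L {0..t} = lebesgue_on {0..t}"
    using t by (subst restrict_restrict_space) (auto simp: min_absorb2)
  finally show ?thesis by (rule strong_has_bochner_integral_cong[rotated]) (auto simp: max_def)
qed

text \<open>Causality: \<open>kern t\<close> erases g after time t, so both sides are the same
  choice. The delayed equations can be solved step by step because of this.\<close>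

lemma V_cong:
  assumes "\<And>s. s \<in> {0..t} \<Longrightarrow> g s = g' s"
  shows "V t g = V t g'"
proof -
  have "kern t g = kern t g'" using assms by (auto simp: kern_def fun_eq_iff indicator_def)
  then show ?thesis by (simp add: V_def)
qed

lemma h_small:
  assumes "0 < \<epsilon>"
  obtains \<delta> where "0 < \<delta>" "\<And>a b. b - a \<le> \<delta> \<Longrightarrow> (LINT s|L. indicator {a..b} s * h s) \<le> \<epsilon>"
  using integral_Icc_small[OF h_integrable h_nonneg assms] by blast

text \<open>The interval [0, 0] is shorter than every \<delta> of \<open>h_small\<close>, so it
  carries no mass of h.\<close>

lemma V_0:
  assumes "admissible g"
  shows "V 0 g = 0"
proof -
  have "norm (V 0 g) \<le> (LINT s|L. K * (indicator {0..0} s * h s))"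
    using T kern_bound[OF assms, of 0] has_integral_V[OF assms, of 0]
    by (intro strong_bochner_integral_norm_le_integral[OF L_complete] integrable_mult_right integrable_indicator_h) auto
  also have "\<dots> = K * (LINT s|L. indicator {0..0} s * h s)" by (rule Bochner_Integration.integral_mult_right_zero)
  finally have le: "norm (V 0 g) \<le> K * (LINT s|L. indicator {0..0} s * h s)" .
  have "(LINT s|L. indicator {0..0} s * h s) \<le> 0"
  proof (rule field_le_epsilon)
    fix e :: real assume "0 < e"
    from h_small[OF this] show "(LINT s|L. indicator {0..0} s * h s) \<le> 0 + e"
      by (metis add.left_neutral diff_self less_imp_le)
  qed
  from order_trans[OF le mult_left_mono[OF this K]]
  show ?thesis by simp
qed

text \<open>The index n depends on \<epsilon> alone. For s within \<delta> of t, where the smoothing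
  bound degenerates, absolute continuity of the integral of h takes over with the crude constant A =
  (1 + C) K. For earlier s the singular factor 1 / (t - s) is at most 1 / \<delta>, and n^(-1/2)
  wins.\<close>

lemma V_approx:
  assumes "0 < \<epsilon>"
  obtains n where "1 \<le> n" "\<And>g t. admissible g \<Longrightarrow> 0 \<le> t \<Longrightarrow> t \<le> T \<Longrightarrow> norm (V t g - Q n (V t g)) \<le> \<epsilon>"
proof -
  define A where "A = (1 + C) * K"
  have A: "0 \<le> A" using C K by (simp add: A_def)
  obtain \<delta> where \<delta>: "0 < \<delta>" "\<And>a b. b - a \<le> \<delta> \<Longrightarrow> (LINT s|L. indicator {a..b} s * h s) \<le> \<epsilon> / (2 * (A + 1))"
    using h_small[of "\<epsilon> / (2 * (A + 1))"] assms A by auto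
  define J where "J = integral\<^sup>L L h"
  have J: "0 \<le> J" unfolding J_def by (rule Bochner_Integration.integral_nonneg) (rule h_nonneg)
  have "(\<lambda>n. (C / \<delta>) * J * (1 / sqrt (real n))) \<longlonglongrightarrow> (C / \<delta>) * J * 0"
    by (intro tendsto_intros) real_asymp
  then have "\<forall>\<^sub>F n in sequentially. (C / \<delta>) * J * (1 / sqrt (real n)) < \<epsilon> / 2"
    by (rule order_tendstoD(2)) (use assms in simp)
  then have "\<forall>\<^sub>F n in sequentially. (C / \<delta>) * J * (1 / sqrt (real n)) < \<epsilon> / 2 \<and> 1 \<le> n"
    using eventually_ge_at_top[of "1::nat"] by eventually_elim simp
  from eventually_happens'[OF sequentially_bot this]
  obtain n where n: "(C / \<delta>) * J * (1 / sqrt (real n)) < \<epsilon> / 2" "1 \<le> n" by (elim exE conjE)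
  interpret Qn: bounded_linear "Q n" by (rule Q_linear[OF n(2)])
  show ?thesis
  proof (rule that[OF n(2)])
    fix g t assume g: "admissible g" and t: "0 \<le> t" "t \<le> T"
    have hb: "strong_has_bochner_integral L (\<lambda>s. kern t g s - Q n (kern t g s)) (V t g - Q n (V t g))"
      by (rule strong_bochner_integral_diff[OF L_complete has_integral_V[OF g t(2)]
            strong_bochner_integral_linear[OF L_complete has_integral_V[OF g t(2)] Qn.bounded_linear]])
    have "AE s in L. norm (g s) \<le> h s" using g by (simp add: admissible_def)
    then have ae: "AE s in L. norm (kern t g s - Q n (kern t g s)) \<le> A * (indicator {t - \<delta>..t} s * h s) + C / (sqrt (real n) * \<delta>) * h s"
      using AE_space
    proof eventually_elim
      fix s assume gs: "norm (g s) \<le> h s" and s: "s \<in> space L"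
      have nn: "0 \<le> C / (sqrt (real n) * \<delta>) * h s" using C \<delta> h_nonneg by simp
      show "norm (kern t g s - Q n (kern t g s)) \<le> A * (indicator {t - \<delta>..t} s * h s) + C / (sqrt (real n) * \<delta>) * h s"
      proof (cases "s \<le> t")
        case False
        then show ?thesis using nn A h_nonneg[of s] by (simp add: kern_def Qn.zero)
      next
        case True
        then have k: "kern t g s = G (t - s) (g s)" using s by (simp add: kern_def)
        have ts: "0 \<le> t - s" "t - s \<le> T" using True s t by auto
        show ?thesis
        proof (cases "t - \<delta> \<le> s")
          case True
          have "norm (kern t g s - Q n (kern t g s)) \<le> norm (kern t g s) + C * norm (kern t g s)"
            using norm_triangle_ineq4[of "kern t g s" "Q n (kern t g s)"] Q_bound[OF n(2), of "kern t g s"] by linarith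
          also have "\<dots> = (1 + C) * norm (kern t g s)" by (simp add: distrib_right)
          also have "\<dots> \<le> (1 + C) * (K * h s)"
            unfolding k using C order_trans[OF G_bound[OF ts] mult_left_mono[OF gs K]] by (intro mult_left_mono) auto
          finally show ?thesis using True \<open>s \<le> t\<close> nn by (simp add: A_def mult.assoc)
        next
          case False
          then have d: "\<delta> < t - s" by simp
          have "(t - s) * norm (kern t g s - Q n (kern t g s)) \<le> C / sqrt (real n) * norm (g s)"
            unfolding k by (rule smoothing[OF n(2) ts])
          then have "\<delta> * norm (kern t g s - Q n (kern t g s)) \<le> C / sqrt (real n) * h s"
            using d gs C mult_right_mono[of \<delta> "t - s" "norm (kern t g s - Q n (kern t g s))"]
              mult_left_mono[OF gs, of "C / sqrt (real n)"] by simp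
          then have "norm (kern t g s - Q n (kern t g s)) \<le> C / sqrt (real n) * h s / \<delta>"
            unfolding pos_le_divide_eq[OF \<delta>(1)] by (simp only: mult.commute[of _ \<delta>])
          also have "\<dots> = C / (sqrt (real n) * \<delta>) * h s" by simp
          finally show ?thesis using A h_nonneg[of s] by (simp add: add_increasing)
        qed
      qed
    qed
    have "norm (V t g - Q n (V t g)) \<le> (LINT s|L. A * (indicator {t - \<delta>..t} s * h s) + C / (sqrt (real n) * \<delta>) * h s)"
      by (rule strong_bochner_integral_norm_le_integral[OF L_complete hb _ ae])
         (intro Bochner_Integration.integrable_add integrable_mult_right integrable_indicator_h h_integrable)
    also have "\<dots> = A * (LINT s|L. indicator {t - \<delta>..t} s * h s) + C / (sqrt (real n) * \<delta>) * J"
      using integrable_indicator_h h_integrable by (simp add: J_def)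
    also have "A * (LINT s|L. indicator {t - \<delta>..t} s * h s) \<le> A * (\<epsilon> / (2 * (A + 1)))"
      using A by (intro mult_left_mono \<delta>) auto
    also have "\<dots> \<le> \<epsilon> / 2" using A assms by (simp add: field_simps)
    finally have "norm (V t g - Q n (V t g)) \<le> \<epsilon> / 2 + C / (sqrt (real n) * \<delta>) * J" by simp
    moreover have "C / (sqrt (real n) * \<delta>) * J = (C / \<delta>) * J * (1 / sqrt (real n))" by simp
    ultimately show "norm (V t g - Q n (V t g)) \<le> \<epsilon>" using n(1) by linarith
  qed
qed

text \<open>Strong continuity and the common bound K make (r, k) -> G r k jointly continuous. On
  [0, T] times the compact closure of the image of the unit ball under Q n it is then uniformly
  continuous, so r -> G r (Q n) is continuous in operator norm.\<close>

lemma G_Q_uniformly_continuous: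
  assumes n: "1 \<le> n" and "0 < \<epsilon>"
  obtains d where "0 < d" "\<And>r r' z. r \<in> {0..T} \<Longrightarrow> r' \<in> {0..T} \<Longrightarrow> \<bar>r - r'\<bar> \<le> d \<Longrightarrow>
    norm (G r (Q n z) - G r' (Q n z)) \<le> \<epsilon> * norm z"
proof -
  interpret Qn: bounded_linear "Q n" by (rule Q_linear[OF n])
  define X where "X = closure (Q n ` cball 0 1)"
  have X: "compact X" using Q_compact[OF n] unfolding X_def compact_operator_def by auto
  have "continuous_on ({0..T} \<times> X) (\<lambda>(r, k). G r k)"
    unfolding continuous_on_def
  proof
    fix p assume p: "p \<in> {0..T} \<times> X"
    obtain r k where p': "p = (r, k)" "r \<in> {0..T}" using p by auto
    show "((\<lambda>(r, k). G r k) \<longlongrightarrow> (case p of (r, k) \<Rightarrow> G r k)) (at p within {0..T} \<times> X)"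
    proof (rule LIM_zero_cancel, rule Lim_null_comparison)
      show "\<forall>\<^sub>F q in at p within {0..T} \<times> X. norm ((case q of (r, k) \<Rightarrow> G r k) - (case p of (r, k) \<Rightarrow> G r k))
          \<le> K * norm (snd q - k) + norm (G (fst q) k - G r k)"
        unfolding eventually_at_filter
      proof (intro always_eventually allI impI)
        fix q assume "q \<in> {0..T} \<times> X"
        then obtain r' k' where q: "q = (r', k')" "r' \<in> {0..T}" by auto
        interpret G': bounded_linear "G r'" using q by (intro G_linear) auto
        have "G r' k' - G r k = G r' (k' - k) + (G r' k - G r k)" by (simp add: G'.diff)
        also have "norm \<dots> \<le> norm (G r' (k' - k)) + norm (G r' k - G r k)" by (rule norm_triangle_ineq)
        also have "norm (G r' (k' - k)) \<le> K * norm (k' - k)" using q by (intro G_bound) auto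
        finally show "norm ((case q of (r, k) \<Rightarrow> G r k) - (case p of (r, k) \<Rightarrow> G r k))
          \<le> K * norm (snd q - k) + norm (G (fst q) k - G r k)" by (simp add: q p')
      qed
      have "continuous_on ({0..T} \<times> X) (\<lambda>q. K * norm (snd q - k) + norm (G (fst q) k - G r k))"
        by (intro continuous_intros continuous_on_compose2[OF G_continuous]) auto
      then have "((\<lambda>q. K * norm (snd q - k) + norm (G (fst q) k - G r k)) \<longlongrightarrow> K * norm (snd p - k) + norm (G (fst p) k - G r k)) (at p within {0..T} \<times> X)"
        using p unfolding continuous_on_def by blast
      then show "((\<lambda>q. K * norm (snd q - k) + norm (G (fst q) k - G r k)) \<longlongrightarrow> 0) (at p within {0..T} \<times> X)"
        by (simp add: p')
    qed
  qed
  then have "uniformly_continuous_on ({0..T} \<times> X) (\<lambda>(r, k). G r k)"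
    using X by (intro compact_uniformly_continuous compact_Times compact_Icc)
  then obtain d where d: "0 < d" "\<And>p q. p \<in> {0..T} \<times> X \<Longrightarrow> q \<in> {0..T} \<times> X \<Longrightarrow> dist q p < d \<Longrightarrow>
      dist (case q of (r, k) \<Rightarrow> G r k) (case p of (r, k) \<Rightarrow> G r k) < \<epsilon>"
    using \<open>0 < \<epsilon>\<close> unfolding uniformly_continuous_on_def by metis
  show ?thesis
  proof (rule that[of "d / 2"])
    show "0 < d / 2" using d by simp
    fix r r' z assume r: "r \<in> {0..T}" "r' \<in> {0..T}" "\<bar>r - r'\<bar> \<le> d / 2"
    interpret G1: bounded_linear "G r" using r by (intro G_linear) auto
    interpret G2: bounded_linear "G r'" using r by (intro G_linear) auto
    show "norm (G r (Q n z) - G r' (Q n z)) \<le> \<epsilon> * norm z"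
    proof (cases "z = 0")
      case False
      define y where "y = z /\<^sub>R norm z"
      have z: "z = norm z *\<^sub>R y" using False by (simp add: y_def)
      have "norm y \<le> 1" using False by (simp add: y_def)
      then have "Q n y \<in> Q n ` cball 0 1" by simp
      then have "Q n y \<in> X" unfolding X_def by (rule subsetD[OF closure_subset])
      moreover have "dist (r, Q n y) (r', Q n y) < d" using r d by (simp add: dist_Pair_Pair dist_real_def)
      ultimately have "norm (G r (Q n y) - G r' (Q n y)) < \<epsilon>"
        using d(2)[of "(r', Q n y)" "(r, Q n y)"] r by (simp add: dist_norm)
      moreover have "G r (Q n z) - G r' (Q n z) = norm z *\<^sub>R (G r (Q n y) - G r' (Q n y))"
      proof -
        have "Q n z = norm z *\<^sub>R Q n y" unfolding Qn.scaleR[symmetric] by (rule arg_cong[OF z])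
        then show ?thesis by (simp only: G1.scaleR G2.scaleR scaleR_diff_right)
      qed
      ultimately show ?thesis
        using mult_right_mono[of "norm (G r (Q n y) - G r' (Q n y))" \<epsilon> "norm z"] by (simp add: mult.commute)
    qed (simp add: Qn.zero G1.zero G2.zero)
  qed
qed

text \<open>V is replaced by Q n V at a cost of \<epsilon> / 4 at each end. Inside the integral Q n
  commutes with G, and the norm continuous family G r (Q n) is compared at t - s and t' - s; the
  extra piece [t, t'] is small by absolute continuity. Each of these two contributions is at most
  \<epsilon> / 4.\<close>

lemma V_equicontinuous:
  assumes "0 < \<epsilon>"
  obtains d where "0 < d" "\<And>g t t'. admissible g \<Longrightarrow> t \<in> {0..T} \<Longrightarrow> t' \<in> {0..T} \<Longrightarrow> \<bar>t - t'\<bar> \<le> d \<Longrightarrow>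
    norm (V t g - V t' g) \<le> \<epsilon>"
proof -
  obtain n where n: "1 \<le> n" "\<And>g t. admissible g \<Longrightarrow> 0 \<le> t \<Longrightarrow> t \<le> T \<Longrightarrow> norm (V t g - Q n (V t g)) \<le> \<epsilon> / 4"
    using V_approx[of "\<epsilon> / 4"] assms by auto
  interpret Qn: bounded_linear "Q n" by (rule Q_linear[OF n(1)])
  define J where "J = integral\<^sup>L L h"
  have J: "0 \<le> J" unfolding J_def by (rule Bochner_Integration.integral_nonneg) (rule h_nonneg)
  define \<eta> where "\<eta> = \<epsilon> / (4 * (J + 1))"
  have \<eta>: "0 < \<eta>" using assms J by (simp add: \<eta>_def)
  obtain d1 where d1: "0 < d1" "\<And>r r' z. r \<in> {0..T} \<Longrightarrow> r' \<in> {0..T} \<Longrightarrow> \<bar>r - r'\<bar> \<le> d1 \<Longrightarrow>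
    norm (G r (Q n z) - G r' (Q n z)) \<le> \<eta> * norm z"
    using G_Q_uniformly_continuous[OF n(1) \<eta>] by blast
  have CK: "0 \<le> C * K" using C K by simp
  obtain d2 where d2: "0 < d2" "\<And>a b. b - a \<le> d2 \<Longrightarrow> (LINT s|L. indicator {a..b} s * h s) \<le> \<epsilon> / (4 * (C * K + 1))"
    using h_small[of "\<epsilon> / (4 * (C * K + 1))"] assms CK by auto
  have main: "norm (V t' g - V t g) \<le> \<epsilon>"
    if g: "admissible g" and t: "0 \<le> t" "t \<le> t'" "t' \<le> T" "t' - t \<le> min d1 d2" for g t t'
  proof -
    have hb: "strong_has_bochner_integral L (\<lambda>s. Q n (kern t' g s) - Q n (kern t g s)) (Q n (V t' g) - Q n (V t g))"
    proof (rule strong_bochner_integral_diff[OF L_complete])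
      show "strong_has_bochner_integral L (\<lambda>s. Q n (kern t' g s)) (Q n (V t' g))"
        by (rule strong_bochner_integral_linear[OF L_complete has_integral_V[OF g t(3)] Qn.bounded_linear])
      have "t \<le> T" using t by simp
      show "strong_has_bochner_integral L (\<lambda>s. Q n (kern t g s)) (Q n (V t g))"
        by (rule strong_bochner_integral_linear[OF L_complete has_integral_V[OF g \<open>t \<le> T\<close>] Qn.bounded_linear])
    qed
    have "AE s in L. norm (g s) \<le> h s" using g by (simp add: admissible_def)
    then have ae: "AE s in L. norm (Q n (kern t' g s) - Q n (kern t g s)) \<le> \<eta> * h s + C * K * (indicator {t..t'} s * h s)"
      using AE_space
    proof eventually_elim
      fix s assume gs: "norm (g s) \<le> h s" and s: "s \<in> space L"
      consider "s \<le> t" | "t < s" "s \<le> t'" | "t' < s" by linarith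
      then show "norm (Q n (kern t' g s) - Q n (kern t g s)) \<le> \<eta> * h s + C * K * (indicator {t..t'} s * h s)"
      proof cases
        case 1
        have "norm (Q n (kern t' g s) - Q n (kern t g s)) = norm (G (t' - s) (Q n (g s)) - G (t - s) (Q n (g s)))"
          using 1 t s G_Q[OF n(1), of "t' - s" "g s"] G_Q[OF n(1), of "t - s" "g s"] by (simp add: kern_def)
        also have "\<dots> \<le> \<eta> * norm (g s)" using 1 t s by (intro d1) auto
        also have "\<dots> \<le> \<eta> * h s" using gs \<eta> by simp
        finally show ?thesis using CK h_nonneg[of s] by (simp add: add_increasing2)
      next
        case 2
        have "norm (Q n (kern t' g s) - Q n (kern t g s)) = norm (Q n (G (t' - s) (g s)))"
          using 2 t s by (simp add: kern_def Qn.zero)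
        also have "\<dots> \<le> C * norm (G (t' - s) (g s))" by (rule Q_bound[OF n(1)])
        also have "\<dots> \<le> C * (K * h s)"
          using 2 t s C order_trans[OF G_bound mult_left_mono[OF gs K], of "t' - s"] by (intro mult_left_mono) auto
        finally show ?thesis using 2 \<eta> h_nonneg[of s] by (simp add: add_increasing mult.assoc)
      next
        case 3
        then show ?thesis using t CK \<eta> h_nonneg[of s] by (simp add: kern_def Qn.zero)
      qed
    qed
    have "norm (Q n (V t' g) - Q n (V t g)) \<le> (LINT s|L. \<eta> * h s + C * K * (indicator {t..t'} s * h s))"
      by (rule strong_bochner_integral_norm_le_integral[OF L_complete hb _ ae])
         (intro Bochner_Integration.integrable_add integrable_mult_right integrable_indicator_h h_integrable)
    also have "\<dots> = \<eta> * J + C * K * (LINT s|L. indicator {t..t'} s * h s)"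
      using integrable_indicator_h h_integrable by (simp add: J_def)
    also have "C * K * (LINT s|L. indicator {t..t'} s * h s) \<le> C * K * (\<epsilon> / (4 * (C * K + 1)))"
      using CK t by (intro mult_left_mono d2) auto
    also have "\<dots> \<le> \<epsilon> / 4" using CK assms by (simp add: field_simps)
    also have "\<eta> * J \<le> \<epsilon> / 4" using J assms by (simp add: \<eta>_def field_simps)
    finally have "norm (Q n (V t' g) - Q n (V t g)) \<le> \<epsilon> / 2" by simp
    moreover have "norm (V t' g - Q n (V t' g)) \<le> \<epsilon> / 4" "norm (V t g - Q n (V t g)) \<le> \<epsilon> / 4"
      using n(2)[OF g] t by auto
    moreover have "norm (V t' g - V t g) \<le> norm (V t' g - Q n (V t' g)) + norm (Q n (V t' g) - Q n (V t g)) + norm (V t g - Q n (V t g))"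
      using norm_triangle_ineq[of "V t' g - Q n (V t' g)" "Q n (V t' g) - Q n (V t g)"]
        norm_triangle_ineq4[of "V t' g - Q n (V t' g) + (Q n (V t' g) - Q n (V t g))" "V t g - Q n (V t g)"]
      by simp
    ultimately show ?thesis by linarith
  qed
  show ?thesis
  proof (rule that[of "min d1 d2"])
    show "0 < min d1 d2" using d1 d2 by simp
    fix g t t' assume "admissible g" "t \<in> {0..T}" "t' \<in> {0..T}" "\<bar>t - t'\<bar> \<le> min d1 d2"
    then show "norm (V t g - V t' g) \<le> \<epsilon>"
      using main[of g t t'] main[of g t' t] by (cases "t \<le> t'") (auto simp: norm_minus_commute)
  qed
qed

text \<open>Total boundedness: up to e / 4 the set lies within the image of a bounded set under the
  compact operator Q n.\<close>

lemma V_compact: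
  assumes t: "t \<in> {0..T}"
  shows "compact (closure {V t g |g. admissible g})"
proof -
  let ?X = "{V t g |g. admissible g}"
  have "\<exists>F. finite F \<and> closure ?X \<subseteq> (\<Union>x\<in>F. ball x e)" if e: "0 < e" for e
  proof -
    obtain n where n: "1 \<le> n" "\<And>g t. admissible g \<Longrightarrow> 0 \<le> t \<Longrightarrow> t \<le> T \<Longrightarrow> norm (V t g - Q n (V t g)) \<le> e / 4"
      using V_approx[of "e / 4"] e by auto
    have "bounded ?X"
      unfolding bounded_iff
    proof (intro exI[of _ "LINT s|L. K * (indicator {0..t} s * h s)"] ballI)
      fix x assume "x \<in> ?X"
      then obtain g where g: "x = V t g" "admissible g" by auto
      show "norm x \<le> (LINT s|L. K * (indicator {0..t} s * h s))"
        unfolding g(1) using t g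
        by (intro strong_bochner_integral_norm_le_integral[OF L_complete has_integral_V _ kern_bound]
            integrable_mult_right integrable_indicator_h) auto
    qed
    then have "compact (closure (Q n ` ?X))" using Q_compact[OF n(1)] by (simp add: compact_operator_def)
    then obtain F where F: "finite F" "closure (Q n ` ?X) \<subseteq> (\<Union>x\<in>F. ball x (e / 4))"
      using e unfolding compact_eq_totally_bounded by (meson zero_less_divide_iff zero_less_numeral)
    have "closure ?X \<subseteq> (\<Union>x\<in>F. ball x e)"
    proof
      fix x assume "x \<in> closure ?X"
      then obtain g where g: "admissible g" "dist (V t g) x < e / 4"
        using e closure_approachable[of x ?X] by (auto dest: spec[of _ "e / 4"])
      have "Q n (V t g) \<in> closure (Q n ` ?X)" using g(1) by (intro subsetD[OF closure_subset]) auto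
      then obtain y where y: "y \<in> F" "dist y (Q n (V t g)) < e / 4" using F(2) by auto
      have "dist (V t g) (Q n (V t g)) \<le> e / 4" using n(2)[OF g(1)] t by (simp add: dist_norm)
      then have "dist y x < e"
        using g(2) y(2) dist_triangle[of y x "Q n (V t g)"] dist_triangle[of "Q n (V t g)" x "V t g"] e
        by (simp add: dist_commute)
      then show "x \<in> (\<Union>x\<in>F. ball x e)" using y by auto
    qed
    then show ?thesis using F(1) by blast
  qed
  then show ?thesis
    unfolding compact_eq_totally_bounded by (simp add: complete_eq_closed)
qed

text \<open>Serves to pass L1 limits of forcing terms through the convolution.\<close>

lemma V_linear_bound:
  assumes g: "admissible g" and g': "admissible g'" and t: "0 \<le> t" "t \<le> T"
  shows "norm (V t g - V t g') \<le> K * (LINT s|L. norm (g s - g' s))"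
proof -
  have sm: "strongly_measurable L (\<lambda>s. g s - g' s)"
    using g g' by (intro strongly_measurable_diff) (auto simp: admissible_def)
  have ae: "AE s in L. norm (g s - g' s) \<le> 2 * h s"
  proof -
    have "AE s in L. norm (g s) \<le> h s" "AE s in L. norm (g' s) \<le> h s" using g g' by (auto simp: admissible_def)
    then show ?thesis
    proof eventually_elim
      fix s assume "norm (g s) \<le> h s" "norm (g' s) \<le> h s"
      then show "norm (g s - g' s) \<le> 2 * h s" using norm_triangle_ineq4[of "g s" "g' s"] by simp
    qed
  qed
  have int: "integrable L (\<lambda>s. norm (g s - g' s))"
    by (rule Bochner_Integration.integrable_bound[OF integrable_mult_right[OF h_integrable, of 2]])
       (use ae h_nonneg strongly_measurable_norm[OF L_complete sm] in \<open>auto elim: eventually_mono\<close>)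
  have "norm (V t g - V t g') \<le> (LINT s|L. K * norm (g s - g' s))"
  proof (rule strong_bochner_integral_norm_le_integral[OF L_complete
        strong_bochner_integral_diff[OF L_complete has_integral_V[OF g t(2)] has_integral_V[OF g' t(2)]]])
    show "integrable L (\<lambda>s. K * norm (g s - g' s))" using int by simp
    show "AE s in L. norm (kern t g s - kern t g' s) \<le> K * norm (g s - g' s)"
    proof (rule AE_I2)
      fix s assume s: "s \<in> space L"
      show "norm (kern t g s - kern t g' s) \<le> K * norm (g s - g' s)"
      proof (cases "s \<le> t")
        case True
        interpret Gs: bounded_linear "G (t - s)" using True by (intro G_linear) simp
        have "kern t g s - kern t g' s = G (t - s) (g s - g' s)"
          using True s by (simp add: kern_def Gs.diff)
        then show ?thesis using True s t by (simp add: G_bound)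
      qed (use K in \<open>simp add: kern_def\<close>)
    qed
  qed
  then show ?thesis by simp
qed

text \<open>With delay d the right-hand side up to time (j + 1) d involves w only up to j d. The
  iterates W j of \<Phi> thus become stationary on longer and longer intervals, and as soon as J d
  >= T the iterate W J solves the equation on [0, T].\<close>

lemma delayed_solution:
  fixes N :: "(real \<Rightarrow> 'w) \<Rightarrow> real \<Rightarrow> 'w" and \<zeta> :: 'w
  assumes N: "\<And>w. continuous_on UNIV w \<Longrightarrow> admissible (N w)"
    and N_cong: "\<And>w w' s. w s = w' s \<Longrightarrow> N w s = N w' s" and d: "0 < d"
  obtains w where "continuous_on UNIV w"
    "\<And>t. t \<in> {0..T} \<Longrightarrow> w t = G t \<zeta> + V t (N (\<lambda>s. w (max 0 (s - d))))"
proof -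
  \<comment> \<open>Freezing time outside [0, T] keeps the iterates continuous on the whole line, as
    the hypothesis on N demands.\<close>
  define clip where "clip t = max 0 (min T t)" for t
  have clip: "clip t \<in> {0..T}" for t using T by (auto simp: clip_def)
  have clip_c: "continuous_on UNIV clip" unfolding clip_def by (intro continuous_intros)
  define \<Phi> where "\<Phi> w t = G (clip t) \<zeta> + V (clip t) (N (\<lambda>s. w (max 0 (s - d))))" for w t
  have shift: "continuous_on UNIV (\<lambda>s. w (max 0 (s - d)))" if "continuous_on UNIV w" for w :: "real \<Rightarrow> 'w"
    by (rule continuous_on_compose2[OF that]) (auto intro!: continuous_intros)
  have \<Phi>_cont: "continuous_on UNIV (\<Phi> w)" if w: "continuous_on UNIV w" for w
  proof -
    let ?g = "N (\<lambda>s. w (max 0 (s - d)))"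
    have g: "admissible ?g" by (intro N shift w)
    have "continuous_on {0..T} (\<lambda>t. V t ?g)"
      unfolding continuous_on_iff
    proof (intro ballI allI impI)
      fix t e :: real assume "t \<in> {0..T}" "0 < e"
      obtain d' where "0 < d'" "\<And>g t t'. admissible g \<Longrightarrow> t \<in> {0..T} \<Longrightarrow> t' \<in> {0..T} \<Longrightarrow> \<bar>t - t'\<bar> \<le> d' \<Longrightarrow>
        norm (V t g - V t' g) \<le> e / 2"
        using V_equicontinuous[of "e / 2"] \<open>0 < e\<close> by auto
      then show "\<exists>d>0. \<forall>t'\<in>{0..T}. dist t' t < d \<longrightarrow> dist (V t' ?g) (V t ?g) < e"
        using g \<open>t \<in> {0..T}\<close> \<open>0 < e\<close>
        by (intro exI[of _ d']) (force simp: dist_norm dist_real_def intro: le_less_trans[of _ "e / 2"])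
    qed
    then have "continuous_on UNIV (\<lambda>t. V (clip t) ?g)"
      by (rule continuous_on_compose2[OF _ clip_c]) (use clip in auto)
    moreover have "continuous_on UNIV (\<lambda>t. G (clip t) \<zeta>)"
      by (rule continuous_on_compose2[OF G_continuous clip_c]) (use clip in auto)
    ultimately show ?thesis unfolding \<Phi>_def[abs_def] by (intro continuous_on_add)
  qed
  define W where "W j = (\<Phi> ^^ j) (\<lambda>_. \<zeta>)" for j
  have W_Suc: "W (Suc j) = \<Phi> (W j)" for j by (simp add: W_def)
  have W_cont: "continuous_on UNIV (W j)" for j
    by (induction j) (auto simp: W_Suc \<Phi>_cont, simp add: W_def)
  have W_0: "W j t = \<zeta>" if "t \<le> 0" for j t
  proof (cases j)
    case (Suc i)
    have "clip t = 0" using that T by (simp add: clip_def)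
    then show ?thesis
      unfolding Suc W_Suc \<Phi>_def using V_0[OF N[OF shift[OF W_cont[of i]]]] by (simp add: G_0)
  qed (simp add: W_def)
  \<comment> \<open>Each iteration gains one delay. The start j = 0 is \<open>W_0\<close>: for t <=
    0 every iterate equals \<zeta>, because V vanishes at time 0.\<close>
  have stable: "W (Suc j) t = W j t" if "t \<le> real j * d" for j t
    using that
  proof (induction j arbitrary: t)
    case 0
    then show ?case by (simp add: W_0)
  next
    case (Suc j)
    have "V (clip t) (N (\<lambda>s. W (Suc j) (max 0 (s - d)))) = V (clip t) (N (\<lambda>s. W j (max 0 (s - d))))"
    proof (rule V_cong, rule N_cong)
      fix s assume s: "s \<in> {0..clip t}"
      have "s - d \<le> real j * d"
      proof (cases "0 \<le> t")
        case True
        then have "s \<le> t" using s by (auto simp: clip_def)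
        then show ?thesis using Suc.prems by (simp add: algebra_simps)
      next
        case False
        then have "s \<le> 0" using s T by (auto simp: clip_def)
        then show ?thesis using d by (smt (verit) mult_nonneg_nonneg of_nat_0_le_iff)
      qed
      then have "max 0 (s - d) \<le> real j * d" using d by simp
      then show "W (Suc j) (max 0 (s - d)) = W j (max 0 (s - d))" by (rule Suc.IH)
    qed
    then show ?case unfolding W_Suc[of "Suc j"] by (subst W_Suc[of j]) (simp add: \<Phi>_def)
  qed
  obtain J :: nat where J: "T / d \<le> real J" using real_arch_simple by blast
  show ?thesis
  proof (rule that[OF W_cont[of J]])
    fix t assume t: "t \<in> {0..T}"
    have "T \<le> real J * d" using J d by (simp add: pos_divide_le_eq)
    then have "W J t = W (Suc J) t" using t by (intro stable[symmetric]) auto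
    also have "clip t = t" using t by (simp add: clip_def)
    then have "W (Suc J) t = G t \<zeta> + V t (N (\<lambda>s. W J (max 0 (s - d))))"
      unfolding W_Suc \<Phi>_def by simp
    finally show "W J t = G t \<zeta> + V t (N (\<lambda>s. W J (max 0 (s - d))))" .
  qed
qed

text \<open>The argument of Arzela and Ascoli: a diagonal sequence converges at the rational points
  of [0, T] by compactness, and equicontinuity carries the Cauchy property over to every t.\<close>

lemma V_convergent_subsequence:
  assumes g: "\<And>n. admissible (g n)"
  obtains r :: "nat \<Rightarrow> nat" where "strict_mono r" "\<And>t. t \<in> {0..T} \<Longrightarrow> convergent (\<lambda>k. V t (g (r k)))"
proof -
  let ?D = "{0..T} \<inter> \<rat>"
  define q where "q = from_nat_into ?D"
  have "0 \<in> ?D" using T by simp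
  then have qD: "q i \<in> ?D" for i unfolding q_def by (intro from_nat_into) auto
  have "countable ?D" by (simp add: countable_rat)
  interpret subseqs "\<lambda>i r. convergent (\<lambda>k. V (q i) (g (r k)))"
  proof
    fix i and s :: "nat \<Rightarrow> nat" assume "strict_mono s"
    have "q i \<in> {0..T}" using qD[of i] by simp
    from V_compact[OF this] have sc: "seq_compact (closure {V (q i) g |g. admissible g})"
      by (simp add: compact_eq_seq_compact_metric)
    have in_cl: "\<forall>k. V (q i) (g (s k)) \<in> closure {V (q i) g |g. admissible g}"
      using g by (intro allI subsetD[OF closure_subset]) auto
    obtain l r where "strict_mono r" "((\<lambda>k. V (q i) (g (s k))) \<circ> r) \<longlonglongrightarrow> l"
      by (rule seq_compactE[OF sc in_cl])
    then show "\<exists>r'. strict_mono r' \<and> convergent (\<lambda>k. V (q i) (g ((s \<circ> r') k)))"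
      by (intro exI[of _ r]) (auto simp: o_def convergent_def)
  qed
  have conv: "convergent (\<lambda>k. V (q i) (g (diagseq k)))" for i
  proof -
    \<comment> \<open>The diagonal sequence is a subsequence of the selection for q i only from
      index Suc i on; the initial segment is put back afterwards.\<close>
    have "convergent (\<lambda>k. V (q i) (g ((diagseq \<circ> ((+) (Suc i))) k)))"
    proof (rule diagseq_holds)
      fix r s :: "nat \<Rightarrow> nat" and n
      assume "strict_mono r" "convergent (\<lambda>k. V (q n) (g (s k)))"
      then show "convergent (\<lambda>k. V (q n) (g ((s \<circ> r) k)))"
        using convergent_subseq_convergent[of "\<lambda>k. V (q n) (g (s k))" r] by (simp add: o_def)
    qed
    then have "convergent (\<lambda>k. V (q i) (g (diagseq (k + Suc i))))" by (simp add: o_def add.commute)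
    then show ?thesis using convergent_ignore_initial_segment[of "\<lambda>k. V (q i) (g (diagseq k))" "Suc i"] by simp
  qed
  show ?thesis
  proof (rule that[OF subseq_diagseq])
    fix t assume t: "t \<in> {0..T}"
    have "Cauchy (\<lambda>k. V t (g (diagseq k)))"
    proof (rule CauchyI)
      fix e :: real assume e: "0 < e"
      obtain d where d: "0 < d" "\<And>g t t'. admissible g \<Longrightarrow> t \<in> {0..T} \<Longrightarrow> t' \<in> {0..T} \<Longrightarrow> \<bar>t - t'\<bar> \<le> d \<Longrightarrow>
        norm (V t g - V t' g) \<le> e / 4"
        using V_equicontinuous[of "e / 4"] e by auto
      \<comment> \<open>Rational points are sought to the left of t. At t = 0 there is no room on
        that side, but 0 is itself rational.\<close>
      have "\<exists>x\<in>?D. \<bar>t - x\<bar> \<le> d"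
      proof (cases "t = 0")
        case True
        then show ?thesis using \<open>0 \<in> ?D\<close> d by (intro bexI[of _ 0]) auto
      next
        case False
        then have "max 0 (t - d) < t" using t d by auto
        then obtain x where "x \<in> \<rat>" "max 0 (t - d) < x" "x < t" using Rats_dense_in_real by blast
        then show ?thesis using t by (intro bexI[of _ x]) auto
      qed
      then obtain i where i: "\<bar>t - q i\<bar> \<le> d"
        using from_nat_into_surj[OF \<open>countable ?D\<close>] unfolding q_def by metis
      have "Cauchy (\<lambda>k. V (q i) (g (diagseq k)))" using conv[of i] by (rule convergent_Cauchy)
      then obtain N where N: "\<And>m n. N \<le> m \<Longrightarrow> N \<le> n \<Longrightarrow> norm (V (q i) (g (diagseq m)) - V (q i) (g (diagseq n))) < e / 4"
        using CauchyD[of _ "e / 4"] e by (metis zero_less_divide_iff zero_less_numeral)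
      have "norm (V t (g (diagseq m)) - V t (g (diagseq n))) < e" if "N \<le> m" "N \<le> n" for m n
      proof -
        have qT: "q i \<in> {0..T}" using qD[of i] by simp
        from d(2)[OF g[of "diagseq m"] t qT i] d(2)[OF g[of "diagseq n"] t qT i]
        show ?thesis
          using N[OF that] e norm_triangle_ineq[of "V t (g (diagseq m)) - V (q i) (g (diagseq m))" "V (q i) (g (diagseq m)) - V (q i) (g (diagseq n))"]
            norm_triangle_ineq4[of "V t (g (diagseq m)) - V (q i) (g (diagseq n))" "V t (g (diagseq n)) - V (q i) (g (diagseq n))"]
          by simp
      qed
      then show "\<exists>N. \<forall>m\<ge>N. \<forall>n\<ge>N. norm (V t (g (diagseq m)) - V t (g (diagseq n))) < e" by blast
    qed
    then show "convergent (\<lambda>k. V t (g (diagseq k)))" by (rule Cauchy_convergent)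
  qed
qed

text \<open>Tonelli's method: solutions of the delayed equations, whose existence is immediate, converge
  along a subsequence to a solution; no fixed point theorem is needed.\<close>

theorem fixed_point:
  fixes F :: "real \<Rightarrow> 'w \<Rightarrow> 'w" and p :: "real \<Rightarrow> 'w" and \<zeta> :: 'w
  assumes F_cont: "AE s in L. continuous_on UNIV (F s)"
    and F_meas: "\<And>x. strongly_measurable L (\<lambda>s. F s x)"
    and bound: "AE s in L. \<forall>x. norm (p s + F s x) \<le> h s"
    and p: "strongly_measurable L p"
  obtains w where "continuous_on {0..T} w"
    "\<And>t. t \<in> {0..T} \<Longrightarrow> strong_has_bochner_integral (lebesgue_on {0..t}) (\<lambda>s. G (t - s) (p s + F s (w s))) (w t - G t \<zeta>)"
proof -
  define N where "N w s = p s + F s (w s)" for w s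
  have N: "admissible (N w)" if w: "continuous_on UNIV w" for w
    unfolding admissible_def
  proof
    show "strongly_measurable L (N w)"
      unfolding N_def[abs_def]
      by (intro strongly_measurable_add p strongly_measurable_caratheodory[OF L_complete F_meas F_cont]
          strongly_measurable_continuous w) simp
    show "AE s in L. norm (N w s) \<le> h s" using bound by (rule eventually_mono) (simp add: N_def)
  qed
  have "\<exists>w. continuous_on UNIV w \<and> (\<forall>t\<in>{0..T}. w t = G t \<zeta> + V t (N (\<lambda>s. w (max 0 (s - 1 / real (Suc n))))))" for n
  proof -
    obtain w where "continuous_on UNIV w" "\<And>t. t \<in> {0..T} \<Longrightarrow> w t = G t \<zeta> + V t (N (\<lambda>s. w (max 0 (s - 1 / real (Suc n)))))"
      by (rule delayed_solution[of N "1 / real (Suc n)" \<zeta>]) (use N in \<open>auto simp: N_def\<close>)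
    then show ?thesis by blast
  qed
  then obtain w where w_cont: "\<And>n. continuous_on UNIV (w n)"
    and w: "\<And>n t. t \<in> {0..T} \<Longrightarrow> w n t = G t \<zeta> + V t (N (\<lambda>s. w n (max 0 (s - 1 / real (Suc n)))))" by metis
  define g where "g n = N (\<lambda>s. w n (max 0 (s - 1 / real (Suc n))))" for n
  have g: "admissible (g n)" for n
    unfolding g_def by (intro N continuous_on_compose2[OF w_cont]) (auto intro!: continuous_intros)
  have wg: "w n t = G t \<zeta> + V t (g n)" if "t \<in> {0..T}" for n t
    unfolding g_def by (rule w[OF that])
  obtain r where r: "strict_mono r" "\<And>t. t \<in> {0..T} \<Longrightarrow> convergent (\<lambda>k. V t (g (r k)))"
    by (rule V_convergent_subsequence[of g]) (use g in auto)
  define v where "v t = lim (\<lambda>k. V t (g (r k)))" for t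
  have v: "(\<lambda>k. V t (g (r k))) \<longlonglongrightarrow> v t" if "t \<in> {0..T}" for t
    unfolding v_def using r(2)[OF that] by (simp add: convergent_LIMSEQ_iff)
  \<comment> \<open>The modulus of continuity is common to all V t (g n), so the pointwise limit
    inherits it.\<close>
  have v_equi: "\<exists>d>0. (\<forall>t\<in>{0..T}. \<forall>t'\<in>{0..T}. \<bar>t - t'\<bar> \<le> d \<longrightarrow> (\<forall>n. norm (V t (g n) - V t' (g n)) \<le> e) \<and> norm (v t - v t') \<le> e)"
    if e: "0 < e" for e
  proof -
    obtain d where d: "0 < d" "\<And>g t t'. admissible g \<Longrightarrow> t \<in> {0..T} \<Longrightarrow> t' \<in> {0..T} \<Longrightarrow> \<bar>t - t'\<bar> \<le> d \<Longrightarrow>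
        norm (V t g - V t' g) \<le> e"
      using V_equicontinuous[of e] e by auto
    have "norm (v t - v t') \<le> e" if "t \<in> {0..T}" "t' \<in> {0..T}" "\<bar>t - t'\<bar> \<le> d" for t t'
      by (rule LIMSEQ_le_const2[OF tendsto_norm[OF tendsto_diff[OF v[OF that(1)] v[OF that(2)]]]])
         (use d(2)[OF g that] in auto)
    with d(1) d(2)[OF g] show ?thesis by (intro exI[of _ d]) simp
  qed
  define u where "u t = G t \<zeta> + v t" for t
  have G\<zeta>: "continuous_on {0..T} (\<lambda>t. G t \<zeta>)"
    by (rule continuous_on_subset[OF G_continuous]) auto
  have "continuous_on {0..T} v"
    unfolding continuous_on_iff
  proof (intro ballI allI impI)
    fix t e :: real assume t: "t \<in> {0..T}" and e: "0 < e"
    obtain d where d: "d > 0" "\<forall>t\<in>{0..T}. \<forall>t'\<in>{0..T}. \<bar>t - t'\<bar> \<le> d \<longrightarrow> (\<forall>n. norm (V t (g n) - V t' (g n)) \<le> e / 2) \<and> norm (v t - v t') \<le> e / 2"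
      using v_equi[of "e / 2"] e by auto
    have "dist (v t') (v t) < e" if "t' \<in> {0..T}" "dist t' t < d" for t'
      using d(2)[rule_format, OF that(1) t] that e by (auto simp: dist_norm dist_real_def)
    then show "\<exists>d>0. \<forall>t'\<in>{0..T}. dist t' t < d \<longrightarrow> dist (v t') (v t) < e" using d(1) by blast
  qed
  then have u_cont: "continuous_on {0..T} u" unfolding u_def[abs_def] by (intro continuous_on_add G\<zeta>)
  define clip where "clip t = max 0 (min T t)" for t
  have clip: "clip t \<in> {0..T}" for t using T by (auto simp: clip_def)
  have clip_id: "clip t = t" if "t \<in> {0..T}" for t using that by (simp add: clip_def)
  have uc: "continuous_on UNIV (\<lambda>t. u (clip t))"
    by (rule continuous_on_compose2[OF u_cont]) (use clip in \<open>auto simp: clip_def intro!: continuous_intros\<close>)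
  define gu where "gu = N (\<lambda>s. u (clip s))"
  have gu: "admissible gu" unfolding gu_def by (rule N[OF uc])
  \<comment> \<open>Both the function and its delayed argument move with k. Equicontinuity replaces
    V at s' k by V at s up to a null sequence.\<close>
  have shifted: "(\<lambda>k. w (r k) (max 0 (s - 1 / real (Suc (r k))))) \<longlonglongrightarrow> u s" if s: "s \<in> {0..T}" for s
  proof -
    define s' where "s' k = max 0 (s - 1 / real (Suc (r k)))" for k
    have s'T: "s' k \<in> {0..T}" for k
    proof -
      have "0 \<le> 1 / real (Suc (r k))" by simp
      then have "s - 1 / real (Suc (r k)) \<le> T" using s unfolding atLeastAtMost_iff by linarith
      then show ?thesis using T by (simp add: s'_def)
    qed
    have "(\<lambda>n. 1 / real (Suc n)) \<longlonglongrightarrow> 0" by real_asymp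
    from LIMSEQ_subseq_LIMSEQ[OF this r(1)] have "(\<lambda>k. 1 / real (Suc (r k))) \<longlonglongrightarrow> 0" by (simp only: o_def)
    from tendsto_max[OF tendsto_const[of 0] tendsto_diff[OF tendsto_const[of s] this]]
    have s'_lim: "s' \<longlonglongrightarrow> s" unfolding s'_def using s by simp
    have "(\<lambda>k. V (s' k) (g (r k)) - V s (g (r k))) \<longlonglongrightarrow> 0"
    proof (rule LIMSEQ_I)
      fix e :: real assume e: "0 < e"
      obtain d where d: "d > 0" "\<forall>t\<in>{0..T}. \<forall>t'\<in>{0..T}. \<bar>t - t'\<bar> \<le> d \<longrightarrow> (\<forall>n. norm (V t (g n) - V t' (g n)) \<le> e / 2) \<and> norm (v t - v t') \<le> e / 2"
        using v_equi[of "e / 2"] e by auto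
      obtain k0 where k0: "\<And>k. k0 \<le> k \<Longrightarrow> norm (s' k - s) < d" using LIMSEQ_D[OF s'_lim d(1)] by blast
      have "norm (V (s' k) (g (r k)) - V s (g (r k)) - 0) < e" if "k0 \<le> k" for k
      proof -
        have "norm (V (s' k) (g (r k)) - V s (g (r k))) \<le> e / 2"
          using d(2)[rule_format, OF s'T[of k] s] k0[OF that] by auto
        then show ?thesis using e by simp
      qed
      then show "\<exists>k0. \<forall>k\<ge>k0. norm (V (s' k) (g (r k)) - V s (g (r k)) - 0) < e" by blast
    qed
    moreover have "(\<lambda>k. G (s' k) \<zeta>) \<longlonglongrightarrow> G s \<zeta>"
      by (rule continuous_on_tendsto_compose[OF G\<zeta> s'_lim s]) (use s'T in simp)
    ultimately have "(\<lambda>k. G (s' k) \<zeta> + ((V (s' k) (g (r k)) - V s (g (r k))) + V s (g (r k)))) \<longlonglongrightarrow> G s \<zeta> + (0 + v s)"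
      using v[OF s] by (intro tendsto_add)
    then show ?thesis using wg[OF s'T] by (simp add: u_def s'_def)
  qed
  \<comment> \<open>Continuity of F s turns the convergence of the delayed values into convergence
    of the forcing terms almost everywhere; twice the common bound h dominates the
    differences.\<close>
  have lim_g: "(\<lambda>k. LINT s|L. norm (g (r k) s - gu s)) \<longlonglongrightarrow> (LINT s|L. 0)"
  proof (rule integral_dominated_convergence[where w="\<lambda>s. 2 * h s"])
    show "(\<lambda>s. norm (g (r k) s - gu s)) \<in> borel_measurable L" for k
      using g gu by (intro strongly_measurable_norm[OF L_complete] strongly_measurable_diff) (auto simp: admissible_def)
    show "integrable L (\<lambda>s. 2 * h s)" using h_integrable by simp
    show "AE s in L. (\<lambda>k. norm (g (r k) s - gu s)) \<longlonglongrightarrow> 0"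
      using F_cont AE_space
    proof eventually_elim
      fix s assume F: "continuous_on UNIV (F s)" and s: "s \<in> space L"
      then have s: "s \<in> {0..T}" by simp
      have "(\<lambda>k. p s + F s (w (r k) (max 0 (s - 1 / real (Suc (r k)))))) \<longlonglongrightarrow> p s + F s (u s)"
        by (intro tendsto_add tendsto_const continuous_on_tendsto_compose[OF F shifted[OF s]]) auto
      then have "(\<lambda>k. g (r k) s) \<longlonglongrightarrow> gu s" by (simp add: g_def gu_def N_def clip_id[OF s])
      then show "(\<lambda>k. norm (g (r k) s - gu s)) \<longlonglongrightarrow> 0"
        by (intro tendsto_norm_zero LIM_zero)
    qed
    show "AE s in L. norm (norm (g (r k) s - gu s)) \<le> 2 * h s" for k
    proof -
      have "AE s in L. norm (g (r k) s) \<le> h s" "AE s in L. norm (gu s) \<le> h s"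
        using g gu by (auto simp: admissible_def)
      then show ?thesis
      proof eventually_elim
        fix s assume "norm (g (r k) s) \<le> h s" "norm (gu s) \<le> h s"
        then show "norm (norm (g (r k) s - gu s)) \<le> 2 * h s"
          using norm_triangle_ineq4[of "g (r k) s" "gu s"] by simp
      qed
    qed
  qed simp
  \<comment> \<open>The convolutions of the forcing terms converge both to v t and to the
    convolution of the limit forcing term, which closes the equation for u.\<close>
  have V_gu: "V t gu = v t" if t: "t \<in> {0..T}" for t
  proof (rule LIMSEQ_unique[OF _ v[OF t]])
    show "(\<lambda>k. V t (g (r k))) \<longlonglongrightarrow> V t gu"
    proof (rule LIM_zero_cancel, rule Lim_null_comparison)
      show "\<forall>\<^sub>F k in sequentially. norm (V t (g (r k)) - V t gu) \<le> K * (LINT s|L. norm (g (r k) s - gu s))"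
        using t by (intro always_eventually allI V_linear_bound g gu) auto
      show "(\<lambda>k. K * (LINT s|L. norm (g (r k) s - gu s))) \<longlonglongrightarrow> 0"
        using tendsto_mult_right_zero[of "\<lambda>k. LINT s|L. norm (g (r k) s - gu s)" sequentially K] lim_g by simp
    qed
  qed
  show ?thesis
  proof (rule that[OF u_cont])
    fix t assume t: "t \<in> {0..T}"
    have "strong_has_bochner_integral (lebesgue_on {0..t}) (\<lambda>s. G (t - s) (gu s)) (V t gu)"
      using t by (intro has_integral_V_restrict gu) auto
    then have "strong_has_bochner_integral (lebesgue_on {0..t}) (\<lambda>s. G (t - s) (p s + F s (u s))) (V t gu)"
      by (rule strong_has_bochner_integral_cong[rotated])
         (use t in \<open>auto simp: gu_def N_def clip_id\<close>)
    then show "strong_has_bochner_integral (lebesgue_on {0..t}) (\<lambda>s. G (t - s) (p s + F s (u s))) (u t - G t \<zeta>)"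
      by (simp add: V_gu[OF t] u_def)
  qed
qed

end

section \<open>Resolvent families of sectorial operators\<close>

text \<open>Bundled so that the estimate can be proved in the complexification and handed back to
  the real space; one C bounds the Q n and gives the rate.\<close>

definition compact_smoothing ::
    "(real \<Rightarrow> 'a \<Rightarrow> 'a::real_normed_vector) \<Rightarrow> real \<Rightarrow> real \<Rightarrow> (nat \<Rightarrow> 'a \<Rightarrow> 'a) \<Rightarrow> bool" where
  "compact_smoothing G T C Q \<longleftrightarrow> 0 \<le> C \<and>
    (\<forall>n\<ge>1. bounded_linear (Q n) \<and> compact_operator (Q n) \<and> (\<forall>z. norm (Q n z) \<le> C * norm z) \<and>
      (\<forall>t\<ge>0. \<forall>z. G t (Q n z) = Q n (G t z)) \<and>
      (\<forall>t z. 0 \<le> t \<longrightarrow> t \<le> T \<longrightarrow> t * norm (G t z - Q n (G t z)) \<le> C / sqrt (real n) * norm z))"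

text \<open>By continuity of the argument at 1, the number 1 / (1 + w) has argument below \<delta>.
  As |arg z| < \<pi> / 2 and \<delta> <= \<pi> / 2, the sum stays in (-\<pi>, \<pi>), where
  arguments add.\<close>

lemma Arg_perturb:
  assumes "0 < \<delta>" "\<delta> \<le> pi / 2"
  obtains \<eta> where "0 < \<eta>" "\<eta> \<le> 1 / 2"
    "\<And>z w. 0 < Re z \<Longrightarrow> cmod w \<le> \<eta> \<Longrightarrow> z * inverse (1 + w) \<in> sector \<delta>"
proof -
  have "isCont (\<lambda>w. Arg (inverse (1 + w))) 0"
  proof -
    have c: "isCont (\<lambda>w :: complex. inverse (1 + w)) 0" by (intro continuous_intros) auto
    have "isCont Arg (inverse (1 + 0))" by (rule continuous_at_Arg) simp
    from isCont_o2[OF c this] show ?thesis .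
  qed
  then have "\<exists>d>0. \<forall>w. dist w 0 < d \<longrightarrow> dist (Arg (inverse (1 + w))) (Arg (inverse (1 + 0))) < \<delta>"
    using assms(1) unfolding continuous_at_eps_delta by (simp add: dist_norm)
  then obtain d where d: "0 < d" "\<And>w. cmod w < d \<Longrightarrow> \<bar>Arg (inverse (1 + w))\<bar> < \<delta>"
    by (auto simp: dist_norm)
  show ?thesis
  proof (rule that[of "min (d / 2) (1 / 2)"])
    fix z w :: complex assume z: "0 < Re z" and w: "cmod w \<le> min (d / 2) (1 / 2)"
    have "1 + w \<noteq> 0" using w norm_diff_ineq[of 1 w] by auto
    then have nz: "z \<noteq> 0" "inverse (1 + w) \<noteq> 0" using z by auto
    have a: "\<bar>Arg z\<bar> < pi / 2" using z by (intro Arg_Re_pos[THEN iffD2] disjI1)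
    have b: "\<bar>Arg (inverse (1 + w))\<bar> < \<delta>" using w d by (intro d(2)) auto
    have "Arg (z * inverse (1 + w)) = Arg z + Arg (inverse (1 + w))"
      using nz a b assms by (subst Arg_times) auto
    then show "z * inverse (1 + w) \<in> sector \<delta>"
      using a b nz by (auto simp: sector_def)
  qed (use d in auto)
qed

context complex_action
begin

lemma sectorial_compact_smoothing:
  assumes A: "linear_operator UNIV sc D A" and dense: "closure D = UNIV"
    and sect: "sectorial_complex sc N D A \<theta>" and N: "\<And>x. norm x \<le> 2 * N x" "\<And>x. N x \<le> 2 * norm x"
    and l: "l \<in> resolvent_set sc D A" and cres: "compact_operator (resolvent sc D A l)"
    and par: "0 < \<alpha>" "0 \<le> \<beta>" "0 < \<nu>" "\<nu> < 1" and T: "0 < T"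
    and G: "\<And>t. 0 \<le> t \<Longrightarrow> bounded_linear (G t)" "\<And>z. continuous_on {0..} (\<lambda>t. G t z)"
    and comm: "\<And>z t. z \<in> D \<Longrightarrow> 0 \<le> t \<Longrightarrow> G t z \<in> D \<and> G t (A z) = A (G t z)"
    and eq: "\<And>z t. z \<in> D \<Longrightarrow> 0 \<le> t \<Longrightarrow>
      G t z = z + integral {0..t} (\<lambda>s. (1 + one_conv_kappa \<alpha> \<beta> \<nu> (t - s)) *\<^sub>R A (G s z))"
  obtains C Q where "compact_smoothing G T C Q"
proof -
  have \<theta>: "0 < \<theta>" "\<theta> \<le> pi / 2" and sub: "sector \<theta> \<subseteq> resolvent_set sc D A"
    and bd: "\<And>\<omega>. 0 < \<omega> \<Longrightarrow> \<omega> < \<theta> \<Longrightarrow> \<exists>C\<ge>1. \<forall>l \<in> closure (sector (\<theta> - \<omega>)) - {0}.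
           \<forall>x. N (resolvent sc D A l x) \<le> C / cmod l * N x"
    using sect by (auto simp: sectorial_complex_def)
  obtain C0 where C0: "1 \<le> C0" "\<And>l x. l \<in> closure (sector (\<theta> / 2)) - {0} \<Longrightarrow> N (resolvent sc D A l x) \<le> C0 / cmod l * N x"
    using bd[of "\<theta> / 2"] \<theta> by auto
  \<comment> \<open>\<theta> / 2 plays two roles: it is the \<omega> for which the resolvent bound
    is taken, on the sector of angle \<theta> - \<theta> / 2, and it is the rotation allowed in z ->
    z / (1 + khat z).\<close>
  define S where "S = sector (\<theta> / 2)"
  define R where "R = resolvent sc D A"
  \<comment> \<open>N and the norm of the type differ by a factor 2 in either direction, hence
    4.\<close>
  define C\<^sub>R where "C\<^sub>R = 4 * C0"
  have S: "bij_betw (\<lambda>x. sc m x - A x) D UNIV" if "m \<in> S" for m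
    using that sub \<theta> by (auto simp: S_def sector_def resolvent_set_def)
  interpret sc_resolvent sc D A R S C\<^sub>R
  proof
    fix m x assume m: "m \<in> S"
    have x: "x \<in> (\<lambda>x. sc m x - A x) ` D" using S[OF m] by (simp add: bij_betw_def)
    show "R m x \<in> D" unfolding R_def resolvent_def by (rule inv_into_into[OF x])
    show "sc m (R m x) - A (R m x) = x" unfolding R_def resolvent_def by (rule f_inv_into_f[OF x])
    show "R m (sc m x - A x) = x" if "x \<in> D"
      unfolding R_def resolvent_def using S[OF m] that by (intro inv_into_f_f) (auto simp: bij_betw_def)
    have "m \<in> closure (sector (\<theta> / 2))" using m unfolding S_def by (rule subsetD[OF closure_subset])
    then have mS: "m \<in> closure (sector (\<theta> / 2)) - {0}" using m by (simp add: S_def sector_def)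
    have "norm (R m x) \<le> 2 * N (R m x)" by (rule N)
    also have "\<dots> \<le> 2 * (C0 / cmod m * N x)" unfolding R_def by (intro mult_left_mono C0 mS) auto
    also have "\<dots> \<le> 2 * (C0 / cmod m * (2 * norm x))" using C0 by (intro mult_left_mono N) auto
    finally show "norm (R m x) \<le> C\<^sub>R / cmod m * norm x" by (simp add: C\<^sub>R_def)
  qed (use A C0 in \<open>auto simp: linear_operator_def S_def sector_def C\<^sub>R_def\<close>)
  obtain \<eta> where \<eta>: "0 < \<eta>" "\<eta> \<le> 1 / 2" "\<And>z w. 0 < Re z \<Longrightarrow> cmod w \<le> \<eta> \<Longrightarrow> z * inverse (1 + w) \<in> sector (\<theta> / 2)"
    using Arg_perturb[of "\<theta> / 2"] \<theta> by auto
  \<comment> \<open>The margin of 1 over T is the one required by t <= \<tau> - 1 in the smoothing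
    estimate.\<close>
  interpret weak_kernel \<alpha> \<beta> \<nu> "T + 1" using par T by unfold_locales auto
  obtain \<sigma> where \<sigma>: "1 \<le> \<sigma>" "\<And>z. \<sigma> \<le> Re z \<Longrightarrow> cmod (khat z) \<le> \<eta>"
    by (rule khat_small[OF \<eta>(1)]) blast
  interpret volterra_resolvent sc D A R S C\<^sub>R \<alpha> \<beta> \<nu> "T + 1" \<sigma>
  proof
    show "1 \<le> \<sigma>" by (rule \<sigma>)
    fix z assume z: "\<sigma> < Re z"
    have k: "cmod (khat z) \<le> \<eta>" using z by (intro \<sigma>) simp
    then show "cmod (khat z) \<le> 1 / 2" using \<eta>(2) by simp
    show "z * inverse (1 + khat z) \<in> S" unfolding S_def using z \<sigma>(1) k by (intro \<eta>(3)) auto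
  qed
  have nS: "of_nat n \<in> S" if "1 \<le> n" for n
    using that \<theta> Arg_of_real[of "real n"] by (simp add: S_def sector_def)
  obtain C where C: "0 \<le> C" "\<And>n t x. 1 \<le> n \<Longrightarrow> 0 \<le> t \<Longrightarrow> t \<le> (T + 1) - 1 \<Longrightarrow>
    t * norm (G t x - Q n (G t x)) \<le> C / sqrt (real n) * norm x"
    by (rule smoothing_Q[of G, OF nS dense G(1) G(2) comm eq]) auto
  have cQ: "compact_operator (Q n)" if n: "1 \<le> n" for n
    unfolding compact_operator_def
  proof (intro allI impI)
    fix X :: "'v set" assume X: "bounded X"
    let ?F = "resolvent sc D A l"
    \<comment> \<open>The point l of the compact resolvent may lie outside the sector. Rewriting the
      equation for R n x at l shows that R n is the compact resolvent after the bounded operator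
      k.\<close>
    define k where "k x = x + sc (l - of_nat n) (R (of_nat n) x)" for x
    have bij: "bij_betw (\<lambda>x. sc l x - A x) D UNIV" using l by (simp add: resolvent_set_def)
    have Rk: "R (of_nat n) x = ?F (k x)" for x
    proof -
      have "k x = sc l (R (of_nat n) x) - A (R (of_nat n) x)"
        using R_right[OF nS[OF n], of x] by (simp add: k_def diff_left algebra_simps)
      then show ?thesis
        using bij R_D[OF nS[OF n], of x] inv_into_f_f[of "\<lambda>x. sc l x - A x" D "R (of_nat n) x"]
        by (simp add: resolvent_def bij_betw_def)
    qed
    have "bounded_linear k"
      unfolding k_def
      using bounded_linear_add[OF bounded_linear_ident bounded_linear_compose[OF bounded_linear_right bounded_linear_R[OF nS[OF n]]]]
      by simp
    then have "bounded (k ` X)" by (rule bounded_linear_image[OF X])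
    then have c: "compact (closure (?F ` k ` X))" using cres by (simp add: compact_operator_def)
    have "compact ((\<lambda>y. real n *\<^sub>R y) ` closure (?F ` k ` X))"
      by (rule compact_scaling[OF c])
    moreover have "closure (Q n ` X) \<subseteq> (\<lambda>y. real n *\<^sub>R y) ` closure (?F ` k ` X)"
    proof (rule closure_minimal)
      show "Q n ` X \<subseteq> (\<lambda>y. real n *\<^sub>R y) ` closure (?F ` k ` X)"
        unfolding Q_def Rk by (rule image_subsetI) (intro imageI subsetD[OF closure_subset])
      show "closed ((\<lambda>y. real n *\<^sub>R y) ` closure (?F ` k ` X))"
        by (rule compact_imp_closed[OF compact_scaling[OF c]])
    qed
    ultimately show "compact (closure (Q n ` X))"
      by (metis closed_closure compact_Int_closed inf.absorb_iff2)
  qed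
  have "compact_smoothing G T (max C C\<^sub>R) Q"
    unfolding compact_smoothing_def
  proof (intro conjI allI impI)
    show "0 \<le> max C C\<^sub>R" using C by simp
    fix n :: nat assume n: "1 \<le> n"
    show "bounded_linear (Q n)" by (rule bounded_linear_Q[OF nS[OF n]])
    show "compact_operator (Q n)" by (rule cQ[OF n])
    show "norm (Q n z) \<le> max C C\<^sub>R * norm z" for z
      by (rule order_trans[OF Q_bound[OF nS[OF n]]]) (simp add: mult_right_mono)
    show "G t (Q n z) = Q n (G t z)" if "0 \<le> t" for t z
      using Q_commute[OF nS[OF n] G(1)[OF that]] comm that by blast
    show "t * norm (G t z - Q n (G t z)) \<le> max C C\<^sub>R / sqrt (real n) * norm z" if "0 \<le> t" "t \<le> T" for t z
    proof -
      have "t * norm (G t z - Q n (G t z)) \<le> C / sqrt (real n) * norm z" using that by (intro C n) auto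
      also have "\<dots> \<le> max C C\<^sub>R / sqrt (real n) * norm z"
        by (intro mult_right_mono divide_right_mono) auto
      finally show ?thesis .
    qed
  qed
  then show ?thesis by (rule that)
qed

end

section \<open>Complexification of a real space\<close>

lemma cplx_norm_bounds:
  fixes p :: "'a::real_normed_vector \<times> 'a"
  shows "norm p \<le> 2 * cplx_norm p" "cplx_norm p \<le> 2 * norm p"
proof -
  obtain x y where p: "p = (x, y)" by (cases p)
  let ?f = "\<lambda>t. norm (cos t *\<^sub>R x - sin t *\<^sub>R y)"
  have le: "?f t \<le> norm x + norm y" for t
  proof -
    have "?f t \<le> \<bar>cos t\<bar> * norm x + \<bar>sin t\<bar> * norm y"
      using norm_triangle_ineq4[of "cos t *\<^sub>R x" "sin t *\<^sub>R y"] by simp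
    also have "\<dots> \<le> 1 * norm x + 1 * norm y" by (intro add_mono mult_right_mono) auto
    finally show ?thesis by simp
  qed
  have bdd: "bdd_above (range ?f)" using le by (intro bdd_aboveI2)
  \<comment> \<open>The angles 0 and \<pi> / 2 recover the norms of the two components.\<close>
  have "?f 0 \<le> (SUP t. ?f t)" "?f (pi / 2) \<le> (SUP t. ?f t)" using bdd by (intro cSUP_upper; simp)+
  then have "norm x \<le> cplx_norm p" "norm y \<le> cplx_norm p" by (simp_all add: cplx_norm_def p)
  then show "norm p \<le> 2 * cplx_norm p" using norm_Pair_le[of x y] by (simp add: p)
  have "cplx_norm p \<le> norm x + norm y" unfolding cplx_norm_def p prod.case by (rule cSUP_least) (auto simp: le)
  also have "\<dots> \<le> 2 * norm p" using norm_fst_le[of x y] norm_snd_le[of y x] by (simp add: p)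
  finally show "cplx_norm p \<le> 2 * norm p" .
qed

text \<open>The Cauchy-Schwarz inequality bounds each component by |a| norm p; adding the two
  components costs the factor 2.\<close>

lemma norm_cplx_scale_le:
  fixes p :: "'a::real_normed_vector \<times> 'a"
  shows "norm (cplx_scale a p) \<le> 2 * cmod a * norm p"
proof -
  obtain x y where p: "p = (x, y)" by (cases p)
  have cs: "(c * norm x + d * norm y)\<^sup>2 \<le> (c\<^sup>2 + d\<^sup>2) * (norm p)\<^sup>2" for c d :: real
  proof -
    have "(c\<^sup>2 + d\<^sup>2) * ((norm x)\<^sup>2 + (norm y)\<^sup>2) - (c * norm x + d * norm y)\<^sup>2 = (c * norm y - d * norm x)\<^sup>2"
      by (simp add: power2_eq_square algebra_simps)
    then have "(c * norm x + d * norm y)\<^sup>2 \<le> (c\<^sup>2 + d\<^sup>2) * ((norm x)\<^sup>2 + (norm y)\<^sup>2)"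
      using zero_le_power2[of "c * norm y - d * norm x"] by linarith
    then show ?thesis by (simp add: p norm_Pair)
  qed
  have c: "(cmod a)\<^sup>2 = (Re a)\<^sup>2 + (Im a)\<^sup>2" by (rule cmod_power2)
  have 1: "norm (fst (cplx_scale a p)) \<le> cmod a * norm p"
  proof (rule power2_le_imp_le)
    have "norm (fst (cplx_scale a p)) \<le> \<bar>Re a\<bar> * norm x + \<bar>Im a\<bar> * norm y"
      using norm_triangle_ineq4[of "Re a *\<^sub>R x" "Im a *\<^sub>R y"] by (simp add: cplx_scale_def p)
    then have "(norm (fst (cplx_scale a p)))\<^sup>2 \<le> (\<bar>Re a\<bar> * norm x + \<bar>Im a\<bar> * norm y)\<^sup>2" by (rule power_mono) simp
    from order_trans[OF this cs] show "(norm (fst (cplx_scale a p)))\<^sup>2 \<le> (cmod a * norm p)\<^sup>2"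
      by (simp add: power_mult_distrib c)
  qed simp
  have 2: "norm (snd (cplx_scale a p)) \<le> cmod a * norm p"
  proof (rule power2_le_imp_le)
    have "norm (snd (cplx_scale a p)) \<le> \<bar>Im a\<bar> * norm x + \<bar>Re a\<bar> * norm y"
      using norm_triangle_ineq[of "Im a *\<^sub>R x" "Re a *\<^sub>R y"] by (simp add: cplx_scale_def p)
    then have "(norm (snd (cplx_scale a p)))\<^sup>2 \<le> (\<bar>Im a\<bar> * norm x + \<bar>Re a\<bar> * norm y)\<^sup>2" by (rule power_mono) simp
    from order_trans[OF this cs] show "(norm (snd (cplx_scale a p)))\<^sup>2 \<le> (cmod a * norm p)\<^sup>2"
      by (simp add: power_mult_distrib c add.commute)
  qed simp
  have "norm (cplx_scale a p) \<le> norm (fst (cplx_scale a p)) + norm (snd (cplx_scale a p))"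
    using norm_Pair_le[of "fst (cplx_scale a p)" "snd (cplx_scale a p)"] by simp
  with 1 2 show ?thesis by linarith
qed

lemma complex_action_cplx_scale: "complex_action (cplx_scale :: complex \<Rightarrow> 'a::banach \<times> 'a \<Rightarrow> 'a \<times> 'a)"
  by unfold_locales (rule norm_cplx_scale_le | simp add: cplx_scale_def split_beta algebra_simps scaleR_conv_of_real prod_eq_iff)+

lemma has_integral_Pair:
  fixes f :: "'n::euclidean_space \<Rightarrow> 'a::real_normed_vector" and g :: "'n \<Rightarrow> 'b::real_normed_vector"
  assumes "(f has_integral i) S" "(g has_integral j) S"
  shows "((\<lambda>x. (f x, g x)) has_integral (i, j)) S"
  using has_integral_add[OF
      has_integral_linear[OF assms(1) bounded_linear_Pair[OF bounded_linear_ident bounded_linear_zero]]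
      has_integral_linear[OF assms(2) bounded_linear_Pair[OF bounded_linear_zero bounded_linear_ident]]]
  by (simp add: o_def)

text \<open>A (G s z) = G s (A z) is continuous in s, hence so is the integrand; its gauge integral
  exists and agrees with the Bochner integral of condition (c).\<close>

lemma resolvent_family_integral_equation:
  fixes sc :: "complex \<Rightarrow> 'a \<Rightarrow> 'a::banach"
  assumes fam: "resolvent_family K sc \<alpha> \<beta> \<nu> D A G" and par: "0 < \<alpha>" "0 \<le> \<beta>" "0 < \<nu>" "\<nu> < 1"
    and z: "z \<in> D" and t: "0 \<le> t"
  shows "((\<lambda>s. (1 + one_conv_kappa \<alpha> \<beta> \<nu> (t - s)) *\<^sub>R A (G s z)) has_integral (G t z - z)) {0..t}"
proof -
  interpret weak_kernel \<alpha> \<beta> \<nu> 1 using par by unfold_locales auto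
  have AG: "A (G s z) = G s (A z)" if "s \<in> {0..t}" for s
    using fam z that by (auto simp: resolvent_family_def)
  have "continuous_on {0..t} (\<lambda>s. G s (A z))"
    using fam continuous_on_subset[of "{0..}" "\<lambda>s. G s (A z)" "{0..t}"] by (auto simp: resolvent_family_def)
  then have "continuous_on {0..t} (\<lambda>s. (1 + one_conv_kappa \<alpha> \<beta> \<nu> (t - s)) *\<^sub>R G s (A z))"
    by (intro continuous_on_scaleR continuous_on_add continuous_on_const
        continuous_on_compose2[OF continuous_mm_UNIV[of UNIV]] continuous_intros) auto
  then have "continuous_on {0..t} (\<lambda>s. (1 + one_conv_kappa \<alpha> \<beta> \<nu> (t - s)) *\<^sub>R A (G s z))"
    by (rule continuous_on_eq) (simp add: AG)
  then have i: "(\<lambda>s. (1 + one_conv_kappa \<alpha> \<beta> \<nu> (t - s)) *\<^sub>R A (G s z)) integrable_on {0..t}"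
    by (rule integrable_continuous_interval)
  obtain I where I: "strong_has_bochner_integral (lebesgue_on {0..t})
      (\<lambda>s. (1 + one_conv_kappa \<alpha> \<beta> \<nu> (t - s)) *\<^sub>R A (G s z)) I" "G t z = z + I"
    using fam z t unfolding resolvent_family_def by blast
  have "G t z - z = I" using I(2) by simp
  then show ?thesis
    using integrable_integral[OF i] strong_bochner_integral_eq_integral[OF I(1) i] by simp
qed

lemma resolvent_family_compact_smoothing:
  fixes scW :: "complex \<Rightarrow> 'w \<Rightarrow> 'w::banach"
  assumes W: "banach_over K scW" and T: "0 < T" and par: "0 < \<alpha>" "0 \<le> \<beta>" "0 < \<nu>" "\<nu> < 1"
    and A: "linear_operator K scW D A" and dense: "densely_defined D"
    and sect: "sectorial K scW D A (\<nu> * pi / 2)" and cres: "has_compact_resolvent K scW D A"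
    and fam: "resolvent_family K scW \<alpha> \<beta> \<nu> D A G"
  obtains C Q where "compact_smoothing G T C Q"
proof -
  have G: "bounded_linear (G t)" if "0 \<le> t" for t
    using fam that by (auto simp: resolvent_family_def bounded_operator_def)
  have Gc: "continuous_on {0..} (\<lambda>t. G t z)" for z using fam by (simp add: resolvent_family_def)
  have comm: "G t z \<in> D \<and> G t (A z) = A (G t z)" if "z \<in> D" "0 \<le> t" for z t
    using fam that by (simp add: resolvent_family_def)
  note int = resolvent_family_integral_equation[OF fam par]
  have dense: "closure D = UNIV" using dense by (simp add: densely_defined_def)
  show ?thesis
  proof (cases "K = UNIV")
    case True
    interpret complex_action scW
      using W unfolding banach_over_def True
      by unfold_locales (auto simp: mult_right_mono)
    obtain l where l: "l \<in> resolvent_set scW D A" "compact_operator (resolvent scW D A l)"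
      using cres True by (auto simp: has_compact_resolvent_def)
    show ?thesis
    proof (rule sectorial_compact_smoothing[OF _ dense _ _ _ l par T G Gc comm _ that])
      show "linear_operator UNIV scW D A" using A True by simp
      show "sectorial_complex scW norm D A (\<nu> * pi / 2)" using sect True by (simp add: sectorial_def)
      show "G t z = z + integral {0..t} (\<lambda>s. (1 + one_conv_kappa \<alpha> \<beta> \<nu> (t - s)) *\<^sub>R A (G s z))"
        if "z \<in> D" "0 \<le> t" for z t
        using integral_unique[OF int[OF that]] by simp
    qed auto
  next
    case False
    then have K: "K = \<real>" using W by (simp add: banach_over_def)
    interpret complex_action "cplx_scale :: complex \<Rightarrow> 'w \<times> 'w \<Rightarrow> 'w \<times> 'w" by (rule complex_action_cplx_scale)
    let ?D = "D \<times> D" and ?A = "map_prod A A" and ?G = "\<lambda>t. map_prod (G t) (G t)"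
    have scr: "scW (of_real r) x = r *\<^sub>R x" for r x using W by (simp add: banach_over_def)
    have Dr: "r *\<^sub>R x \<in> D" "A (r *\<^sub>R x) = r *\<^sub>R A x" if "x \<in> D" for r x
      using A that scr[of r] unfolding linear_operator_def K by (metis Reals_of_real)+
    have Da: "x + y \<in> D" "A (x + y) = A x + A y" if "x \<in> D" "y \<in> D" for x y
      using A that by (auto simp: linear_operator_def)
    have Ds: "x - y \<in> D" "A (x - y) = A x - A y" if "x \<in> D" "y \<in> D" for x y
      using Da[OF that(1) Dr(1)[OF that(2), of "-1"]] Dr(2)[OF that(2), of "-1"] by auto
    obtain l where l: "l \<in> resolvent_set cplx_scale ?D ?A" "compact_operator (resolvent cplx_scale ?D ?A l)"
      using cres False by (auto simp: has_compact_resolvent_def)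
    obtain C Q where "compact_smoothing ?G T C Q"
    proof (rule sectorial_compact_smoothing[where D="?D" and A="?A" and N=cplx_norm and G="?G", OF _ _ _ _ _ l par T])
      have "0 \<in> D" using A by (simp add: linear_operator_def)
      then show "linear_operator UNIV cplx_scale ?D ?A"
        unfolding linear_operator_def cplx_scale_def
        by (auto simp: Dr Da Ds zero_prod_def)
      show "closure ?D = UNIV" by (simp add: closure_Times dense)
      show "sectorial_complex cplx_scale cplx_norm ?D ?A (\<nu> * pi / 2)" using sect False by (simp add: sectorial_def)
      show "bounded_linear (?G t)" if "0 \<le> t" for t
        unfolding map_prod_def split_beta
        by (intro bounded_linear_Pair bounded_linear_compose[OF G[OF that]] bounded_linear_fst bounded_linear_snd)
      show "continuous_on {0..} (\<lambda>t. ?G t z)" for z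
        unfolding map_prod_def split_beta by (intro continuous_on_Pair Gc)
      show "?G t z \<in> ?D \<and> ?G t (?A z) = ?A (?G t z)" if "z \<in> ?D" "0 \<le> t" for z t
        using that comm by auto
      show "?G t z = z + integral {0..t} (\<lambda>s. (1 + one_conv_kappa \<alpha> \<beta> \<nu> (t - s)) *\<^sub>R ?A (?G s z))"
        if zD: "z \<in> ?D" and t: "0 \<le> t" for z t
      proof -
        obtain x y where z: "z = (x, y)" "x \<in> D" "y \<in> D" using zD by auto
        from integral_unique[OF has_integral_Pair[OF int[OF z(2) t] int[OF z(3) t]]]
        show ?thesis by (simp add: z)
      qed
    qed (auto intro: cplx_norm_bounds)
    then have C: "0 \<le> C" and Q: "\<And>n. 1 \<le> n \<Longrightarrow> bounded_linear (Q n)" "\<And>n. 1 \<le> n \<Longrightarrow> compact_operator (Q n)"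
      "\<And>n z. 1 \<le> n \<Longrightarrow> norm (Q n z) \<le> C * norm z"
      "\<And>n t z. 1 \<le> n \<Longrightarrow> 0 \<le> t \<Longrightarrow> ?G t (Q n z) = Q n (?G t z)"
      "\<And>n t z. 1 \<le> n \<Longrightarrow> 0 \<le> t \<Longrightarrow> t \<le> T \<Longrightarrow> t * norm (?G t z - Q n (?G t z)) \<le> C / sqrt (real n) * norm z"
      unfolding compact_smoothing_def by blast+
    \<comment> \<open>Q is known through \<open>compact_smoothing\<close> only. Embedding by x ->
      (x, 0) and projecting by \<open>fst\<close> preserves its properties: G acts componentwise on
      the complexification, so it commutes with both maps, and \<open>fst\<close> does not increase
      norms.\<close>
    define P where "P n x = fst (Q n (x, 0))" for n x
    have fst_le: "norm (fst q) \<le> norm q" for q :: "'w \<times> 'w"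
      using norm_fst_le[of "fst q" "snd q"] by simp
    have "compact_smoothing G T C P"
      unfolding compact_smoothing_def
    proof (intro conjI allI impI)
      fix n :: nat assume n: "1 \<le> n"
      show "bounded_linear (P n)"
        unfolding P_def
        by (intro bounded_linear_compose[OF bounded_linear_fst] bounded_linear_compose[OF Q(1)[OF n]]
            bounded_linear_Pair bounded_linear_ident bounded_linear_zero)
      show "compact_operator (P n)"
        unfolding compact_operator_def
      proof (intro allI impI)
        fix X :: "'w set" assume "bounded X"
        then have "bounded ((\<lambda>x. (x, 0 :: 'w)) ` X)"
          by (rule bounded_linear_image) (intro bounded_linear_Pair bounded_linear_ident bounded_linear_zero)
        then have "compact (closure (Q n ` (\<lambda>x. (x, 0)) ` X))" using Q(2)[OF n] by (simp add: compact_operator_def)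
        then have c: "compact (fst ` closure (Q n ` (\<lambda>x. (x, 0)) ` X))"
          by (intro compact_continuous_image continuous_intros)
        have "closure (P n ` X) \<subseteq> fst ` closure (Q n ` (\<lambda>x. (x, 0)) ` X)"
        proof (rule closure_minimal[OF _ compact_imp_closed[OF c]])
          show "P n ` X \<subseteq> fst ` closure (Q n ` (\<lambda>x. (x, 0)) ` X)"
            unfolding P_def by (rule image_subsetI) (intro imageI subsetD[OF closure_subset])
        qed
        with c show "compact (closure (P n ` X))" by (metis closed_closure compact_Int_closed inf.absorb_iff2)
      qed
      show "norm (P n z) \<le> C * norm z" for z
        using order_trans[OF fst_le Q(3)[OF n, of "(z, 0)"]] by (simp add: P_def norm_Pair)
      have G0: "G t 0 = 0" if "0 \<le> t" for t using linear_0[OF bounded_linear.linear[OF G[OF that]]] .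
      show "G t (P n z) = P n (G t z)" if "0 \<le> t" for t z
      proof -
        have "G t (P n z) = fst (?G t (Q n (z, 0)))" by (simp add: P_def)
        also have "\<dots> = P n (G t z)" unfolding Q(4)[OF n that] by (simp add: P_def G0 that)
        finally show ?thesis .
      qed
      show "t * norm (G t z - P n (G t z)) \<le> C / sqrt (real n) * norm z" if t: "0 \<le> t" "t \<le> T" for t z
      proof -
        have "G t z - P n (G t z) = fst (?G t (z, 0) - Q n (?G t (z, 0)))"
          by (simp add: P_def G0 t)
        then have "norm (G t z - P n (G t z)) \<le> norm (?G t (z, 0) - Q n (?G t (z, 0)))"
          by (simp only: fst_le)
        then have "t * norm (G t z - P n (G t z)) \<le> t * norm (?G t (z, 0) - Q n (?G t (z, 0)))"
          using t by (intro mult_left_mono)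
        also have "\<dots> \<le> C / sqrt (real n) * norm (z, 0 :: 'w)" by (rule Q(5)[OF n t])
        finally show ?thesis by (simp add: norm_Pair)
      qed
    qed (rule C)
    then show ?thesis by (rule that)
  qed
qed

theorem theorem2p9:
  fixes K :: "complex set"
    and scW :: "complex \<Rightarrow> 'w \<Rightarrow> 'w::banach"
    and scU :: "complex \<Rightarrow> 'u \<Rightarrow> 'u::banach"
    and T \<alpha> \<beta> \<nu> :: real
    and D :: "'w set" and A :: "'w \<Rightarrow> 'w"
    and G :: "real \<Rightarrow> 'w \<Rightarrow> 'w"
    and B :: "'u \<Rightarrow> 'w"
    and \<zeta> :: 'w
    and f :: "real \<Rightarrow> 'w \<Rightarrow> 'w"
    and \<gamma> :: "real \<Rightarrow> real"
    and u :: "real \<Rightarrow> 'u"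
  assumes "banach_over K scW" and "banach_over K scU"
    and "T > 0" and "\<alpha> > 0" and "\<beta> \<ge> 0" and "0 < \<nu>" and "\<nu> < 1"
    and "linear_operator K scW D A" and "closed_operator D A" and "densely_defined D"
    and "sectorial K scW D A (\<nu> * pi / 2)"
    and "has_compact_resolvent K scW D A"
    and "resolvent_family K scW \<alpha> \<beta> \<nu> D A G"
    and "bounded_operator K scU scW B"
    and "AE t in lebesgue_on {0..T}. continuous_on UNIV (f t)"
    and "\<And>w. strongly_measurable (lebesgue_on {0..T}) (\<lambda>t. f t w)"
    and "integrable (lebesgue_on {0..T}) \<gamma>" and "\<And>t. t \<in> {0..T} \<Longrightarrow> \<gamma> t \<ge> 0"
    and "AE t in lebesgue_on {0..T}. \<forall>w. norm (f t w) \<le> \<gamma> t"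
    and "strongly_measurable (lebesgue_on {0..T}) u"
    and "integrable (lebesgue_on {0..T}) (\<lambda>t. (norm (u t))\<^sup>2)"
  shows "\<exists>w. mild_solution T G B f u \<zeta> w"
proof -
  let ?L = "lebesgue_on {0..T}"
  have L: "complete_measure ?L" by (rule complete_measure_lebesgue_on) simp
  have fin: "finite_measure ?L" by (rule finite_measure_lebesgue_on) simp
  have B: "bounded_linear B" using assms by (simp add: bounded_operator_def)
  then obtain b where b: "0 \<le> b" "\<And>x. norm (B x) \<le> norm x * b" using bounded_linear.nonneg_bounded by blast
  have G: "bounded_linear (G t)" if "0 \<le> t" for t
    using assms(13) that by (auto simp: resolvent_family_def bounded_operator_def)
  have Gc: "continuous_on {0..} (\<lambda>t. G t z)" and G0: "G 0 z = z" for z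
    using assms(13) by (auto simp: resolvent_family_def)
  obtain C Q where "compact_smoothing G T C Q"
    by (rule resolvent_family_compact_smoothing[OF assms(1,3-8,10-13)])
  then have C: "0 \<le> C" and Q: "\<And>n. 1 \<le> n \<Longrightarrow> bounded_linear (Q n)" "\<And>n. 1 \<le> n \<Longrightarrow> compact_operator (Q n)"
    "\<And>n z. 1 \<le> n \<Longrightarrow> norm (Q n z) \<le> C * norm z"
    "\<And>n t z. 1 \<le> n \<Longrightarrow> 0 \<le> t \<Longrightarrow> G t (Q n z) = Q n (G t z)"
    "\<And>n t z. 1 \<le> n \<Longrightarrow> 0 \<le> t \<Longrightarrow> t \<le> T \<Longrightarrow> t * norm (G t z - Q n (G t z)) \<le> C / sqrt (real n) * norm z"
    unfolding compact_smoothing_def by blast+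
  \<comment> \<open>By strong continuity every orbit is bounded on the compact interval
    [0, T].\<close>
  obtain M where M: "0 \<le> M" "\<And>t z. t \<in> {0..T} \<Longrightarrow> norm (G t z) \<le> M * norm z"
  proof (rule uniform_boundedness[of "{0..T}" G])
    show "bounded_linear (G t)" if "t \<in> {0..T}" for t using that by (intro G) simp
    show "bounded ((\<lambda>t. G t z) ` {0..T})" for z
      by (intro compact_imp_bounded compact_continuous_image continuous_on_subset[OF Gc] compact_Icc) auto
  qed blast
  define p where "p s = B (u s)" for s
  have p: "strongly_measurable ?L p"
    unfolding p_def
    by (rule strongly_measurable_compose[OF assms(20) bounded_linear.continuous_on[OF B continuous_on_id]])
  have "integrable ?L (\<lambda>s. norm (p s))"
  proof (rule Bochner_Integration.integrable_bound)
    \<comment> \<open>L2 is embedded into L1 by norm u <= 1 + (norm u)^2, constants being integrable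
      on [0, T].\<close>
    show "integrable ?L (\<lambda>s. b * (1 + (norm (u s))\<^sup>2))"
      using assms(21) finite_measure.integrable_const[OF fin] by (intro integrable_mult_right Bochner_Integration.integrable_add) auto
    show "(\<lambda>s. norm (p s)) \<in> borel_measurable ?L" by (rule strongly_measurable_norm[OF L p])
    show "AE s in ?L. norm (norm (p s)) \<le> norm (b * (1 + (norm (u s))\<^sup>2))"
    proof (rule AE_I2)
      fix s
      have "norm (u s) \<le> 1 + (norm (u s))\<^sup>2"
        using zero_le_power2[of "norm (u s) - 1"] norm_ge_zero[of "u s"] by (simp add: power2_eq_square algebra_simps del: norm_ge_zero)
      then have "norm (u s) * b \<le> (1 + (norm (u s))\<^sup>2) * b" using b(1) by (rule mult_right_mono)
      then show "norm (norm (p s)) \<le> norm (b * (1 + (norm (u s))\<^sup>2))"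
        using b(2)[of "u s"] b(1) by (simp add: p_def abs_mult mult.commute)
    qed
  qed
  \<comment> \<open>The absolute value is there because \<open>smoothing_family\<close> wants a
    bound that is nonnegative on the whole line, while \<gamma> is known to be so on [0, T].\<close>
  then have h: "integrable ?L (\<lambda>s. norm (p s) + \<bar>\<gamma> s\<bar>)"
    using assms(17) by (intro Bochner_Integration.integrable_add integrable_abs)
  have M': "norm (G t z) \<le> M * norm z" if "0 \<le> t" "t \<le> T" for t z
    using that by (intro M(2)) simp
  interpret smoothing_family G Q T C M "\<lambda>s. norm (p s) + \<bar>\<gamma> s\<bar>"
    by (rule smoothing_family.intro) (assumption | rule assms(3) C M(1) G Gc G0 M' Q h | simp)+
  have bound: "AE s in ?L. \<forall>x. norm (p s + f s x) \<le> norm (p s) + \<bar>\<gamma> s\<bar>"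
    using assms(19)
  proof eventually_elim
    fix s assume f: "\<forall>w. norm (f s w) \<le> \<gamma> s"
    show "\<forall>x. norm (p s + f s x) \<le> norm (p s) + \<bar>\<gamma> s\<bar>"
    proof
      fix x
      have "norm (f s x) \<le> \<bar>\<gamma> s\<bar>" using f[rule_format, of x] by linarith
      then show "norm (p s + f s x) \<le> norm (p s) + \<bar>\<gamma> s\<bar>" using norm_triangle_ineq[of "p s" "f s x"] by linarith
    qed
  qed
  show ?thesis
  proof (rule fixed_point[OF assms(15,16) bound p, of \<zeta>])
    fix w assume w: "continuous_on {0..T} w"
      and sol: "\<And>t. t \<in> {0..T} \<Longrightarrow>
        strong_has_bochner_integral (lebesgue_on {0..t}) (\<lambda>s. G (t - s) (p s + f s (w s))) (w t - G t \<zeta>)"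
    have "mild_solution T G B f u \<zeta> w"
      unfolding mild_solution_def
    proof (intro conjI ballI)
      fix t assume "t \<in> {0..T}"
      from sol[OF this]
      show "\<exists>I. strong_has_bochner_integral (lebesgue_on {0..t}) (\<lambda>s. G (t - s) (B (u s) + f s (w s))) I \<and> w t = G t \<zeta> + I"
        unfolding p_def by (intro exI[of _ "w t - G t \<zeta>"] conjI) simp_all
    qed (rule w)
    then show ?thesis by (intro exI[of _ w])
  qed
qed

end
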